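(* Assume the data generating conditions (i)-(iv) of the context, that every basis function $\phi_k$ is Lipschitz continuous, that there are $s>0$ and a finite $C_s>0$ with $\sum_{k\ge1}k^{2s}\|\beta_k\|^2_{L^2(\mathcal U)}\le C_s$, and that $(t,t')\mapsto\Gamma_X(t,t')$ is continuous on $\mathcal T\times\mathcal T$. Let $\{\omega_{ij}\}$ be deterministic admissible weights (as defined in the context). Then for each integer $K\ge1$, $$\mathcal R(\widehat\mu;K)\le\Bigl(\sum_{i,j}\omega_{ij}^2\Bigr)\Bigl(C_1K-\|\mu\|^2_{L^2(\mathcal U\times\mathcal T)}+C_sK^{-2s}\Bigr)+\Bigl[\sum_{i}\sum_{j\ne j'}\omega_{ij}\omega_{ij'}\Bigr]_+C_2+C_sK^{-2s},$$ where $C_2=\mathbb E\bigl[\|X\|^2_{L^2(\mathcal U\times\mathcal T)}\bigr]$, $C_1=\bigl(\sup_{t\in\mathcal T}\|\mu(\cdot,t)\|^2_{L^2(\mathcal U)}+\|\Gamma_X\|_\infty+\|\tau\|_\infty^2\,\nu(\mathcal U)\bigr)/g_{\min}$ and $[x]_+=\max(x,0)$.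
   Context: $\mathcal T\subset\mathbb R$ is a compact interval with Lebesgue measure; $(\mathcal U,d_{\mathcal U})$ is a separable metric space with its Borel $\sigma$-field and a finite Borel measure $\nu$. For subjects $i=1,\dots,n$ and visits $j=1,\dots,m_i$ ($m_i\ge1$ deterministic), one observes $(T_{ij},Y_{ij}(\cdot))$ with $$Y_{ij}(u)=\mu(u,T_{ij})+X_i(u,T_{ij})+\varepsilon_{ij}(u),\quad u\in\mathcal U,$$ where $\mu\in L^2(\mathcal U\times\mathcal T)$ is deterministic. $M=m_1+\dots+m_n$. Data generating conditions: (i) the $X_i$ are independent copies of a random field $X$ on $\mathcal U\times\mathcal T$ with $\mathbb E\|X\|^2_{L^2(\mathcal U\times\mathcal T)}<\infty$ and $\mathbb E[X(u,t)]=0$ for all $(u,t)$; (ii) the $T_{ij}$ are i.i.d. copies of $T$ with Lipschitz continuous density $g$, positive on $\mathcal T$; $g_{\min}=\inf_{\mathcal T}g$; (iii) $\varepsilon_{ij}(u)=\tau(T_{ij})\eta_{ij}(u)$ with $\tau:\mathcal T\to\mathbb R_+$ bounded deterministic and $\eta_{ij}$ i.i.d. random fields on $\mathcal U$ with $\mathbb E[\eta_{ij}(u)]=0$, $\mathrm{Var}(\eta_{ij}(u))=1$ for all $u$; (iv) the collections $\{T_{ij}\}$, $\{X_i\}$, $\{\eta_{ij}\}$ are mutually independent. $\Gamma_X(t,t')=\mathbb E\langle X(\cdot,t),X(\cdot,t')\rangle_{L^2(\mathcal U)}$; $\|\cdot\|_\infty$ is the sup norm. $\{\phi_k\}_{k\ge1}$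 is an orthonormal basis of $L^2(\mathcal T)$ and $\beta_k(u)=\int_{\mathcal T}\mu(u,t)\phi_k(t)\,dt$. Estimator (with $g$ known): $\widehat\beta_k(u)=\sum_{i=1}^n\sum_{j=1}^{m_i}\omega_{ij}Y_{ij}(u)\phi_k(T_{ij})/g(T_{ij})$, $\widehat\mu_K(u,t)=\sum_{k=1}^K\widehat\beta_k(u)\phi_k(t)$, and $\mathcal R(\widehat\mu;K)=\mathbb E\|\widehat\mu_K-\mu\|^2_{L^2(\mathcal U\times\mathcal T)}$. Admissible weights: $\sum_{i,j}\omega_{ij}=1$; for any integrable $\psi(T)$, $\sum_{i,j}\mathbb E[\omega_{ij}\psi(T_{ij})]=\mathbb E[\psi(T)]$; and there is a constant $C_0\ge0$ with $\sum_{i,j}\omega_{ij}^2\le1+C_0M^{-1}$.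
   Formalization: Random fields X, X_i, η_ij are assumed jointly measurable w.r.t. the σ-field they generate, and τ measurable; with mere joint measurability the bound fails, e.g. X(u,t)=1{t=T_11} is a.s. zero at each point yet X(u,T_11)=1. *)

theory Defs
  imports "HOL-Probability.Probability"
begin

section \<open>Square-integrable functions\<close>

text \<open>
  Elements of \<open>L\<^sup>2(N)\<close> are represented by measurable functions. The squared norm is
  \<open>[0,\<infinity>]\<close>-valued, so that it is meaningful without an integrability proviso; the same
  holds for the supremum norm.
\<close>

definition square_integrable :: "'s measure \<Rightarrow> ('s \<Rightarrow> real) \<Rightarrow> bool" where
  "square_integrable N f \<longleftrightarrow> f \<in> borel_measurable N \<and> integrable N (\<lambda>x. (f x)\<^sup>2)"

definition sq_norm :: "'s measure \<Rightarrow> ('s \<Rightarrow> real) \<Rightarrow> ennreal" where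
  "sq_norm N f = (\<integral>\<^sup>+x. ennreal ((f x)\<^sup>2) \<partial>N)"

definition sup_norm :: "'s set \<Rightarrow> ('s \<Rightarrow> real) \<Rightarrow> ennreal" where
  "sup_norm A f = (SUP x\<in>A. ennreal \<bar>f x\<bar>)"

definition orthonormal_basis :: "'s measure \<Rightarrow> (nat \<Rightarrow> 's \<Rightarrow> real) \<Rightarrow> bool" where
  "orthonormal_basis N \<phi> \<longleftrightarrow>
     (\<forall>k\<ge>1. square_integrable N (\<phi> k)) \<and>
     (\<forall>k\<ge>1. \<forall>l\<ge>1. (\<integral>x. \<phi> k x * \<phi> l x \<partial>N) = (if k = l then 1 else 0)) \<and>
     (\<forall>f. square_integrable N f \<longrightarrow>
        (\<lambda>n. sq_norm N (\<lambda>x. f x - (\<Sum>k=1..n. (\<integral>y. f y * \<phi> k y \<partial>N) * \<phi> k x)))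
          \<longlonglongrightarrow> 0)"

abbreviation interval_lebesgue :: "real \<Rightarrow> real \<Rightarrow> real measure" where
  "interval_lebesgue a b \<equiv> restrict_space lborel {a..b}"


section \<open>Random fields\<close>

definition path_space :: "'s measure \<Rightarrow> ('s \<Rightarrow> real) measure" where
  "path_space S = (\<Pi>\<^sub>M s\<in>space S. borel)"

definition field_path :: "'s measure \<Rightarrow> ('s \<Rightarrow> 'w \<Rightarrow> real) \<Rightarrow> 'w \<Rightarrow> 's \<Rightarrow> real" where
  "field_path S X w = (\<lambda>s\<in>space S. X s w)"

definition field_algebra :: "'w measure \<Rightarrow> 's measure \<Rightarrow> ('s \<Rightarrow> 'w \<Rightarrow> real) \<Rightarrow> 'w measure" where
  "field_algebra P S X = vimage_algebra (space P) (field_path S X) (path_space S)"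

text \<open>
  Joint measurability is required with respect to the \<open>\<sigma>\<close>-field generated by the
  field itself. Joint measurability with respect to the \<open>\<sigma>\<close>-field of \<open>P\<close> would not be
  enough to evaluate a field at an independent random point: if the law of \<open>T\<close> has no
  atoms, then the field \<open>X t w = (if t = T w then 1 else 0)\<close> is jointly measurable, each
  of its coordinates vanishes almost surely and hence the field is independent of
  \<open>T\<close>, but \<open>X (T w) w = 1\<close>.
\<close>

definition random_field :: "'w measure \<Rightarrow> 's measure \<Rightarrow> ('s \<Rightarrow> 'w \<Rightarrow> real) \<Rightarrow> bool" where
  "random_field P S X \<longleftrightarrow>
     field_path S X \<in> P \<rightarrow>\<^sub>M path_space S \<and>
     (\<lambda>(w, s). X s w) \<in> borel_measurable (field_algebra P S X \<Otimes>\<^sub>M S)"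

definition same_field_law ::
    "'w measure \<Rightarrow> 's measure \<Rightarrow> ('s \<Rightarrow> 'w \<Rightarrow> real) \<Rightarrow> ('s \<Rightarrow> 'w \<Rightarrow> real) \<Rightarrow> bool" where
  "same_field_law P S X X' \<longleftrightarrow>
     distr P (path_space S) (field_path S X) = distr P (path_space S) (field_path S X')"

definition indep_fields ::
    "'w measure \<Rightarrow> 's measure \<Rightarrow> ('i \<Rightarrow> 's \<Rightarrow> 'w \<Rightarrow> real) \<Rightarrow> 'i set \<Rightarrow> bool" where
  "indep_fields P S X I \<longleftrightarrow>
     prob_space.indep_vars P (\<lambda>_. path_space S) (\<lambda>i. field_path S (X i)) I"

definition joint_sigma :: "'w measure \<Rightarrow> 'i set \<Rightarrow> ('i \<Rightarrow> 'w measure) \<Rightarrow> 'w set set" where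
  "joint_sigma P I F = sigma_sets (space P) (\<Union>i\<in>I. sets (F i))"

text \<open>The covariance kernel \<open>E \<langle>X(\<cdot>,t), X(\<cdot>,t')\<rangle>\<close> in \<open>L\<^sup>2(\<nu>)\<close>.\<close>

definition cov_kernel ::
    "'w measure \<Rightarrow> 'u measure \<Rightarrow> ('u \<times> real \<Rightarrow> 'w \<Rightarrow> real) \<Rightarrow> real \<times> real \<Rightarrow> real" where
  "cov_kernel P \<nu> X = (\<lambda>(t, t'). \<integral>w. (\<integral>u. X (u, t) w * X (u, t') w \<partial>\<nu>) \<partial>P)"


section \<open>The sampling design, the weights and the estimator\<close>

definition visits :: "nat \<Rightarrow> (nat \<Rightarrow> nat) \<Rightarrow> (nat \<times> nat) set" where
  "visits n m = (SIGMA i:{1..n}. {1..m i})"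

definition admissible_weights ::
    "'w measure \<Rightarrow> real measure \<Rightarrow> nat \<Rightarrow> (nat \<Rightarrow> nat) \<Rightarrow> ('w \<Rightarrow> real) \<Rightarrow>
     (nat \<Rightarrow> nat \<Rightarrow> 'w \<Rightarrow> real) \<Rightarrow> (nat \<Rightarrow> nat \<Rightarrow> real) \<Rightarrow> bool" where
  "admissible_weights P L n m T\<^sub>0 T \<omega> \<longleftrightarrow>
     (\<Sum>(i, j)\<in>visits n m. \<omega> i j) = 1 \<and>
     (\<forall>\<psi>. \<psi> \<in> borel_measurable L \<longrightarrow> integrable P (\<lambda>w. \<psi> (T\<^sub>0 w)) \<longrightarrow>
        (\<Sum>(i, j)\<in>visits n m. \<integral>w. \<omega> i j * \<psi> (T i j w) \<partial>P) = (\<integral>w. \<psi> (T\<^sub>0 w) \<partial>P)) \<and>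
     (\<exists>C\<^sub>0\<ge>0. (\<Sum>(i, j)\<in>visits n m. (\<omega> i j)\<^sup>2) \<le> 1 + C\<^sub>0 / real (\<Sum>i=1..n. m i))"

definition basis_coeff ::
    "real measure \<Rightarrow> (nat \<Rightarrow> real \<Rightarrow> real) \<Rightarrow> ('u \<times> real \<Rightarrow> real) \<Rightarrow> nat \<Rightarrow> 'u \<Rightarrow> real" where
  "basis_coeff L \<phi> \<mu> k u = (\<integral>t. \<mu> (u, t) * \<phi> k t \<partial>L)"

definition beta_hat ::
    "nat \<Rightarrow> (nat \<Rightarrow> nat) \<Rightarrow> (nat \<Rightarrow> nat \<Rightarrow> real) \<Rightarrow> (nat \<Rightarrow> nat \<Rightarrow> 'u \<Rightarrow> 'w \<Rightarrow> real) \<Rightarrow>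
     (nat \<Rightarrow> nat \<Rightarrow> 'w \<Rightarrow> real) \<Rightarrow> (real \<Rightarrow> real) \<Rightarrow> (nat \<Rightarrow> real \<Rightarrow> real) \<Rightarrow>
     nat \<Rightarrow> 'u \<Rightarrow> 'w \<Rightarrow> real" where
  "beta_hat n m \<omega> Y T g \<phi> k u w =
     (\<Sum>(i, j)\<in>visits n m. \<omega> i j * Y i j u w * \<phi> k (T i j w) / g (T i j w))"

definition mu_hat ::
    "nat \<Rightarrow> (nat \<Rightarrow> nat) \<Rightarrow> (nat \<Rightarrow> nat \<Rightarrow> real) \<Rightarrow> (nat \<Rightarrow> nat \<Rightarrow> 'u \<Rightarrow> 'w \<Rightarrow> real) \<Rightarrow>
     (nat \<Rightarrow> nat \<Rightarrow> 'w \<Rightarrow> real) \<Rightarrow> (real \<Rightarrow> real) \<Rightarrow> (nat \<Rightarrow> real \<Rightarrow> real) \<Rightarrow>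
     nat \<Rightarrow> 'u \<times> real \<Rightarrow> 'w \<Rightarrow> real" where
  "mu_hat n m \<omega> Y T g \<phi> K = (\<lambda>(u, t) w. \<Sum>k=1..K. beta_hat n m \<omega> Y T g \<phi> k u w * \<phi> k t)"

definition risk :: "'w measure \<Rightarrow> 's measure \<Rightarrow> ('s \<Rightarrow> 'w \<Rightarrow> real) \<Rightarrow> ('s \<Rightarrow> real) \<Rightarrow> ennreal" where
  "risk P N est \<mu> = (\<integral>\<^sup>+w. sq_norm N (\<lambda>x. est x w - \<mu> x) \<partial>P)"


section \<open>The constants\<close>

text \<open>
  \<open>C1\<close> may be infinite, since \<open>\<mu> \<in> L\<^sup>2\<close> does not bound \<open>sup\<^sub>t \<parallel>\<mu>(\<cdot>,t)\<parallel>\<close>.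
\<close>

definition C1 ::
    "'w measure \<Rightarrow> 'u measure \<Rightarrow> real \<Rightarrow> real \<Rightarrow> ('u \<times> real \<Rightarrow> real) \<Rightarrow>
     ('u \<times> real \<Rightarrow> 'w \<Rightarrow> real) \<Rightarrow> (real \<Rightarrow> real) \<Rightarrow> (real \<Rightarrow> real) \<Rightarrow> ennreal" where
  "C1 P \<nu> a b \<mu> X \<tau> g =
     ((SUP t\<in>{a..b}. sq_norm \<nu> (\<lambda>u. \<mu> (u, t)))
        + sup_norm ({a..b} \<times> {a..b}) (cov_kernel P \<nu> X)
        + (sup_norm {a..b} \<tau>)\<^sup>2 * emeasure \<nu> (space \<nu>))
     / ennreal (INF t\<in>{a..b}. g t)"

definition C2 :: "'w measure \<Rightarrow> 's measure \<Rightarrow> ('s \<Rightarrow> 'w \<Rightarrow> real) \<Rightarrow> ennreal" where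
  "C2 P N X = (\<integral>\<^sup>+w. sq_norm N (\<lambda>x. X x w) \<partial>P)"

end

(* For almost every u the problem is a scalar one. Given the noise algebra generated by the X_i
   and eta_ij, the design points T_ij are still i.i.d. with density g, so each summand of the
   estimator can be integrated over its own design point. Centred at beta_k(u), the integrated
   summands are (integral of X_i(u,t) phi_k(t) dt) + const * eta_ij(u). For distinct visits these
   are uncorrelated unless both visits belong to the same subject, and then their covariance is
   the second moment of the k-th coefficient of X(u,.), the same for all subjects. This gives the
   variance at u exactly; Bessel's inequality summed over k bounds the within-subject terms by C2,
   Tonelli bounds the diagonal terms by C1, and Parseval's identity splits both the risk and the
   norm of mu into coefficients up to K and a tail controlled by the smoothness assumption. *)
theory Submission
  imports Defs
begin

section \<open>Freezing an independent design\<close>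

text \<open>Two obstacles shape the proof. First, a field is evaluated at a random time. Freezing is
  therefore expressed by a law on pairs: the sample point w, seen only through the noise algebra,
  together with the design point, has a product law, and everything substituted into it must be
  measurable for the noise algebra and not merely for \<open>P\<close>. Second, equality in law of
  the fields lives on the product sigma-field, where a path integral is in general not measurable.
  Coefficients of the copies are therefore compared with those of \<open>X\<close> only through
  second moments, rewritten as double integrals of two-point moments. The term with the negative
  sign arises because centring turns each diagonal second moment J into J - beta_k(u)^2. Summed over
  k up to K and integrated over u, the squares give the squared norm of mu minus its tail, which
  explains one C_s K^(-2s); the other is the squared bias. Because C1 may be infinite, the
  subtracted term stays on the left of every inequality until the last step.\<close>

lemma integrable_product_of_squares:
  fixes f h :: "'x \<Rightarrow> real"
  assumes [measurable]: "f \<in> borel_measurable N" "h \<in> borel_measurable N"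
    and "integrable N (\<lambda>x. (f x)\<^sup>2)" "integrable N (\<lambda>x. (h x)\<^sup>2)"
  shows "integrable N (\<lambda>x. f x * h x)"
proof (rule Bochner_Integration.integrable_bound)
  show "integrable N (\<lambda>x. (f x)\<^sup>2 + (h x)\<^sup>2)" using assms by auto
  have "\<bar>x * y\<bar> \<le> x\<^sup>2 + y\<^sup>2" for x y :: real
  proof -
    have "0 \<le> \<bar>x\<bar> * \<bar>y\<bar>" by simp
    with sum_squares_bound[of "\<bar>x\<bar>" "\<bar>y\<bar>"] show ?thesis unfolding abs_mult power2_abs by linarith
  qed
  then show "AE x in N. norm (f x * h x) \<le> norm ((f x)\<^sup>2 + (h x)\<^sup>2)"
    by simp
qed simp

text \<open>The hypothesis has the form in which Fubini delivers it for almost every frozen w. A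
  constant factor leaves a Bochner integral unconditionally, so iterating the integral gives the
  product.\<close>

lemma integral_pair_mult:
  fixes f h :: "'t \<Rightarrow> real"
  assumes "sigma_finite_measure N" "integrable (N \<Otimes>\<^sub>M N) (\<lambda>(x, y). f x * h y)"
  shows "(\<integral>p. (case p of (x, y) \<Rightarrow> f x * h y) \<partial>(N \<Otimes>\<^sub>M N)) = (\<integral>x. f x \<partial>N) * (\<integral>x. h x \<partial>N)"
proof -
  interpret sigma_finite_measure N by fact
  interpret pair_sigma_finite N N ..
  show ?thesis using integral_fst'[OF assms(2)] by simp
qed

lemma (in prob_space) indep_var_of_indep_set:
  assumes FG: "indep_set (sets F) (sets G)" "subalgebra M F" "subalgebra M G"
    and S: "S \<in> F \<rightarrow>\<^sub>M N" and R: "R \<in> G \<rightarrow>\<^sub>M N'"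
  shows "indep_var N S N' R"
proof -
  have sp: "space F = space M" "space G = space M"
    using FG by (auto simp: subalgebra_def)
  have "sigma_sets (space M) {S -` A \<inter> space M |A. A \<in> sets N} \<subseteq> sets F"
    using sets.sigma_sets_subset[of "{S -` A \<inter> space M |A. A \<in> sets N}" F] measurable_sets[OF S] sp by auto
  moreover have "sigma_sets (space M) {R -` A \<inter> space M |A. A \<in> sets N'} \<subseteq> sets G"
    using sets.sigma_sets_subset[of "{R -` A \<inter> space M |A. A \<in> sets N'}" G] measurable_sets[OF R] sp by auto
  ultimately have "indep_set (sigma_sets (space M) {S -` A \<inter> space M |A. A \<in> sets N})
       (sigma_sets (space M) {R -` A \<inter> space M |A. A \<in> sets N'})"
    using FG(1) unfolding indep_set_def
    by (elim indep_sets_mono_sets) (auto split: bool.splits)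
  then show ?thesis
    using measurable_from_subalg[OF FG(2) S] measurable_from_subalg[OF FG(3) R]
    by (simp add: indep_var_eq)
qed

text \<open>
  The library's \<open>indep_var\<close> forces both variables to have the same type, so the product law
  is obtained here from the independence of the generated algebras.
\<close>

lemma (in prob_space) distr_Pair_of_indep_set:
  assumes FG: "indep_set (sets F) (sets G)" "subalgebra M F" "subalgebra M G"
    and S: "S \<in> F \<rightarrow>\<^sub>M N" and R: "R \<in> G \<rightarrow>\<^sub>M N'"
  shows "distr M (N \<Otimes>\<^sub>M N') (\<lambda>w. (S w, R w)) = distr M N S \<Otimes>\<^sub>M distr M N' R"
proof -
  have [measurable]: "S \<in> M \<rightarrow>\<^sub>M N" "R \<in> M \<rightarrow>\<^sub>M N'"
    using measurable_from_subalg[OF FG(2) S] measurable_from_subalg[OF FG(3) R] by auto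
  have sp: "space F = space M" "space G = space M"
    using FG by (auto simp: subalgebra_def)
  interpret SP: prob_space "distr M N S" by (rule prob_space_distr) simp
  interpret RP: prob_space "distr M N' R" by (rule prob_space_distr) simp
  show ?thesis
  proof (rule pair_measure_eqI[symmetric])
    fix A B assume AB: "A \<in> sets (distr M N S)" "B \<in> sets (distr M N' R)"
    have 1: "S -` A \<inter> space M \<in> sets F" "R -` B \<inter> space M \<in> sets G"
      using measurable_sets[OF S, of A] measurable_sets[OF R, of B] AB sp by auto
    have "(\<lambda>w. (S w, R w)) -` (A \<times> B) \<inter> space M = (S -` A \<inter> space M) \<inter> (R -` B \<inter> space M)"
      by auto
    then show "emeasure (distr M N S) A * emeasure (distr M N' R) B =
        emeasure (distr M (N \<Otimes>\<^sub>M N') (\<lambda>w. (S w, R w))) (A \<times> B)"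
      using AB indep_setD[OF FG(1) 1]
      by (simp add: emeasure_distr emeasure_eq_measure ennreal_mult)
  qed (unfold_locales, auto)
qed

text \<open>
  \<open>F\<close> carries the design points \<open>T p\<close> and \<open>G\<close> the noise; \<open>PG\<close> is \<open>P\<close> restricted to \<open>G\<close>, and \<open>D\<close> the
  law of one design point.
\<close>

locale frozen_design = prob_space P for P :: "'w measure" +
  fixes L :: "'t measure" and F G :: "'w measure" and I :: "'p set"
    and T :: "'p \<Rightarrow> 'w \<Rightarrow> 't" and g :: "'t \<Rightarrow> real"
  assumes finite_I: "finite I"
    and finite_L: "finite_measure L"
    and F: "subalgebra P F" and G: "subalgebra P G"
    and FG: "indep_set (sets G) (sets F)"
    and T_F: "\<And>p. p \<in> I \<Longrightarrow> T p \<in> F \<rightarrow>\<^sub>M L"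
    and T_indep: "indep_vars (\<lambda>_. L) T I"
    and T_law: "\<And>p. p \<in> I \<Longrightarrow> distr P L (T p) = density L (\<lambda>t. ennreal (g t))"
    and I_ne: "I \<noteq> {}"
    and g_meas [measurable]: "g \<in> borel_measurable L"
    and g_pos: "\<And>t. t \<in> space L \<Longrightarrow> 0 < g t"
begin

definition "D = density L (\<lambda>t. ennreal (g t))"
definition "PG = distr P G (\<lambda>w. w)"

lemma id_G: "(\<lambda>w. w) \<in> P \<rightarrow>\<^sub>M G"
  using measurable_from_subalg[OF G, of "\<lambda>w. w" G] by simp

lemma T_meas: "p \<in> I \<Longrightarrow> T p \<in> P \<rightarrow>\<^sub>M L"
  using measurable_from_subalg[OF F T_F] .

lemma prob_D: "prob_space D"
proof -
  obtain p where "p \<in> I" using I_ne by auto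
  then have "prob_space (distr P L (T p))" using T_meas by (rule_tac prob_space_distr)
  with \<open>p \<in> I\<close> show ?thesis by (simp add: D_def T_law)
qed

lemma prob_PG: "prob_space PG"
  unfolding PG_def by (rule prob_space_distr[OF id_G])

lemma sets_D [simp, measurable_cong]: "sets D = sets L" and space_D [simp]: "space D = space L"
  by (simp_all add: D_def)

lemma sets_PG [simp, measurable_cong]: "sets PG = sets G" and space_PG [simp]: "space PG = space G"
  by (simp_all add: PG_def)

text \<open>This is conditioning on the noise without a conditional expectation: the identity into
  \<open>G\<close> carries all the noise, \<open>T p\<close> is \<open>F\<close>-measurable, and
  independence of the two algebras makes the law a product. It may be applied to f (w, T p w) as
  soon as f is jointly measurable for \<open>G\<close> and \<open>L\<close>.\<close>

lemma frozen_law: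
  assumes p: "p \<in> I"
  shows "distr P (G \<Otimes>\<^sub>M L) (\<lambda>w. (w, T p w)) = PG \<Otimes>\<^sub>M D"
  using distr_Pair_of_indep_set[OF FG G F _ T_F[OF p], of "\<lambda>w. w" G] T_law[OF p]
  by (simp add: PG_def D_def)

text \<open>Two sources of independence meet here: the pair of design points is independent of the
  noise because both are \<open>F\<close>-measurable, and the points are independent of each other
  by \<open>T_indep\<close>.\<close>

lemma frozen_law_pair:
  assumes p: "p \<in> I" "q \<in> I" "p \<noteq> q"
  shows "distr P (G \<Otimes>\<^sub>M (L \<Otimes>\<^sub>M L)) (\<lambda>w. (w, (T p w, T q w))) = PG \<Otimes>\<^sub>M (D \<Otimes>\<^sub>M D)"
proof -
  have "(\<lambda>w. (T p w, T q w)) \<in> F \<rightarrow>\<^sub>M L \<Otimes>\<^sub>M L"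
    using T_F p by auto
  then have 1: "PG \<Otimes>\<^sub>M distr P (L \<Otimes>\<^sub>M L) (\<lambda>w. (T p w, T q w))
      = distr P (G \<Otimes>\<^sub>M (L \<Otimes>\<^sub>M L)) (\<lambda>w. (w, (T p w, T q w)))"
    using distr_Pair_of_indep_set[OF FG G F, of "\<lambda>w. w" G "\<lambda>w. (T p w, T q w)" "L \<Otimes>\<^sub>M L"]
    by (simp add: PG_def)
  have "indep_var (PiM {p} (\<lambda>_. L)) (\<lambda>w. \<lambda>i\<in>{p}. T i w) (PiM {q} (\<lambda>_. L)) (\<lambda>w. \<lambda>i\<in>{q}. T i w)"
    by (rule indep_var_restrict[OF T_indep]) (use p in auto)
  then have "indep_var L ((\<lambda>x. x p) \<circ> (\<lambda>w. \<lambda>i\<in>{p}. T i w)) L ((\<lambda>x. x q) \<circ> (\<lambda>w. \<lambda>i\<in>{q}. T i w))"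
    by (rule indep_var_compose) simp_all
  then have "indep_var L (T p) L (T q)"
    by (simp add: comp_def)
  then have "distr P (L \<Otimes>\<^sub>M L) (\<lambda>w. (T p w, T q w)) = D \<Otimes>\<^sub>M D"
    unfolding indep_var_distribution_eq using T_law p by (simp add: D_def)
  with 1 show ?thesis by (simp add: PG_def)
qed

lemma integrable_frozen:
  fixes f :: "'w \<times> 't \<Rightarrow> real"
  assumes p: "p \<in> I" and f: "integrable (PG \<Otimes>\<^sub>M D) f"
  shows "integrable P (\<lambda>w. f (w, T p w))" and "(\<integral>w. f (w, T p w) \<partial>P) = integral\<^sup>L (PG \<Otimes>\<^sub>M D) f"
proof -
  have f': "f \<in> borel_measurable (G \<Otimes>\<^sub>M L)"
    using borel_measurable_integrable[OF f] by simp
  have m: "(\<lambda>w. (w, T p w)) \<in> P \<rightarrow>\<^sub>M G \<Otimes>\<^sub>M L"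
    using id_G T_meas[OF p] by simp
  show "integrable P (\<lambda>w. f (w, T p w))"
    using f integrable_distr_eq[OF m f'] by (simp add: frozen_law[OF p])
  show "(\<integral>w. f (w, T p w) \<partial>P) = integral\<^sup>L (PG \<Otimes>\<^sub>M D) f"
    using integral_distr[OF m f'] by (simp add: frozen_law[OF p])
qed

text \<open>With w outermost, Fubini integrates each factor over its own design point. Whatever
  correlation remains between two distinct visits is carried by the noise alone.\<close>

lemma cross_moment:
  fixes a b :: "'w \<times> 't \<Rightarrow> real"
  assumes pq: "p \<in> I" "q \<in> I" "p \<noteq> q"
    and [measurable]: "a \<in> borel_measurable (G \<Otimes>\<^sub>M L)" "b \<in> borel_measurable (G \<Otimes>\<^sub>M L)"
    and a2: "integrable (PG \<Otimes>\<^sub>M D) (\<lambda>x. (a x)\<^sup>2)" and b2: "integrable (PG \<Otimes>\<^sub>M D) (\<lambda>x. (b x)\<^sup>2)"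
  shows "(\<integral>w. a (w, T p w) * b (w, T q w) \<partial>P)
      = (\<integral>w. (\<integral>t. a (w, t) \<partial>D) * (\<integral>t. b (w, t) \<partial>D) \<partial>P)"
proof -
  interpret PG: prob_space PG by (rule prob_PG)
  interpret D: prob_space D by (rule prob_D)
  interpret DD: pair_prob_space D D ..
  interpret GD: pair_prob_space PG D ..
  interpret GDD: pair_prob_space PG "D \<Otimes>\<^sub>M D" ..
  let ?f = "\<lambda>(w, t, t'). a (w, t) * b (w, t')"
  \<comment> \<open>Integrability on the triple product is read off from \<open>P\<close>, where the
    further coordinate \<open>T q\<close> does not change the random variable.\<close>
  have sq1: "integrable (PG \<Otimes>\<^sub>M (D \<Otimes>\<^sub>M D)) (\<lambda>(w, t, t'). (a (w, t))\<^sup>2)"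
  proof -
    have "integrable P (\<lambda>w. (a (w, T p w))\<^sup>2)" using integrable_frozen(1)[OF pq(1) a2] .
    then show ?thesis
      using integrable_distr_eq[of "\<lambda>w. (w, (T p w, T q w))" P "G \<Otimes>\<^sub>M (L \<Otimes>\<^sub>M L)" "\<lambda>(w, t, t'). (a (w, t))\<^sup>2"]
        id_G T_meas pq by (simp add: frozen_law_pair[OF pq])
  qed
  have sq2: "integrable (PG \<Otimes>\<^sub>M (D \<Otimes>\<^sub>M D)) (\<lambda>(w, t, t'). (b (w, t'))\<^sup>2)"
  proof -
    have "integrable P (\<lambda>w. (b (w, T q w))\<^sup>2)" using integrable_frozen(1)[OF pq(2) b2] .
    then show ?thesis
      using integrable_distr_eq[of "\<lambda>w. (w, (T p w, T q w))" P "G \<Otimes>\<^sub>M (L \<Otimes>\<^sub>M L)" "\<lambda>(w, t, t'). (b (w, t'))\<^sup>2"]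
        id_G T_meas pq by (simp add: frozen_law_pair[OF pq])
  qed
  have int: "integrable (PG \<Otimes>\<^sub>M (D \<Otimes>\<^sub>M D)) ?f"
    using integrable_product_of_squares[of "\<lambda>(w, t, t'). a (w, t)" "PG \<Otimes>\<^sub>M (D \<Otimes>\<^sub>M D)" "\<lambda>(w, t, t'). b (w, t')"] sq1 sq2
    by (simp add: case_prod_unfold)
  have "(\<integral>w. a (w, T p w) * b (w, T q w) \<partial>P) = (\<integral>x. ?f x \<partial>(PG \<Otimes>\<^sub>M (D \<Otimes>\<^sub>M D)))"
    using integral_distr[of "\<lambda>w. (w, (T p w, T q w))" P "G \<Otimes>\<^sub>M (L \<Otimes>\<^sub>M L)" ?f]
      id_G T_meas pq by (simp add: frozen_law_pair[OF pq])
  also have "\<dots> = (\<integral>w. \<integral>x. ?f (w, x) \<partial>(D \<Otimes>\<^sub>M D) \<partial>PG)"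
    using GDD.integral_fst'[OF int] by simp
  \<comment> \<open>Fubini makes the section in (t, t') integrable for almost every w only, hence an
    almost-everywhere congruence.\<close>
  also have "\<dots> = (\<integral>w. (\<integral>t. a (w, t) \<partial>D) * (\<integral>t. b (w, t) \<partial>D) \<partial>PG)"
  proof (rule integral_cong_AE)
    show "AE w in PG. (\<integral>x. ?f (w, x) \<partial>(D \<Otimes>\<^sub>M D)) = (\<integral>t. a (w, t) \<partial>D) * (\<integral>t. b (w, t) \<partial>D)"
      using GDD.AE_integrable_fst'[OF int]
      by eventually_elim (use integral_pair_mult[of D] in \<open>auto simp: D.sigma_finite_measure_axioms\<close>)
  qed measurable
  also have "\<dots> = (\<integral>w. (\<integral>t. a (w, t) \<partial>D) * (\<integral>t. b (w, t) \<partial>D) \<partial>P)"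
    unfolding PG_def by (rule integral_distr[OF id_G]) measurable
  finally show ?thesis .
qed

text \<open>The square is expanded over ordered pairs of visits. A diagonal pair involves one design
  point and keeps its full second moment; an off-diagonal pair involves two and factors by
  \<open>cross_moment\<close>.\<close>

lemma second_moment_weighted_sum:
  fixes a :: "'p \<Rightarrow> 'w \<times> 't \<Rightarrow> real" and c :: "'p \<Rightarrow> real"
  assumes m: "\<And>p. p \<in> I \<Longrightarrow> a p \<in> borel_measurable (G \<Otimes>\<^sub>M L)"
    and sq: "\<And>p. p \<in> I \<Longrightarrow> integrable (PG \<Otimes>\<^sub>M D) (\<lambda>x. (a p x)\<^sup>2)"
  shows "integrable P (\<lambda>w. (\<Sum>p\<in>I. c p * a p (w, T p w))\<^sup>2)"
    and "(\<integral>w. (\<Sum>p\<in>I. c p * a p (w, T p w))\<^sup>2 \<partial>P)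
      = (\<Sum>p\<in>I. (c p)\<^sup>2 * (\<integral>x. (a p x)\<^sup>2 \<partial>(PG \<Otimes>\<^sub>M D)))
        + (\<Sum>p\<in>I. \<Sum>q\<in>I - {p}. c p * c q * (\<integral>w. (\<integral>t. a p (w, t) \<partial>D) * (\<integral>t. a q (w, t) \<partial>D) \<partial>P))"
proof -
  have m': "(\<lambda>w. a p (w, T p w)) \<in> borel_measurable P" if "p \<in> I" for p
  proof -
    have "(\<lambda>w. (w, T p w)) \<in> P \<rightarrow>\<^sub>M G \<Otimes>\<^sub>M L" using id_G T_meas[OF that] by simp
    from measurable_compose[OF this m[OF that]] show ?thesis .
  qed
  have int: "integrable P (\<lambda>w. a p (w, T p w) * a q (w, T q w))" if "p \<in> I" "q \<in> I" for p q
    using that m' integrable_frozen(1)[OF _ sq] by (intro integrable_product_of_squares) auto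
  have eq: "(\<Sum>p\<in>I. c p * a p (w, T p w))\<^sup>2
      = (\<Sum>p\<in>I. \<Sum>q\<in>I. c p * c q * (a p (w, T p w) * a q (w, T q w)))" for w
    by (simp add: power2_eq_square sum_product algebra_simps)
  show "integrable P (\<lambda>w. (\<Sum>p\<in>I. c p * a p (w, T p w))\<^sup>2)"
    unfolding eq using int by auto
  have "(\<integral>w. (\<Sum>p\<in>I. c p * a p (w, T p w))\<^sup>2 \<partial>P)
      = (\<Sum>p\<in>I. \<Sum>q\<in>I. c p * c q * (\<integral>w. a p (w, T p w) * a q (w, T q w) \<partial>P))"
    unfolding eq using int by (simp add: Bochner_Integration.integral_sum)
  also have "\<dots> = (\<Sum>p\<in>I. c p * c p * (\<integral>w. a p (w, T p w) * a p (w, T p w) \<partial>P)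
      + (\<Sum>q\<in>I - {p}. c p * c q * (\<integral>w. a p (w, T p w) * a q (w, T q w) \<partial>P)))"
    by (intro sum.cong refl sum.remove finite_I)
  also have "\<dots> = (\<Sum>p\<in>I. (c p)\<^sup>2 * (\<integral>x. (a p x)\<^sup>2 \<partial>(PG \<Otimes>\<^sub>M D))
      + (\<Sum>q\<in>I - {p}. c p * c q * (\<integral>w. (\<integral>t. a p (w, t) \<partial>D) * (\<integral>t. a q (w, t) \<partial>D) \<partial>P)))"
    using integrable_frozen(2)[OF _ sq] m sq
    by (intro sum.cong refl arg_cong2[where f="(+)"]) (auto simp: cross_moment power2_eq_square)
  finally show "(\<integral>w. (\<Sum>p\<in>I. c p * a p (w, T p w))\<^sup>2 \<partial>P)
      = (\<Sum>p\<in>I. (c p)\<^sup>2 * (\<integral>x. (a p x)\<^sup>2 \<partial>(PG \<Otimes>\<^sub>M D)))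
        + (\<Sum>p\<in>I. \<Sum>q\<in>I - {p}. c p * c q * (\<integral>w. (\<integral>t. a p (w, t) \<partial>D) * (\<integral>t. a q (w, t) \<partial>D) \<partial>P))"
    by (simp add: sum.distrib)
qed

text \<open>Makes the sampling density explicit, so that it can cancel against the division by
  \<open>g\<close> in the estimator.\<close>

lemma integral_frozen_density:
  fixes f :: "'w \<times> 't \<Rightarrow> real"
  assumes [measurable]: "f \<in> borel_measurable (G \<Otimes>\<^sub>M L)"
  shows "integrable (PG \<Otimes>\<^sub>M D) f \<longleftrightarrow> integrable (PG \<Otimes>\<^sub>M L) (\<lambda>(w, t). g t * f (w, t))"
    and "integral\<^sup>L (PG \<Otimes>\<^sub>M D) f = (\<integral>(w, t). g t * f (w, t) \<partial>(PG \<Otimes>\<^sub>M L))"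
proof -
  interpret PG: prob_space PG by (rule prob_PG)
  interpret D: prob_space D by (rule prob_D)
  interpret L: finite_measure L by (rule finite_L)
  \<comment> \<open>Giving \<open>PG\<close> the constant density 1 brings the product into the form
    of the rule for products of densities.\<close>
  have "PG \<Otimes>\<^sub>M D = density PG (\<lambda>_. 1) \<Otimes>\<^sub>M density L (\<lambda>t. ennreal (g t))"
    by (simp add: density_1 D_def)
  also have "\<dots> = density (PG \<Otimes>\<^sub>M L) (\<lambda>(w, t). 1 * ennreal (g t))"
    by (rule pair_measure_density)
       (use D.sigma_finite_measure_axioms L.sigma_finite_measure_axioms in \<open>simp_all add: D_def\<close>)
  finally have eq: "PG \<Otimes>\<^sub>M D = density (PG \<Otimes>\<^sub>M L) (\<lambda>x. ennreal (g (snd x)))"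
    by (simp add: case_prod_unfold)
  have nonneg: "AE x in PG \<Otimes>\<^sub>M L. 0 \<le> g (snd x)"
    by (rule AE_I2) (auto simp: space_pair_measure intro!: less_imp_le g_pos)
  show "integrable (PG \<Otimes>\<^sub>M D) f \<longleftrightarrow> integrable (PG \<Otimes>\<^sub>M L) (\<lambda>(w, t). g t * f (w, t))"
    unfolding eq by (subst integrable_density) (auto simp: nonneg case_prod_unfold)
  show "integral\<^sup>L (PG \<Otimes>\<^sub>M D) f = (\<integral>(w, t). g t * f (w, t) \<partial>(PG \<Otimes>\<^sub>M L))"
    unfolding eq by (subst integral_density) (auto simp: nonneg case_prod_unfold)
qed

lemma weighted_estimator_risk:
  fixes f \<phi> :: "'t \<Rightarrow> real" and W :: "'p \<Rightarrow> 'w \<times> 't \<Rightarrow> real" and c :: "'p \<Rightarrow> real" and B \<gamma> :: real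
  assumes f_meas [measurable]: "f \<in> borel_measurable L" and f_sq: "integrable L (\<lambda>t. (f t)\<^sup>2)"
    and phi_meas [measurable]: "\<phi> \<in> borel_measurable L" and phi_bd: "\<And>t. t \<in> space L \<Longrightarrow> \<bar>\<phi> t\<bar> \<le> B"
    and \<gamma>: "0 < \<gamma>" "\<And>t. t \<in> space L \<Longrightarrow> \<gamma> \<le> g t"
    and W_meas: "\<And>p. p \<in> I \<Longrightarrow> W p \<in> borel_measurable (G \<Otimes>\<^sub>M L)"
    and W_sq: "\<And>p. p \<in> I \<Longrightarrow> integrable (PG \<Otimes>\<^sub>M L) (\<lambda>x. (W p x)\<^sup>2)"
    and W_mean: "\<And>p t. p \<in> I \<Longrightarrow> t \<in> space L \<Longrightarrow> (\<integral>w. W p (w, t) \<partial>P) = 0"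
    and c: "(\<Sum>p\<in>I. c p) = 1"
  defines "\<beta> \<equiv> \<integral>t. f t * \<phi> t \<partial>L"
    and "\<xi> \<equiv> \<lambda>p w. \<integral>t. W p (w, t) * \<phi> t \<partial>L"
  shows "integrable P (\<lambda>w. ((\<Sum>p\<in>I. c p * ((f (T p w) + W p (w, T p w)) * \<phi> (T p w) / g (T p w))) - \<beta>)\<^sup>2)"
    and "(\<integral>w. ((\<Sum>p\<in>I. c p * ((f (T p w) + W p (w, T p w)) * \<phi> (T p w) / g (T p w))) - \<beta>)\<^sup>2 \<partial>P)
       = (\<Sum>p\<in>I. (c p)\<^sup>2 * ((\<integral>x. (f (snd x) + W p x)\<^sup>2 * ((\<phi> (snd x))\<^sup>2 / g (snd x)) \<partial>(PG \<Otimes>\<^sub>M L)) - \<beta>\<^sup>2))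
         + (\<Sum>p\<in>I. \<Sum>q\<in>I - {p}. c p * c q * (\<integral>w. \<xi> p w * \<xi> q w \<partial>P))"
    and "\<And>p. p \<in> I \<Longrightarrow> integrable (PG \<Otimes>\<^sub>M L) (\<lambda>x. (f (snd x) + W p x)\<^sup>2 * ((\<phi> (snd x))\<^sup>2 / g (snd x)))"
proof -
  interpret PG: prob_space PG by (rule prob_PG)
  interpret D: prob_space D by (rule prob_D)
  interpret L: finite_measure L by (rule finite_L)
  interpret GL: pair_sigma_finite PG L ..
  interpret GD: pair_prob_space PG D ..
  interpret GLf: finite_measure "PG \<Otimes>\<^sub>M L"
    by (rule finite_measure_pair_measure) unfold_locales
  \<comment> \<open>\<open>b p\<close> is the estimate of \<open>\<beta>\<close> from the single
    visit p, and \<open>a p\<close> is its error.\<close>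
  define b where "b p = (\<lambda>x. (f (snd x) + W p x) * (\<phi> (snd x) / g (snd x)))" for p
  define a where "a p = (\<lambda>x. b p x - \<beta>)" for p
  note W_meas [measurable]
  have b_meas [measurable]: "b p \<in> borel_measurable (G \<Otimes>\<^sub>M L)" if "p \<in> I" for p
    unfolding b_def using that by measurable
  have f_sq': "integrable (PG \<Otimes>\<^sub>M L) (\<lambda>x. (f (snd x))\<^sup>2)"
    by (rule GL.Fubini_integrable) (use f_sq in auto)
  have B0: "0 \<le> B"
  proof -
    obtain t where "t \<in> space L" using D.not_empty by auto
    with phi_bd[OF this] show ?thesis by linarith
  qed
  have fW_sq: "integrable (PG \<Otimes>\<^sub>M L) (\<lambda>x. (f (snd x) + W p x)\<^sup>2)" if p: "p \<in> I" for p
  proof -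
    have "integrable (PG \<Otimes>\<^sub>M L) (\<lambda>x. f (snd x) * W p x)"
      by (rule integrable_product_of_squares) (use p f_sq' W_sq in auto)
    then show ?thesis using f_sq' W_sq[OF p] by (simp add: power2_sum mult.assoc)
  qed
  \<comment> \<open>The bound of the basis function and the lower bound of the density make the
    weight of the diagonal terms bounded, so square integrability of mean plus noise is all that
    remains to be checked.\<close>
  have bd: "\<bar>(\<phi> t)\<^sup>2 / g t\<bar> \<le> B\<^sup>2 / \<gamma>" if "t \<in> space L" for t
  proof -
    have "(\<phi> t)\<^sup>2 \<le> B\<^sup>2" using phi_bd[OF that] by (rule abs_le_square_iff[THEN iffD1, OF order_trans]) simp
    then show ?thesis using \<gamma>(1) \<gamma>(2)[OF that] by (auto simp: abs_of_nonneg intro!: frac_le)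
  qed
  show fWh: "integrable (PG \<Otimes>\<^sub>M L) (\<lambda>x. (f (snd x) + W p x)\<^sup>2 * ((\<phi> (snd x))\<^sup>2 / g (snd x)))" if p: "p \<in> I" for p
  proof (rule Bochner_Integration.integrable_bound)
    show "integrable (PG \<Otimes>\<^sub>M L) (\<lambda>x. (B\<^sup>2 / \<gamma>) * (f (snd x) + W p x)\<^sup>2)" using fW_sq[OF p] by simp
    show "AE x in PG \<Otimes>\<^sub>M L. norm ((f (snd x) + W p x)\<^sup>2 * ((\<phi> (snd x))\<^sup>2 / g (snd x)))
        \<le> norm ((B\<^sup>2 / \<gamma>) * (f (snd x) + W p x)\<^sup>2)"
    proof (rule AE_I2)
      fix x assume "x \<in> space (PG \<Otimes>\<^sub>M L)"
      then have "snd x \<in> space L" by (auto simp: space_pair_measure)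
      from mult_right_mono[OF bd[OF this], of "(f (snd x) + W p x)\<^sup>2"]
      show "norm ((f (snd x) + W p x)\<^sup>2 * ((\<phi> (snd x))\<^sup>2 / g (snd x)))
        \<le> norm ((B\<^sup>2 / \<gamma>) * (f (snd x) + W p x)\<^sup>2)"
        using \<gamma>(1) by (simp add: abs_mult mult.commute)
    qed
  qed (use p in measurable)
  \<comment> \<open>Under the sampling density one of the two factors 1/g survives in the square,
    and none in the first power. This is why the diagonal carries the weight phi^2/g while
    \<open>\<beta>\<close> and \<open>\<xi>\<close> are free of \<open>g\<close>.\<close>
  have gb2: "g t * (b p (w, t))\<^sup>2 = (f t + W p (w, t))\<^sup>2 * ((\<phi> t)\<^sup>2 / g t)" if "t \<in> space L" for p w t
    using g_pos[OF that] by (simp add: b_def field_simps power2_eq_square)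
  have gb1: "g t * b p (w, t) = (f t + W p (w, t)) * \<phi> t" if "t \<in> space L" for p w t
    using g_pos[OF that] by (simp add: b_def)
  have b2: "integrable (PG \<Otimes>\<^sub>M D) (\<lambda>x. (b p x)\<^sup>2)"
    "(\<integral>x. (b p x)\<^sup>2 \<partial>(PG \<Otimes>\<^sub>M D)) = (\<integral>x. (f (snd x) + W p x)\<^sup>2 * ((\<phi> (snd x))\<^sup>2 / g (snd x)) \<partial>(PG \<Otimes>\<^sub>M L))"
    if p: "p \<in> I" for p
  proof -
    have [simp]: "b p \<in> borel_measurable (G \<Otimes>\<^sub>M L)" using p by simp
    show "integrable (PG \<Otimes>\<^sub>M D) (\<lambda>x. (b p x)\<^sup>2)"
    proof -
      have "integrable (PG \<Otimes>\<^sub>M L) (\<lambda>(w, t). g t * (b p (w, t))\<^sup>2)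
          \<longleftrightarrow> integrable (PG \<Otimes>\<^sub>M L) (\<lambda>x. (f (snd x) + W p x)\<^sup>2 * ((\<phi> (snd x))\<^sup>2 / g (snd x)))"
        by (rule Bochner_Integration.integrable_cong) (auto simp: gb2 space_pair_measure)
      then show ?thesis using fWh[OF p] p by (subst integral_frozen_density(1)) auto
    qed
    show "(\<integral>x. (b p x)\<^sup>2 \<partial>(PG \<Otimes>\<^sub>M D)) = (\<integral>x. (f (snd x) + W p x)\<^sup>2 * ((\<phi> (snd x))\<^sup>2 / g (snd x)) \<partial>(PG \<Otimes>\<^sub>M L))"
      using p by (subst integral_frozen_density(2))
         (auto simp: gb2 space_pair_measure intro!: Bochner_Integration.integral_cong)
  qed
  have phi_sq: "integrable (PG \<Otimes>\<^sub>M L) (\<lambda>x. (\<phi> (snd x))\<^sup>2)"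
    by (rule GLf.integrable_const_bound[of _ "B\<^sup>2"])
       (auto simp: space_pair_measure abs_le_square_iff[symmetric] B0 phi_bd)
  have W_phi: "integrable (PG \<Otimes>\<^sub>M L) (\<lambda>x. W p x * \<phi> (snd x))" if "p \<in> I" for p
    by (rule integrable_product_of_squares) (use that phi_sq W_sq in auto)
  have f_phi: "integrable (PG \<Otimes>\<^sub>M L) (\<lambda>x. f (snd x) * \<phi> (snd x))"
    by (rule integrable_product_of_squares) (use phi_sq f_sq' in auto)
  have f_phiL: "integrable L (\<lambda>x. f x * \<phi> x)"
  proof (rule integrable_product_of_squares)
    show "integrable L (\<lambda>x. (\<phi> x)\<^sup>2)"
      by (rule L.integrable_const_bound[of _ "B\<^sup>2"])
         (auto simp: abs_le_square_iff[symmetric] B0 phi_bd)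
  qed (use f_sq in auto)
  have b1: "integrable (PG \<Otimes>\<^sub>M D) (b p)" "integral\<^sup>L (PG \<Otimes>\<^sub>M D) (b p) = \<beta>" if p: "p \<in> I" for p
  proof -
    show "integrable (PG \<Otimes>\<^sub>M D) (b p)"
      using GD.square_integrable_imp_integrable[OF _ b2(1)[OF p]] p by simp
    have "integral\<^sup>L (PG \<Otimes>\<^sub>M D) (b p) = (\<integral>x. f (snd x) * \<phi> (snd x) + W p x * \<phi> (snd x) \<partial>(PG \<Otimes>\<^sub>M L))"
      using p by (subst integral_frozen_density(2))
         (auto simp: gb1 space_pair_measure distrib_right intro!: Bochner_Integration.integral_cong)
    \<comment> \<open>The deterministic part is integrated over t inside, the noise part over w
      inside, because the centring of the noise is given for each fixed t.\<close>
    also have "\<dots> = (\<integral>w. \<integral>t. f t * \<phi> t \<partial>L \<partial>PG) + (\<integral>t. \<integral>w. W p (w, t) * \<phi> t \<partial>PG \<partial>L)"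
      using f_phi W_phi[OF p] GL.integral_fst'[OF f_phi] GL.integral_snd[of "\<lambda>w t. W p (w, t) * \<phi> t"]
      by (simp add: case_prod_unfold)
    also have "(\<integral>t. \<integral>w. W p (w, t) * \<phi> t \<partial>PG \<partial>L) = (\<integral>t. 0 \<partial>L)"
    proof (intro Bochner_Integration.integral_cong refl)
      fix t assume t: "t \<in> space L"
      have "(\<integral>w. W p (w, t) \<partial>PG) = (\<integral>w. W p (w, t) \<partial>P)"
        unfolding PG_def by (rule integral_distr[OF id_G]) (use p t in measurable)
      then show "(\<integral>w. W p (w, t) * \<phi> t \<partial>PG) = 0" using W_mean[OF p t] by simp
    qed
    finally show "integral\<^sup>L (PG \<Otimes>\<^sub>M D) (b p) = \<beta>" using PG.prob_space by (simp add: \<beta>_def)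
  qed
  have a_meas: "a p \<in> borel_measurable (G \<Otimes>\<^sub>M L)" if "p \<in> I" for p
    unfolding a_def using that by measurable
  have a_eq: "(\<lambda>x. (a p x)\<^sup>2) = (\<lambda>x. (b p x)\<^sup>2 - 2 * \<beta> * b p x + \<beta>\<^sup>2)" for p
    by (auto simp: a_def power2_diff algebra_simps)
  have a2: "integrable (PG \<Otimes>\<^sub>M D) (\<lambda>x. (a p x)\<^sup>2)"
    "(\<integral>x. (a p x)\<^sup>2 \<partial>(PG \<Otimes>\<^sub>M D)) = (\<integral>x. (f (snd x) + W p x)\<^sup>2 * ((\<phi> (snd x))\<^sup>2 / g (snd x)) \<partial>(PG \<Otimes>\<^sub>M L)) - \<beta>\<^sup>2"
    if p: "p \<in> I" for p
  proof -
    show "integrable (PG \<Otimes>\<^sub>M D) (\<lambda>x. (a p x)\<^sup>2)"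
      unfolding a_eq using b1[OF p] b2[OF p] by simp
    have "(\<integral>x. (a p x)\<^sup>2 \<partial>(PG \<Otimes>\<^sub>M D)) = (\<integral>x. (b p x)\<^sup>2 \<partial>(PG \<Otimes>\<^sub>M D)) - 2 * \<beta> * \<beta> + \<beta>\<^sup>2"
      unfolding a_eq using b1[OF p] b2(1)[OF p] GD.prob_space by simp
    then show "(\<integral>x. (a p x)\<^sup>2 \<partial>(PG \<Otimes>\<^sub>M D)) = (\<integral>x. (f (snd x) + W p x)\<^sup>2 * ((\<phi> (snd x))\<^sup>2 / g (snd x)) \<partial>(PG \<Otimes>\<^sub>M L)) - \<beta>\<^sup>2"
      unfolding b2(2)[OF p] by (simp add: power2_eq_square)
  qed
  \<comment> \<open>The mean part integrates to \<open>\<beta>\<close> and cancels the centring. The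
    identity holds for almost every w, namely where the section of the noise is integrable against
    the basis function.\<close>
  have a_xi: "AE w in P. (\<integral>t. a p (w, t) \<partial>D) = \<xi> p w" if p: "p \<in> I" for p
  proof -
    have "AE w in PG. (\<integral>t. a p (w, t) \<partial>D) = \<xi> p w"
      using GL.AE_integrable_fst'[OF W_phi[OF p]] AE_space
    proof eventually_elim
      case (elim w)
      have wm [measurable]: "(\<lambda>t. W p (w, t)) \<in> borel_measurable L"
        using measurable_compose[OF measurable_Pair1'[of w G L] W_meas[OF p]] elim(2) by simp
      have bm: "(\<lambda>t. b p (w, t)) \<in> borel_measurable L"
        unfolding b_def by simp
      have 1: "integrable L (\<lambda>t. g t * b p (w, t))"
      proof -
        have "integrable L (\<lambda>t. g t * b p (w, t)) \<longleftrightarrow> integrable L (\<lambda>t. f t * \<phi> t + W p (w, t) * \<phi> t)"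
          by (rule Bochner_Integration.integrable_cong) (auto simp: gb1 distrib_right)
        then show ?thesis using f_phiL elim(1) by simp
      qed
      have "(\<integral>t. b p (w, t) \<partial>D) = (\<integral>t. g t * b p (w, t) \<partial>L)"
        unfolding D_def by (subst integral_density) (auto simp: bm intro!: less_imp_le g_pos)
      also have "\<dots> = (\<integral>t. f t * \<phi> t + W p (w, t) * \<phi> t \<partial>L)"
        by (intro Bochner_Integration.integral_cong) (auto simp: gb1 distrib_right)
      also have "\<dots> = \<beta> + \<xi> p w"
        using f_phiL elim(1) by (simp add: \<beta>_def \<xi>_def)
      finally have "(\<integral>t. b p (w, t) \<partial>D) = \<beta> + \<xi> p w" .
      moreover have "integrable D (\<lambda>t. b p (w, t))"
        unfolding D_def using 1 by (subst integrable_density) (auto simp: bm intro!: less_imp_le g_pos)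
      ultimately show ?case using D.prob_space by (simp add: a_def)
    qed
    then show ?thesis unfolding PG_def by (rule AE_distrD[OF id_G])
  qed
  have xi_meas [measurable]: "\<xi> p \<in> borel_measurable P" if "p \<in> I" for p
  proof -
    have "\<xi> p \<in> borel_measurable G" unfolding \<xi>_def using that by measurable
    then show ?thesis by (rule measurable_from_subalg[OF G])
  qed
  have aD_meas [measurable]: "(\<lambda>w. \<integral>t. a p (w, t) \<partial>D) \<in> borel_measurable P" if "p \<in> I" for p
  proof -
    have "(\<lambda>w. \<integral>t. a p (w, t) \<partial>D) \<in> borel_measurable G" using a_meas[OF that] by measurable
    then show ?thesis by (rule measurable_from_subalg[OF G])
  qed
  have cross: "(\<integral>w. (\<integral>t. a p (w, t) \<partial>D) * (\<integral>t. a q (w, t) \<partial>D) \<partial>P) = (\<integral>w. \<xi> p w * \<xi> q w \<partial>P)"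
    if "p \<in> I" "q \<in> I" for p q
    using a_xi[OF that(1)] a_xi[OF that(2)] that
    by (intro integral_cong_AE) auto
  \<comment> \<open>Since the weights sum to one, the centring by \<open>\<beta>\<close> distributes
    over the summands.\<close>
  have err: "(\<Sum>p\<in>I. c p * ((f (T p w) + W p (w, T p w)) * \<phi> (T p w) / g (T p w))) - \<beta>
      = (\<Sum>p\<in>I. c p * a p (w, T p w))" for w
  proof -
    have "(\<Sum>p\<in>I. c p * a p (w, T p w)) = (\<Sum>p\<in>I. c p * b p (w, T p w)) - (\<Sum>p\<in>I. c p) * \<beta>"
      by (simp add: a_def right_diff_distrib sum_subtractf sum_distrib_right)
    then show ?thesis by (simp add: b_def c)
  qed
  show "integrable P (\<lambda>w. ((\<Sum>p\<in>I. c p * ((f (T p w) + W p (w, T p w)) * \<phi> (T p w) / g (T p w))) - \<beta>)\<^sup>2)"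
    unfolding err by (rule second_moment_weighted_sum(1)[OF a_meas a2(1)])
  show "(\<integral>w. ((\<Sum>p\<in>I. c p * ((f (T p w) + W p (w, T p w)) * \<phi> (T p w) / g (T p w))) - \<beta>)\<^sup>2 \<partial>P)
       = (\<Sum>p\<in>I. (c p)\<^sup>2 * ((\<integral>x. (f (snd x) + W p x)\<^sup>2 * ((\<phi> (snd x))\<^sup>2 / g (snd x)) \<partial>(PG \<Otimes>\<^sub>M L)) - \<beta>\<^sup>2))
         + (\<Sum>p\<in>I. \<Sum>q\<in>I - {p}. c p * c q * (\<integral>w. \<xi> p w * \<xi> q w \<partial>P))"
  proof -
    have "(\<integral>w. (\<Sum>p\<in>I. c p * a p (w, T p w))\<^sup>2 \<partial>P)
      = (\<Sum>p\<in>I. (c p)\<^sup>2 * (\<integral>x. (a p x)\<^sup>2 \<partial>(PG \<Otimes>\<^sub>M D)))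
        + (\<Sum>p\<in>I. \<Sum>q\<in>I - {p}. c p * c q * (\<integral>w. (\<integral>t. a p (w, t) \<partial>D) * (\<integral>t. a q (w, t) \<partial>D) \<partial>P))"
      by (rule second_moment_weighted_sum(2)) (simp_all add: a_meas a2(1))
    then show ?thesis
      unfolding err by (simp add: a2(2) cross)
  qed
qed

end

section \<open>Random fields and their generated algebras\<close>

lemma subalgebra_trans: "subalgebra M N \<Longrightarrow> subalgebra N K \<Longrightarrow> subalgebra M K"
  by (auto simp: subalgebra_def)

lemma measurable_pair_subalgebra:
  assumes "subalgebra M F" "f \<in> F \<Otimes>\<^sub>M N \<rightarrow>\<^sub>M K"
  shows "f \<in> M \<Otimes>\<^sub>M N \<rightarrow>\<^sub>M K"
proof -
  have "fst \<in> M \<Otimes>\<^sub>M N \<rightarrow>\<^sub>M F"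
    using measurable_compose[OF measurable_fst measurable_from_subalg[OF assms(1) measurable_ident]]
    by (simp add: id_def)
  then have "(\<lambda>x. (fst x, snd x)) \<in> M \<Otimes>\<^sub>M N \<rightarrow>\<^sub>M F \<Otimes>\<^sub>M N" by (rule measurable_Pair) simp
  from measurable_compose[OF this assms(2)] show ?thesis by simp
qed

text \<open>\<open>joint_sigma\<close> is a bare family of sets; measurability and
  \<open>subalgebra\<close> need the same sigma-field as a measure.\<close>

definition joint_algebra :: "'w measure \<Rightarrow> 'i set \<Rightarrow> ('i \<Rightarrow> 'w measure) \<Rightarrow> 'w measure" where
  "joint_algebra P I F = sigma (space P) (\<Union>i\<in>I. sets (F i))"

lemma sets_joint_algebra:
  assumes "\<And>i. i \<in> I \<Longrightarrow> subalgebra P (F i)"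
  shows "sets (joint_algebra P I F) = joint_sigma P I F"
proof -
  have "(\<Union>i\<in>I. sets (F i)) \<subseteq> Pow (space P)"
  proof safe
    fix i A w assume "i \<in> I" "A \<in> sets (F i)" "w \<in> A"
    then show "w \<in> space P"
      using sets.sets_into_space[of A "F i"] assms[of i] by (auto simp: subalgebra_def)
  qed
  then show ?thesis by (simp add: joint_algebra_def joint_sigma_def)
qed

lemma space_joint_algebra [simp]: "space (joint_algebra P I F) = space P"
  unfolding joint_algebra_def by (rule space_measure_of_conv)

lemma subalgebra_joint_algebra:
  assumes "\<And>i. i \<in> I \<Longrightarrow> subalgebra P (F i)"
  shows "subalgebra P (joint_algebra P I F)" "\<And>i. i \<in> I \<Longrightarrow> subalgebra (joint_algebra P I F) (F i)"
proof -
  have "(\<Union>i\<in>I. sets (F i)) \<subseteq> sets P" using assms by (auto simp: subalgebra_def)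
  then show "subalgebra P (joint_algebra P I F)"
    using sets.sigma_sets_subset[of "\<Union>i\<in>I. sets (F i)" P]
    by (simp add: subalgebra_def sets_joint_algebra[OF assms] joint_sigma_def)
  show "subalgebra (joint_algebra P I F) (F i)" if "i \<in> I" for i
    using assms[OF that] that
    by (auto simp: subalgebra_def sets_joint_algebra[OF assms] joint_sigma_def intro: sigma_sets.Basic)
qed

text \<open>Sigma-fields are stable under intersection, so independence passes to the sigma-fields
  generated by disjoint blocks. It is used to separate the design from the two noise sources taken
  together.\<close>

lemma (in prob_space) indep_set_joint_algebras:
  fixes A B :: "'k set" and E :: "'k \<Rightarrow> 'a measure"
  assumes ind: "indep_sets (\<lambda>k. sets (E k)) J" and "A \<subseteq> J" "B \<subseteq> J" "A \<inter> B = {}"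
    and sub: "\<And>k. k \<in> J \<Longrightarrow> subalgebra M (E k)"
  shows "indep_set (sets (joint_algebra M A E)) (sets (joint_algebra M B E))"
proof -
  have "indep_sets (\<lambda>j. sigma_sets (space M) (\<Union>k\<in>case_bool A B j. sets (E k))) UNIV"
  proof (rule indep_sets_collect_sigma)
    show "indep_sets (\<lambda>k. sets (E k)) (\<Union>j\<in>UNIV. case_bool A B j)"
      by (rule indep_sets_mono_index[OF _ ind]) (use assms in \<open>auto split: bool.splits\<close>)
    show "disjoint_family_on (case_bool A B) UNIV"
      using assms by (auto simp: disjoint_family_on_def split: bool.splits)
  qed (rule sets.Int_stable)
  moreover have "(\<lambda>j. sigma_sets (space M) (\<Union>k\<in>case_bool A B j. sets (E k)))
      = case_bool (sets (joint_algebra M A E)) (sets (joint_algebra M B E))"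
  proof
    have subs: "subalgebra M (E k)" if "k \<in> A \<or> k \<in> B" for k using that assms by auto
    show "sigma_sets (space M) (\<Union>k\<in>case_bool A B j. sets (E k))
      = case_bool (sets (joint_algebra M A E)) (sets (joint_algebra M B E)) j" for j
      by (cases j) (simp_all add: sets_joint_algebra subs joint_sigma_def)
  qed
  ultimately show ?thesis
    unfolding indep_set_def by simp
qed

lemma (in prob_space) expectation_mult_indep_set:
  fixes U V :: "'a \<Rightarrow> real"
  assumes "indep_set (sets F) (sets G)" "subalgebra M F" "subalgebra M G"
    and "U \<in> borel_measurable F" "V \<in> borel_measurable G" "integrable M U" "integrable M V"
  shows "integrable M (\<lambda>w. U w * V w)" "expectation (\<lambda>w. U w * V w) = expectation U * expectation V"
proof -
  have "indep_var borel U borel V"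
    by (rule indep_var_of_indep_set[OF assms(1-5)])
  then show "integrable M (\<lambda>w. U w * V w)" "expectation (\<lambda>w. U w * V w) = expectation U * expectation V"
    using indep_var_integrable[OF _ assms(6,7)] indep_var_lebesgue_integral[OF _ assms(6,7)] by simp_all
qed

lemma subalgebra_field_algebra:
  "field_path S X \<in> P \<rightarrow>\<^sub>M path_space S \<Longrightarrow> subalgebra P (field_algebra P S X)"
  unfolding subalgebra_def field_algebra_def by (simp add: sets_image_in_sets[OF refl])

lemma random_field_subalgebra: "random_field P S X \<Longrightarrow> subalgebra P (field_algebra P S X)"
  by (simp add: random_field_def subalgebra_field_algebra)

lemma sets_field_algebra:
  assumes "field_path S X \<in> P \<rightarrow>\<^sub>M path_space S"
  shows "sets (field_algebra P S X) = {field_path S X -` A \<inter> space P | A. A \<in> sets (path_space S)}"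
  unfolding field_algebra_def
  by (rule sets_vimage_algebra2) (use measurable_space[OF assms] in auto)

lemma (in prob_space) indep_fields_field_algebras:
  assumes ind: "indep_fields M S X I" and f: "\<And>i. i \<in> I \<Longrightarrow> random_field M S (X i)"
    and ij: "i \<in> I" "j \<in> I" "i \<noteq> j"
  shows "indep_set (sets (field_algebra M S (X i))) (sets (field_algebra M S (X j)))"
proof -
  have 1: "indep_sets (\<lambda>i. sets (field_algebra M S (X i))) I"
  proof -
    have "indep_sets (\<lambda>i. {field_path S (X i) -` A \<inter> space M | A. A \<in> sets (path_space S)}) I"
      using ind unfolding indep_fields_def indep_vars_def2 by simp
    moreover have "sets (field_algebra M S (X i)) = {field_path S (X i) -` A \<inter> space M | A. A \<in> sets (path_space S)}"
      if "i \<in> I" for i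
      using f[OF that] by (simp add: sets_field_algebra random_field_def)
    ultimately show ?thesis by (subst indep_sets_cong[OF refl]) simp_all
  qed
  show ?thesis
  proof (rule indep_setI)
    show "sets (field_algebra M S (X i)) \<subseteq> events" "sets (field_algebra M S (X j)) \<subseteq> events"
      using random_field_subalgebra[OF f] ij by (auto simp: subalgebra_def)
    fix A B assume "A \<in> sets (field_algebra M S (X i))" "B \<in> sets (field_algebra M S (X j))"
    with indep_setsD[OF 1, of "{i, j}" "\<lambda>k. if k = i then A else B"] ij
    show "prob (A \<inter> B) = prob A * prob B" by (auto simp: Int_commute)
  qed
qed

text \<open>Measurability for the algebra generated by the field is what lets independence of such
  algebras act on single values of the field.\<close>

lemma random_field_point:
  assumes "random_field P S X" "s \<in> space S"
  shows "X s \<in> borel_measurable (field_algebra P S X)" "X s \<in> borel_measurable P"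
proof -
  have 1: "(\<lambda>w. (w, s)) \<in> field_algebra P S X \<rightarrow>\<^sub>M field_algebra P S X \<Otimes>\<^sub>M S"
    by (rule measurable_Pair2'[OF assms(2)])
  have 2: "(\<lambda>(w, s). X s w) \<in> borel_measurable (field_algebra P S X \<Otimes>\<^sub>M S)"
    using assms(1) by (simp add: random_field_def)
  show 3: "X s \<in> borel_measurable (field_algebra P S X)"
    using measurable_compose[OF 1 2] by (simp only: prod.case)
  show "X s \<in> borel_measurable P"
    by (rule measurable_from_subalg[OF random_field_subalgebra[OF assms(1)] 3])
qed

lemma random_field_joint:
  assumes "random_field P S X"
  shows "(\<lambda>(w, s). X s w) \<in> borel_measurable (P \<Otimes>\<^sub>M S)"
  by (rule measurable_pair_subalgebra[OF random_field_subalgebra[OF assms]])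
     (use assms in \<open>simp add: random_field_def\<close>)

text \<open>A function of two coordinates is measurable on \<open>path_space\<close>, and two
  coordinates are enough for what follows: means and second moments use one point, the second moment
  of a coefficient uses pairs of points.\<close>

lemma same_field_law_expectation:
  fixes h :: "real \<times> real \<Rightarrow> real"
  assumes law: "same_field_law P S X X'"
    and f: "random_field P S X" "random_field P S X'"
    and s: "s \<in> space S" "t \<in> space S"
    and h [measurable]: "h \<in> borel_measurable (borel \<Otimes>\<^sub>M borel)"
  shows "(\<integral>w. h (X s w, X t w) \<partial>P) = (\<integral>w. h (X' s w, X' t w) \<partial>P)"
    and "(\<integral>\<^sup>+w. ennreal (h (X s w, X t w)) \<partial>P) = (\<integral>\<^sup>+w. ennreal (h (X' s w, X' t w)) \<partial>P)"
    and "integrable P (\<lambda>w. h (X s w, X t w)) \<longleftrightarrow> integrable P (\<lambda>w. h (X' s w, X' t w))"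
proof -
  have m: "field_path S X \<in> P \<rightarrow>\<^sub>M path_space S" "field_path S X' \<in> P \<rightarrow>\<^sub>M path_space S"
    using f by (auto simp: random_field_def)
  have hm: "(\<lambda>p. h (p s, p t)) \<in> borel_measurable (path_space S)"
    unfolding path_space_def using s by measurable
  have eq: "h (X s w, X t w) = h (field_path S X w s, field_path S X w t)"
    "h (X' s w, X' t w) = h (field_path S X' w s, field_path S X' w t)" for w
    using s by (simp_all add: field_path_def)
  have law': "distr P (path_space S) (field_path S X) = distr P (path_space S) (field_path S X')"
    using law by (simp add: same_field_law_def)
  show "(\<integral>w. h (X s w, X t w) \<partial>P) = (\<integral>w. h (X' s w, X' t w) \<partial>P)"
    using integral_distr[OF m(1) hm] integral_distr[OF m(2) hm] law' by (simp only: eq)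
  show "(\<integral>\<^sup>+w. ennreal (h (X s w, X t w)) \<partial>P) = (\<integral>\<^sup>+w. ennreal (h (X' s w, X' t w)) \<partial>P)"
    using nn_integral_distr[OF m(1), of "\<lambda>p. ennreal (h (p s, p t))"]
      nn_integral_distr[OF m(2), of "\<lambda>p. ennreal (h (p s, p t))"] law' hm by (simp add: eq)
  show "integrable P (\<lambda>w. h (X s w, X t w)) \<longleftrightarrow> integrable P (\<lambda>w. h (X' s w, X' t w))"
    using integrable_distr_eq[OF m(1) hm] integrable_distr_eq[OF m(2) hm] law' by (simp only: eq)
qed

section \<open>The noise of the longitudinal model\<close>

lemma (in prob_space) integral_section_square:
  fixes Z :: "'a \<times> 't \<Rightarrow> real" and \<phi> :: "'t \<Rightarrow> real"
  assumes L: "finite_measure L"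
    and Z [measurable]: "Z \<in> borel_measurable (M \<Otimes>\<^sub>M L)" and Z_sq: "integrable (M \<Otimes>\<^sub>M L) (\<lambda>x. (Z x)\<^sup>2)"
    and phi [measurable]: "\<phi> \<in> borel_measurable L" and bd: "\<forall>t\<in>space L. \<bar>\<phi> t\<bar> \<le> B"
  defines "y \<equiv> \<lambda>w. \<integral>t. Z (w, t) * \<phi> t \<partial>L"
  shows "integrable M (\<lambda>w. (y w)\<^sup>2)"
    and "(\<integral>w. (y w)\<^sup>2 \<partial>M) = (\<integral>p. (\<integral>w. Z (w, fst p) * Z (w, snd p) \<partial>M) * (\<phi> (fst p) * \<phi> (snd p)) \<partial>(L \<Otimes>\<^sub>M L))"
    and "AE w in M. integrable L (\<lambda>t. Z (w, t) * \<phi> t)"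
    and "integrable M y"
    and "(\<integral>w. y w \<partial>M) = (\<integral>t. (\<integral>w. Z (w, t) \<partial>M) * \<phi> t \<partial>L)"
proof -
  interpret L: finite_measure L by fact
  interpret PL: pair_sigma_finite M L ..
  interpret LL: pair_sigma_finite L L ..
  interpret PLL: pair_sigma_finite M "L \<Otimes>\<^sub>M L"
    by unfold_locales
  have LL_sf: "sigma_finite_measure (L \<Otimes>\<^sub>M L)" by unfold_locales
  interpret PLf: finite_measure "M \<Otimes>\<^sub>M L"
    by (rule finite_measure_pair_measure) unfold_locales
  have [measurable]: "(\<lambda>t. Z (w, t)) \<in> borel_measurable L" if "w \<in> space M" for w
    by (rule measurable_compose[OF measurable_Pair1'[OF that] Z])
  have Zphi_sq: "integrable (M \<Otimes>\<^sub>M L) (\<lambda>x. (Z x * \<phi> (snd x))\<^sup>2)"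
  proof (rule Bochner_Integration.integrable_bound)
    show "integrable (M \<Otimes>\<^sub>M L) (\<lambda>x. B\<^sup>2 * (Z x)\<^sup>2)" using Z_sq by simp
    show "AE x in M \<Otimes>\<^sub>M L. norm ((Z x * \<phi> (snd x))\<^sup>2) \<le> norm (B\<^sup>2 * (Z x)\<^sup>2)"
    proof (rule AE_I2)
      fix x assume "x \<in> space (M \<Otimes>\<^sub>M L)"
      then have "\<bar>\<phi> (snd x)\<bar> \<le> B" by (auto simp: space_pair_measure bd)
      then have "(\<phi> (snd x))\<^sup>2 \<le> B\<^sup>2" by (simp add: abs_le_square_iff[symmetric])
      from mult_right_mono[OF this, of "(Z x)\<^sup>2"]
      show "norm ((Z x * \<phi> (snd x))\<^sup>2) \<le> norm (B\<^sup>2 * (Z x)\<^sup>2)"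
        by (simp add: power_mult_distrib abs_mult mult.commute)
    qed
  qed measurable
  have Zphi: "integrable (M \<Otimes>\<^sub>M L) (\<lambda>x. Z x * \<phi> (snd x))"
    by (rule PLf.square_integrable_imp_integrable[OF _ Zphi_sq]) measurable
  show ae: "AE w in M. integrable L (\<lambda>t. Z (w, t) * \<phi> t)"
    using PL.AE_integrable_fst'[OF Zphi] by simp
  show "integrable M y"
    unfolding y_def using PL.integrable_fst'[OF Zphi] by simp
  show "(\<integral>w. y w \<partial>M) = (\<integral>t. (\<integral>w. Z (w, t) \<partial>M) * \<phi> t \<partial>L)"
    unfolding y_def using PL.Fubini_integral[of "\<lambda>w t. Z (w, t) * \<phi> t"] Zphi
    by (simp add: case_prod_unfold)
  \<comment> \<open>Each square depends on one of the two times; the other contributes only the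
    finite total mass of \<open>L\<close>. The two bounds together make the product integrable on
    the triple space.\<close>
  have sq: "integrable (M \<Otimes>\<^sub>M (L \<Otimes>\<^sub>M L)) (\<lambda>(w, t, t'). (Z (w, t) * \<phi> t)\<^sup>2)"
    "integrable (M \<Otimes>\<^sub>M (L \<Otimes>\<^sub>M L)) (\<lambda>(w, t, t'). (Z (w, t') * \<phi> t')\<^sup>2)"
  proof -
    have fin: "(\<integral>\<^sup>+w. \<integral>\<^sup>+t. ennreal ((Z (w, t) * \<phi> t)\<^sup>2) \<partial>L \<partial>M) < \<infinity>"
      using Zphi_sq L.nn_integral_fst[of "\<lambda>x. ennreal ((Z x * \<phi> (snd x))\<^sup>2)" M]
      by (simp add: integrable_iff_bounded)
    have "(\<integral>\<^sup>+x. (case x of (w, t, t') \<Rightarrow> ennreal ((Z (w, t) * \<phi> t)\<^sup>2)) \<partial>(M \<Otimes>\<^sub>M (L \<Otimes>\<^sub>M L)))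
      = (\<integral>\<^sup>+w. \<integral>\<^sup>+t. \<integral>\<^sup>+t'. ennreal ((Z (w, t) * \<phi> t)\<^sup>2) \<partial>L \<partial>L \<partial>M)"
      by (subst sigma_finite_measure.nn_integral_fst[OF LL_sf, symmetric], measurable)
         (intro nn_integral_cong, subst L.nn_integral_fst[symmetric], simp_all)
    also have "\<dots> = (\<integral>\<^sup>+w. (\<integral>\<^sup>+t. ennreal ((Z (w, t) * \<phi> t)\<^sup>2) \<partial>L) * emeasure L (space L) \<partial>M)"
      by (intro nn_integral_cong) (simp add: nn_integral_multc)
    also have "\<dots> = (\<integral>\<^sup>+w. \<integral>\<^sup>+t. ennreal ((Z (w, t) * \<phi> t)\<^sup>2) \<partial>L \<partial>M) * emeasure L (space L)"
      by (rule nn_integral_multc) measurable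
    also have "\<dots> < \<infinity>" using fin L.emeasure_finite[of "space L"]
      unfolding infinity_ennreal_def top.not_eq_extremum ennreal_mult_less_top by blast
    finally show "integrable (M \<Otimes>\<^sub>M (L \<Otimes>\<^sub>M L)) (\<lambda>(w, t, t'). (Z (w, t) * \<phi> t)\<^sup>2)"
      by (intro integrableI_bounded) (auto simp: case_prod_unfold)
    have "(\<integral>\<^sup>+x. (case x of (w, t, t') \<Rightarrow> ennreal ((Z (w, t') * \<phi> t')\<^sup>2)) \<partial>(M \<Otimes>\<^sub>M (L \<Otimes>\<^sub>M L)))
      = (\<integral>\<^sup>+w. \<integral>\<^sup>+t. \<integral>\<^sup>+t'. ennreal ((Z (w, t') * \<phi> t')\<^sup>2) \<partial>L \<partial>L \<partial>M)"
      by (subst sigma_finite_measure.nn_integral_fst[OF LL_sf, symmetric], measurable)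
         (intro nn_integral_cong, subst L.nn_integral_fst[symmetric], simp_all)
    also have "\<dots> = (\<integral>\<^sup>+w. (\<integral>\<^sup>+t. ennreal ((Z (w, t) * \<phi> t)\<^sup>2) \<partial>L) * emeasure L (space L) \<partial>M)"
      by (intro nn_integral_cong) (simp add: nn_integral_multc)
    also have "\<dots> = (\<integral>\<^sup>+w. \<integral>\<^sup>+t. ennreal ((Z (w, t) * \<phi> t)\<^sup>2) \<partial>L \<partial>M) * emeasure L (space L)"
      by (rule nn_integral_multc) measurable
    also have "\<dots> < \<infinity>" using fin L.emeasure_finite[of "space L"]
      unfolding infinity_ennreal_def top.not_eq_extremum ennreal_mult_less_top by blast
    finally show "integrable (M \<Otimes>\<^sub>M (L \<Otimes>\<^sub>M L)) (\<lambda>(w, t, t'). (Z (w, t') * \<phi> t')\<^sup>2)"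
      by (intro integrableI_bounded) (auto simp: case_prod_unfold)
  qed
  let ?h = "\<lambda>(w, p). Z (w, fst p) * \<phi> (fst p) * (Z (w, snd p) * \<phi> (snd p))"
  have int: "integrable (M \<Otimes>\<^sub>M (L \<Otimes>\<^sub>M L)) ?h"
    using integrable_product_of_squares[of "\<lambda>(w, t, t'). Z (w, t) * \<phi> t" "M \<Otimes>\<^sub>M (L \<Otimes>\<^sub>M L)" "\<lambda>(w, t, t'). Z (w, t') * \<phi> t'"] sq
    by (simp add: case_prod_unfold)
  have y2: "AE w in M. (\<integral>p. ?h (w, p) \<partial>(L \<Otimes>\<^sub>M L)) = (y w)\<^sup>2"
    using PLL.AE_integrable_fst'[OF int]
  proof eventually_elim
    case (elim w)
    have "integrable (L \<Otimes>\<^sub>M L) (\<lambda>(t, t'). (Z (w, t) * \<phi> t) * (Z (w, t') * \<phi> t'))"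
      using elim by (simp add: case_prod_unfold)
    from integral_pair_mult[OF L.sigma_finite_measure_axioms this] show ?case
      by (simp add: y_def case_prod_unfold power2_eq_square)
  qed
  have ym: "y \<in> borel_measurable M" unfolding y_def by measurable
  have int1: "integrable M (\<lambda>w. \<integral>p. ?h (w, p) \<partial>(L \<Otimes>\<^sub>M L))"
    by (rule PLL.integrable_fst'[OF int])
  show "integrable M (\<lambda>w. (y w)\<^sup>2)"
    by (rule integrable_cong_AE_imp[OF int1]) (use ym y2 in auto)
  have "(\<integral>w. (y w)\<^sup>2 \<partial>M) = (\<integral>w. \<integral>p. ?h (w, p) \<partial>(L \<Otimes>\<^sub>M L) \<partial>M)"
    using borel_measurable_integrable[OF int1] ym y2 by (intro integral_cong_AE) auto
  also have "\<dots> = (\<integral>p. \<integral>w. ?h (w, p) \<partial>M \<partial>(L \<Otimes>\<^sub>M L))"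
    using PLL.Fubini_integral[of "\<lambda>w p. ?h (w, p)"] int by (simp add: case_prod_unfold)
  also have "\<dots> = (\<integral>p. (\<integral>w. Z (w, fst p) * Z (w, snd p) \<partial>M) * (\<phi> (fst p) * \<phi> (snd p)) \<partial>(L \<Otimes>\<^sub>M L))"
    by (simp add: mult_ac flip: integral_mult_right_zero)
  finally show "(\<integral>w. (y w)\<^sup>2 \<partial>M) = (\<integral>p. (\<integral>w. Z (w, fst p) * Z (w, snd p) \<partial>M) * (\<phi> (fst p) * \<phi> (snd p)) \<partial>(L \<Otimes>\<^sub>M L))" .
qed

text \<open>Places t outermost and replaces \<open>PG\<close> by \<open>P\<close>, because the
  moments of the fields are known under \<open>P\<close> at each fixed time.\<close>

lemma (in frozen_design) nn_integral_PG_L: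
  assumes [measurable]: "f \<in> borel_measurable (G \<Otimes>\<^sub>M L)"
  shows "(\<integral>\<^sup>+x. f x \<partial>(PG \<Otimes>\<^sub>M L)) = (\<integral>\<^sup>+t. \<integral>\<^sup>+w. f (w, t) \<partial>P \<partial>L)"
proof -
  interpret PG: prob_space PG by (rule prob_PG)
  interpret L: finite_measure L by (rule finite_L)
  interpret GL: pair_sigma_finite PG L ..
  have "(\<integral>\<^sup>+x. f x \<partial>(PG \<Otimes>\<^sub>M L)) = (\<integral>\<^sup>+t. \<integral>\<^sup>+w. f (w, t) \<partial>PG \<partial>L)"
    using GL.nn_integral_snd[of f] by simp
  also have "\<dots> = (\<integral>\<^sup>+t. \<integral>\<^sup>+w. f (w, t) \<partial>P \<partial>L)"
    unfolding PG_def by (intro nn_integral_cong nn_integral_distr[OF id_G]) measurable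
  finally show ?thesis .
qed

text \<open>The constants \<open>\<gamma>\<close> and \<open>\<tau>'\<close> are real bounds for the
  density and the noise level, which keeps the integrability arguments free of extended suprema.
  Here \<open>\<gamma>\<close> is any positive lower bound; it is identified with the infimum only
  where \<open>C1\<close> enters.\<close>

locale longitudinal_model = prob_space P for P :: "'w measure" +
  fixes \<nu> :: "'u::metric_space measure"
    and a b :: real
    and n :: nat and m :: "nat \<Rightarrow> nat"
    and X :: "'u \<times> real \<Rightarrow> 'w \<Rightarrow> real" and Xs :: "nat \<Rightarrow> 'u \<times> real \<Rightarrow> 'w \<Rightarrow> real"
    and T :: "nat \<Rightarrow> nat \<Rightarrow> 'w \<Rightarrow> real"
    and g \<tau> :: "real \<Rightarrow> real" and \<gamma> \<tau>' :: real
    and \<eta> :: "nat \<Rightarrow> nat \<Rightarrow> 'u \<Rightarrow> 'w \<Rightarrow> real"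
  assumes nu_borel: "sets \<nu> = sets borel"
    and nu_finite: "finite_measure \<nu>"
    and visits_ne: "visits n m \<noteq> {}"
    and X_field: "random_field P (\<nu> \<Otimes>\<^sub>M interval_lebesgue a b) X"
    and X_mean: "\<And>u t. t \<in> {a..b} \<Longrightarrow> has_bochner_integral P (X (u, t)) 0"
    and Xs_field: "\<And>i. i \<in> {1..n} \<Longrightarrow> random_field P (\<nu> \<Otimes>\<^sub>M interval_lebesgue a b) (Xs i)"
    and Xs_law: "\<And>i. i \<in> {1..n} \<Longrightarrow>
          same_field_law P (\<nu> \<Otimes>\<^sub>M interval_lebesgue a b) (Xs i) X"
    and Xs_indep: "indep_fields P (\<nu> \<Otimes>\<^sub>M interval_lebesgue a b) Xs {1..n}"
    and T_law: "\<And>i j. (i, j) \<in> visits n m \<Longrightarrow>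
          distr P (interval_lebesgue a b) (T i j) = density (interval_lebesgue a b) (\<lambda>t. ennreal (g t))"
    and T_indep: "prob_space.indep_vars P (\<lambda>_. interval_lebesgue a b) (\<lambda>(i, j). T i j) (visits n m)"
    and g_meas: "g \<in> borel_measurable (interval_lebesgue a b)"
    and \<gamma>_pos: "0 < \<gamma>" and g_ge: "\<And>t. t \<in> {a..b} \<Longrightarrow> \<gamma> \<le> g t"
    and tau_meas: "\<tau> \<in> borel_measurable (interval_lebesgue a b)"
    and tau_le: "\<And>t. t \<in> {a..b} \<Longrightarrow> \<bar>\<tau> t\<bar> \<le> \<tau>'"
    and eta_field: "\<And>i j. (i, j) \<in> visits n m \<Longrightarrow> random_field P \<nu> (\<eta> i j)"
    and eta_indep: "indep_fields P \<nu> (\<lambda>(i, j). \<eta> i j) (visits n m)"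
    and eta_mean: "\<And>i j u. (i, j) \<in> visits n m \<Longrightarrow> has_bochner_integral P (\<eta> i j u) 0"
    and eta_var: "\<And>i j u. (i, j) \<in> visits n m \<Longrightarrow> prob_space.variance P (\<eta> i j u) = 1"
    and indep: "prob_space.indep_sets P
          (\<lambda>l. [joint_sigma P (visits n m)
                  (\<lambda>(i, j). vimage_algebra (space P) (T i j) (interval_lebesgue a b)),
                joint_sigma P {1..n}
                  (\<lambda>i. field_algebra P (\<nu> \<Otimes>\<^sub>M interval_lebesgue a b) (Xs i)),
                joint_sigma P (visits n m)
                  (\<lambda>(i, j). field_algebra P \<nu> (\<eta> i j))] ! l) {0, 1, 2}"
begin

abbreviation "L \<equiv> interval_lebesgue a b"
abbreviation "I \<equiv> visits n m"

lemma space_nu: "space \<nu> = UNIV"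
  using sets_eq_imp_space_eq[OF nu_borel] by simp

lemma space_field: "space (\<nu> \<Otimes>\<^sub>M L) = UNIV \<times> {a..b}"
  by (simp add: space_pair_measure space_nu)

lemma finite_L: "finite_measure L"
  by (rule finite_measureI) (simp add: emeasure_restrict_space emeasure_lborel_Icc_eq)

lemma visitsD: "(i, j) \<in> I \<Longrightarrow> i \<in> {1..n}"
  by (auto simp: visits_def)

lemma T_measurable: "(i, j) \<in> I \<Longrightarrow> T i j \<in> P \<rightarrow>\<^sub>M L"
  using T_indep by (auto simp: indep_vars_def)

definition "algebra_T = joint_algebra P I (\<lambda>(i, j). vimage_algebra (space P) (T i j) L)"
definition "algebra_X = joint_algebra P {1..n} (\<lambda>i. field_algebra P (\<nu> \<Otimes>\<^sub>M L) (Xs i))"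
definition "algebra_\<eta> = joint_algebra P I (\<lambda>(i, j). field_algebra P \<nu> (\<eta> i j))"

text \<open>The indices 0, 1, 2 follow the list in \<open>indep\<close>: design, subject fields,
  errors. The noise algebra joins the last two, so that freezing it leaves only the design
  random.\<close>

definition "algebras = (\<lambda>l. [algebra_T, algebra_X, algebra_\<eta>] ! l)"
definition "design_algebra = joint_algebra P {0} algebras"
definition "noise_algebra = joint_algebra P {1, 2} algebras"

lemma T_subalgebra: "p \<in> I \<Longrightarrow> subalgebra P ((\<lambda>(i, j). vimage_algebra (space P) (T i j) L) p)"
  using sets_image_in_sets[OF refl T_measurable] by (cases p) (simp add: subalgebra_def)

lemma X_subalgebra: "i \<in> {1..n} \<Longrightarrow> subalgebra P (field_algebra P (\<nu> \<Otimes>\<^sub>M L) (Xs i))"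
  by (rule random_field_subalgebra[OF Xs_field])

lemma eta_subalgebra: "p \<in> I \<Longrightarrow> subalgebra P ((\<lambda>(i, j). field_algebra P \<nu> (\<eta> i j)) p)"
  using random_field_subalgebra[OF eta_field] by (cases p) simp

lemma algebras_subalgebra: "l \<in> {0, 1, 2} \<Longrightarrow> subalgebra P (algebras l)"
proof -
  have "subalgebra P algebra_T" "subalgebra P algebra_X" "subalgebra P algebra_\<eta>"
    unfolding algebra_T_def algebra_X_def algebra_\<eta>_def
    by (rule subalgebra_joint_algebra(1), erule T_subalgebra X_subalgebra eta_subalgebra)+
  then show "l \<in> {0, 1, 2} \<Longrightarrow> subalgebra P (algebras l)"
    by (auto simp: algebras_def)
qed

lemma indep_algebras: "indep_sets (\<lambda>l. sets (algebras l)) {0, 1, 2}"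
proof (rule indep_sets_cong[THEN iffD1, OF refl _ indep])
  fix l :: nat assume "l \<in> {0, 1, 2}"
  moreover have "sets algebra_T = joint_sigma P I (\<lambda>(i, j). vimage_algebra (space P) (T i j) L)"
    unfolding algebra_T_def by (rule sets_joint_algebra[OF T_subalgebra])
  moreover have "sets algebra_X = joint_sigma P {1..n} (\<lambda>i. field_algebra P (\<nu> \<Otimes>\<^sub>M L) (Xs i))"
    unfolding algebra_X_def by (rule sets_joint_algebra[OF X_subalgebra])
  moreover have "sets algebra_\<eta> = joint_sigma P I (\<lambda>(i, j). field_algebra P \<nu> (\<eta> i j))"
    unfolding algebra_\<eta>_def by (rule sets_joint_algebra[OF eta_subalgebra])
  ultimately show "[joint_sigma P I (\<lambda>(i, j). vimage_algebra (space P) (T i j) L),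
                joint_sigma P {1..n} (\<lambda>i. field_algebra P (\<nu> \<Otimes>\<^sub>M L) (Xs i)),
                joint_sigma P I (\<lambda>(i, j). field_algebra P \<nu> (\<eta> i j))] ! l = sets (algebras l)"
    by (auto simp: algebras_def)
qed

lemma design_noise_indep: "indep_set (sets noise_algebra) (sets design_algebra)"
  unfolding noise_algebra_def design_algebra_def
  by (rule indep_set_joint_algebras[OF indep_algebras]) (auto intro: algebras_subalgebra)

lemma X_eta_indep: "indep_set (sets algebra_X) (sets algebra_\<eta>)"
proof -
  have 1: "sets algebra_X \<subseteq> events" "sets algebra_\<eta> \<subseteq> events"
    using algebras_subalgebra[of 1] algebras_subalgebra[of 2] by (auto simp: algebras_def subalgebra_def)
  show ?thesis
  proof (rule indep_setI[OF 1])
    fix A B assume "A \<in> sets algebra_X" "B \<in> sets algebra_\<eta>"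
    with indep_setsD[OF indep_algebras, of "{1, 2}" "\<lambda>k. if k = 1 then A else B"]
    show "prob (A \<inter> B) = prob A * prob B" by (auto simp: algebras_def Int_commute)
  qed
qed

lemma noise_subalgebra: "subalgebra P noise_algebra" and design_subalgebra: "subalgebra P design_algebra"
  unfolding noise_algebra_def design_algebra_def
  by (rule subalgebra_joint_algebra(1), rule algebras_subalgebra, blast)+

lemma X_noise_subalgebra:
  assumes "i \<in> {1..n}"
  shows "subalgebra noise_algebra (field_algebra P (\<nu> \<Otimes>\<^sub>M L) (Xs i))"
    and "subalgebra algebra_X (field_algebra P (\<nu> \<Otimes>\<^sub>M L) (Xs i))"
proof -
  show 1: "subalgebra algebra_X (field_algebra P (\<nu> \<Otimes>\<^sub>M L) (Xs i))"
    unfolding algebra_X_def by (rule subalgebra_joint_algebra(2)[OF X_subalgebra assms])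
  have "subalgebra noise_algebra (algebras 1)"
    unfolding noise_algebra_def by (rule subalgebra_joint_algebra(2), rule algebras_subalgebra) auto
  then have "subalgebra noise_algebra algebra_X" by (simp add: algebras_def)
  from subalgebra_trans[OF this 1] show "subalgebra noise_algebra (field_algebra P (\<nu> \<Otimes>\<^sub>M L) (Xs i))" .
qed

lemma eta_noise_subalgebra:
  assumes "(i, j) \<in> I"
  shows "subalgebra noise_algebra (field_algebra P \<nu> (\<eta> i j))"
    and "subalgebra algebra_\<eta> (field_algebra P \<nu> (\<eta> i j))"
proof -
  show 1: "subalgebra algebra_\<eta> (field_algebra P \<nu> (\<eta> i j))"
  proof -
    have "subalgebra algebra_\<eta> ((\<lambda>(i, j). field_algebra P \<nu> (\<eta> i j)) (i, j))"
      unfolding algebra_\<eta>_def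
      by (rule subalgebra_joint_algebra(2)[where F="\<lambda>(i, j). field_algebra P \<nu> (\<eta> i j)"], erule eta_subalgebra, rule assms)
    then show ?thesis by simp
  qed
  have "subalgebra noise_algebra (algebras 2)"
    unfolding noise_algebra_def by (rule subalgebra_joint_algebra(2), rule algebras_subalgebra) auto
  then have "subalgebra noise_algebra algebra_\<eta>" by (simp add: algebras_def)
  from subalgebra_trans[OF this 1] show "subalgebra noise_algebra (field_algebra P \<nu> (\<eta> i j))" .
qed

lemma T_design: "(i, j) \<in> I \<Longrightarrow> T i j \<in> design_algebra \<rightarrow>\<^sub>M L"
proof -
  assume ij: "(i, j) \<in> I"
  have "subalgebra design_algebra (algebras 0)"
    unfolding design_algebra_def by (rule subalgebra_joint_algebra(2), rule algebras_subalgebra) auto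
  then have 1: "subalgebra design_algebra algebra_T" by (simp add: algebras_def)
  have 2: "subalgebra algebra_T (vimage_algebra (space P) (T i j) L)"
  proof -
    have "subalgebra algebra_T ((\<lambda>(i, j). vimage_algebra (space P) (T i j) L) (i, j))"
      unfolding algebra_T_def
      by (rule subalgebra_joint_algebra(2)[where F="\<lambda>(i, j). vimage_algebra (space P) (T i j) L"], erule T_subalgebra, rule ij)
    then show ?thesis by simp
  qed
  have "T i j \<in> vimage_algebra (space P) (T i j) L \<rightarrow>\<^sub>M L"
    by (rule measurable_vimage_algebra1) (use measurable_space[OF T_measurable[OF ij]] in auto)
  from measurable_from_subalg[OF subalgebra_trans[OF 1 2] this] show ?thesis .
qed

sublocale design: frozen_design P L design_algebra noise_algebra I "\<lambda>(i, j). T i j" g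
proof (intro_locales, rule frozen_design_axioms.intro)
  show "finite I" by (simp add: visits_def)
  show "p \<in> I \<Longrightarrow> (case p of (i, j) \<Rightarrow> T i j) \<in> design_algebra \<rightarrow>\<^sub>M L" for p
    using T_design by (cases p) simp
  show "p \<in> I \<Longrightarrow> distr P L (case p of (i, j) \<Rightarrow> T i j) = density L (\<lambda>t. ennreal (g t))" for p
    using T_law by (cases p) simp
  show "t \<in> space L \<Longrightarrow> 0 < g t" for t using g_ge[of t] \<gamma>_pos by auto
qed (fact finite_L design_subalgebra noise_subalgebra design_noise_indep T_indep visits_ne g_meas)+

end

lemma random_field_section:
  fixes \<nu> :: "'u measure"
  assumes Z: "random_field P (\<nu> \<Otimes>\<^sub>M L) Z" and u: "u \<in> space \<nu>"
  shows "(\<lambda>x. Z (u, snd x) (fst x)) \<in> borel_measurable (field_algebra P (\<nu> \<Otimes>\<^sub>M L) Z \<Otimes>\<^sub>M L)"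
    and "(\<lambda>x. Z (u, snd x) (fst x)) \<in> borel_measurable (P \<Otimes>\<^sub>M L)"
proof -
  let ?F = "field_algebra P (\<nu> \<Otimes>\<^sub>M L) Z"
  have 1: "(\<lambda>(w, s). Z s w) \<in> borel_measurable (?F \<Otimes>\<^sub>M (\<nu> \<Otimes>\<^sub>M L))"
    using Z by (simp add: random_field_def)
  have 2: "(\<lambda>x. (fst x, (u, snd x))) \<in> ?F \<Otimes>\<^sub>M L \<rightarrow>\<^sub>M ?F \<Otimes>\<^sub>M (\<nu> \<Otimes>\<^sub>M L)"
    using u by simp
  show 3: "(\<lambda>x. Z (u, snd x) (fst x)) \<in> borel_measurable (?F \<Otimes>\<^sub>M L)"
    using measurable_compose[OF 2 1] by (simp only: prod.case)
  show "(\<lambda>x. Z (u, snd x) (fst x)) \<in> borel_measurable (P \<Otimes>\<^sub>M L)"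
    by (rule measurable_pair_subalgebra[OF random_field_subalgebra[OF Z] 3])
qed

section \<open>Moments of the noise and scalar risk at a fixed u\<close>

context longitudinal_model
begin

text \<open>Extended-valued because the condition on \<open>X\<close> bounds only its integral over
  (u, t); at exceptional points it may be infinite.\<close>

definition "second_moment u t = (\<integral>\<^sup>+w. ennreal ((X (u, t) w)\<^sup>2) \<partial>P)"

text \<open>The argument is a frozen pair (w, t): the noise that visit p would carry if it took
  place at time t. Inserting the design point for t recovers the noise in the observation.\<close>

definition "noise u p x = Xs (fst p) (u, snd x) (fst x) + \<tau> (snd x) * \<eta> (fst p) (snd p) u (fst x)"

lemmas X_section = random_field_section[OF X_field, simplified space_nu, OF UNIV_I]

lemmas Xs_section = random_field_section[OF Xs_field, simplified space_nu, OF _ UNIV_I]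

lemma eta_measurable:
  assumes "(i, j) \<in> I"
  shows "\<eta> i j u \<in> borel_measurable (field_algebra P \<nu> (\<eta> i j))" "\<eta> i j u \<in> borel_measurable algebra_\<eta>"
    "\<eta> i j u \<in> borel_measurable noise_algebra"
proof -
  show 1: "\<eta> i j u \<in> borel_measurable (field_algebra P \<nu> (\<eta> i j))"
    by (rule random_field_point[OF eta_field[OF assms]]) (simp add: space_nu)
  show "\<eta> i j u \<in> borel_measurable algebra_\<eta>" "\<eta> i j u \<in> borel_measurable noise_algebra"
    by (rule measurable_from_subalg[OF eta_noise_subalgebra(2)[OF assms] 1]
             measurable_from_subalg[OF eta_noise_subalgebra(1)[OF assms] 1])+
qed

lemma eta_moments:
  assumes ij: "(i, j) \<in> I"
  shows "integrable P (\<eta> i j u)" "expectation (\<eta> i j u) = 0"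
    "integrable P (\<lambda>w. (\<eta> i j u w)\<^sup>2)" "expectation (\<lambda>w. (\<eta> i j u w)\<^sup>2) = 1"
proof -
  show "integrable P (\<eta> i j u)" and 1: "expectation (\<eta> i j u) = 0"
    using eta_mean[OF ij, of u] by (auto simp: has_bochner_integral_iff)
  show 2: "expectation (\<lambda>w. (\<eta> i j u w)\<^sup>2) = 1"
    using eta_var[OF ij, of u] by (simp add: 1)
  \<comment> \<open>A non-integrable function would have Bochner integral 0 by default, whereas this
    one has integral 1.\<close>
  then show "integrable P (\<lambda>w. (\<eta> i j u w)\<^sup>2)"
    using not_integrable_integral_eq by fastforce
qed

lemma eta_orthogonal:
  assumes "p \<in> I" "q \<in> I" "p \<noteq> q"
  shows "integrable P (\<lambda>w. \<eta> (fst p) (snd p) u w * \<eta> (fst q) (snd q) u w)"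
    and "expectation (\<lambda>w. \<eta> (fst p) (snd p) u w * \<eta> (fst q) (snd q) u w) = 0"
proof -
  have pq: "(fst p, snd p) \<in> I" "(fst q, snd q) \<in> I" using assms by auto
  have ind: "indep_set (sets (field_algebra P \<nu> ((\<lambda>(i, j). \<eta> i j) p))) (sets (field_algebra P \<nu> ((\<lambda>(i, j). \<eta> i j) q)))"
  proof (rule indep_fields_field_algebras[OF eta_indep _ assms])
    show "r \<in> I \<Longrightarrow> random_field P \<nu> ((\<lambda>(i, j). \<eta> i j) r)" for r
      using eta_field by (cases r) simp
  qed
  have ind': "indep_set (sets (field_algebra P \<nu> (\<eta> (fst p) (snd p)))) (sets (field_algebra P \<nu> (\<eta> (fst q) (snd q))))"
    using ind by (simp add: case_prod_unfold)
  note e = expectation_mult_indep_set[OF ind' random_field_subalgebra[OF eta_field[OF pq(1)]]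
      random_field_subalgebra[OF eta_field[OF pq(2)]] eta_measurable(1)[OF pq(1)] eta_measurable(1)[OF pq(2)]
      eta_moments(1)[OF pq(1)] eta_moments(1)[OF pq(2)], of u u]
  show "integrable P (\<lambda>w. \<eta> (fst p) (snd p) u w * \<eta> (fst q) (snd q) u w)" by (rule e(1))
  show "expectation (\<lambda>w. \<eta> (fst p) (snd p) u w * \<eta> (fst q) (snd q) u w) = 0"
    using e(2) eta_moments(2)[OF pq(1), of u] by simp
qed

lemma Xs_measurable:
  assumes "i \<in> {1..n}" "t \<in> {a..b}"
  shows "Xs i (u, t) \<in> borel_measurable (field_algebra P (\<nu> \<Otimes>\<^sub>M L) (Xs i))" "Xs i (u, t) \<in> borel_measurable P"
    "Xs i (u, t) \<in> borel_measurable algebra_X"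
proof -
  have s: "(u, t) \<in> space (\<nu> \<Otimes>\<^sub>M L)" using assms(2) by (simp add: space_field)
  note 1 = random_field_point[OF Xs_field[OF assms(1)] s]
  show "Xs i (u, t) \<in> borel_measurable (field_algebra P (\<nu> \<Otimes>\<^sub>M L) (Xs i))" "Xs i (u, t) \<in> borel_measurable P"
    by (fact 1)+
  show "Xs i (u, t) \<in> borel_measurable algebra_X"
    by (rule measurable_from_subalg[OF X_noise_subalgebra(2)[OF assms(1)] 1(1)])
qed

lemma Xs_moments:
  assumes i: "i \<in> {1..n}" and t: "t \<in> {a..b}"
  shows "integrable P (Xs i (u, t))" "expectation (Xs i (u, t)) = 0"
    "(\<integral>\<^sup>+w. ennreal ((Xs i (u, t) w)\<^sup>2) \<partial>P) = second_moment u t"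
proof -
  have s: "(u, t) \<in> space (\<nu> \<Otimes>\<^sub>M L)" using t by (simp add: space_field)
  note law = same_field_law_expectation[OF Xs_law[OF i] Xs_field[OF i] X_field s s]
  show "integrable P (Xs i (u, t))" "expectation (Xs i (u, t)) = 0"
    using law(1)[of fst] law(3)[of fst] X_mean[OF t, of u] by (auto simp: has_bochner_integral_iff)
  show "(\<integral>\<^sup>+w. ennreal ((Xs i (u, t) w)\<^sup>2) \<partial>P) = second_moment u t"
    using law(2)[of "\<lambda>p. (fst p)\<^sup>2"] by (simp add: second_moment_def)
qed

lemma Xs_square_integrable:
  assumes "i \<in> {1..n}" "t \<in> {a..b}" "second_moment u t < \<infinity>"
  shows "integrable P (\<lambda>w. (Xs i (u, t) w)\<^sup>2)"
  using Xs_moments(3)[OF assms(1,2), of u] assms(3) Xs_measurable(2)[OF assms(1,2), of u]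
  by (intro integrableI_bounded) auto

lemma noise_measurable:
  assumes "p \<in> I"
  shows "noise u p \<in> borel_measurable (noise_algebra \<Otimes>\<^sub>M L)"
proof -
  obtain i j where p: "p = (i, j)" "(i, j) \<in> I" using assms by (cases p) auto
  have 1: "(\<lambda>x. Xs i (u, snd x) (fst x)) \<in> borel_measurable (noise_algebra \<Otimes>\<^sub>M L)"
    by (rule measurable_pair_subalgebra[OF X_noise_subalgebra(1) Xs_section(1)]) (use visitsD p in auto)
  note [measurable] = eta_measurable(3)[OF p(2)] tau_meas 1
  show ?thesis unfolding noise_def p(1) fst_conv snd_conv by measurable
qed

lemma noise_mean:
  assumes "p \<in> I" "t \<in> {a..b}"
  shows "integrable P (\<lambda>w. noise u p (w, t))" "expectation (\<lambda>w. noise u p (w, t)) = 0"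
proof -
  have p: "(fst p, snd p) \<in> I" "fst p \<in> {1..n}" using assms visitsD[of "fst p" "snd p"] by auto
  note m = Xs_moments(1,2)[OF p(2) assms(2), of u] eta_moments(1,2)[OF p(1), of u]
  show "integrable P (\<lambda>w. noise u p (w, t))" "expectation (\<lambda>w. noise u p (w, t)) = 0"
    using m by (simp_all add: noise_def)
qed

text \<open>The constant c stands for the mean at (u, t). The linear terms vanish by centring, the
  product of field and error also by independence of their algebras, and unit variance leaves the
  squared noise level.\<close>

lemma noise_second_moment:
  assumes p: "p \<in> I" and t: "t \<in> {a..b}" and fin: "second_moment u t < \<infinity>"
  shows "(\<integral>\<^sup>+w. ennreal ((c + noise u p (w, t))\<^sup>2) \<partial>P)
    = ennreal (c\<^sup>2) + second_moment u t + ennreal ((\<tau> t)\<^sup>2)"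
proof -
  have p': "(fst p, snd p) \<in> I" "fst p \<in> {1..n}" using p visitsD[of "fst p" "snd p"] by auto
  let ?x = "Xs (fst p) (u, t)" and ?e = "\<eta> (fst p) (snd p) u"
  note x = Xs_moments[OF p'(2) t, of u] and e = eta_moments[OF p'(1), of u]
  have x2: "integrable P (\<lambda>w. (?x w)\<^sup>2)" by (rule Xs_square_integrable[OF p'(2) t fin])
  have xe: "integrable P (\<lambda>w. ?x w * ?e w)" "expectation (\<lambda>w. ?x w * ?e w) = 0"
    using expectation_mult_indep_set[OF X_eta_indep _ _ Xs_measurable(3)[OF p'(2) t] eta_measurable(2)[OF p'(1)] x(1) e(1)]
      algebras_subalgebra[of 1] algebras_subalgebra[of 2] x(2) by (simp_all add: algebras_def)
  have eq: "(c + noise u p (w, t))\<^sup>2 = c\<^sup>2 + (?x w)\<^sup>2 + (\<tau> t)\<^sup>2 * (?e w)\<^sup>2 + 2 * c * ?x w + 2 * c * \<tau> t * ?e w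
      + 2 * \<tau> t * (?x w * ?e w)" for w
    by (simp add: noise_def power2_eq_square algebra_simps)
  have int: "integrable P (\<lambda>w. (c + noise u p (w, t))\<^sup>2)"
    unfolding eq using x x2 e xe by simp
  have "expectation (\<lambda>w. (c + noise u p (w, t))\<^sup>2) = c\<^sup>2 + expectation (\<lambda>w. (?x w)\<^sup>2) + (\<tau> t)\<^sup>2"
    unfolding eq using x x2 e xe prob_space by simp
  moreover have "second_moment u t = ennreal (expectation (\<lambda>w. (?x w)\<^sup>2))"
    using nn_integral_eq_integral[OF x2] x(3) by simp
  ultimately show ?thesis
    using nn_integral_eq_integral[OF int] by (simp add: ennreal_plus)
qed

lemma second_moment_measurable: "second_moment u \<in> borel_measurable L"
proof -
  interpret L: finite_measure L by (rule finite_L)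
  have "(\<lambda>(t, w). (X (u, t) w)) \<in> borel_measurable (L \<Otimes>\<^sub>M P)"
    using measurable_compose[OF measurable_pair_swap' X_section(2), of u]
    by (simp add: case_prod_unfold)
  then show ?thesis unfolding second_moment_def by measurable
qed

text \<open>The coefficient of a subject's own curve at u along the basis function. It depends on
  the subject and not on the visit, which is the source of all covariance within a subject.\<close>

definition "score u \<phi> i w = (\<integral>t. Xs i (u, t) w * \<phi> t \<partial>L)"

text \<open>Stated for any Z with the second moments of \<open>X\<close>, so that it covers both
  \<open>X\<close> and its copies.\<close>

lemma joint_square_integrable:
  assumes fin: "(\<integral>\<^sup>+t. second_moment u t \<partial>L) < \<infinity>"
    and Z: "(\<lambda>x. Z (u, snd x) (fst x)) \<in> borel_measurable (P \<Otimes>\<^sub>M L)"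
    and sm: "\<And>t. t \<in> {a..b} \<Longrightarrow> (\<integral>\<^sup>+w. ennreal ((Z (u, t) w)\<^sup>2) \<partial>P) = second_moment u t"
  shows "integrable (P \<Otimes>\<^sub>M L) (\<lambda>x. (Z (u, snd x) (fst x))\<^sup>2)"
proof -
  interpret L: finite_measure L by (rule finite_L)
  interpret PL: pair_sigma_finite P L ..
  have "(\<integral>\<^sup>+x. ennreal ((Z (u, snd x) (fst x))\<^sup>2) \<partial>(P \<Otimes>\<^sub>M L))
      = (\<integral>\<^sup>+t. \<integral>\<^sup>+w. ennreal ((Z (u, t) w)\<^sup>2) \<partial>P \<partial>L)"
    using PL.nn_integral_snd[of "\<lambda>x. ennreal ((Z (u, snd x) (fst x))\<^sup>2)"] Z by simp
  also have "\<dots> = (\<integral>\<^sup>+t. second_moment u t \<partial>L)"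
    by (intro nn_integral_cong sm) simp
  finally show ?thesis
    using fin Z by (intro integrableI_bounded) auto
qed

lemma score_moments:
  assumes fin: "(\<integral>\<^sup>+t. second_moment u t \<partial>L) < \<infinity>"
    and phi [measurable]: "\<phi> \<in> borel_measurable L" and bd: "\<forall>t\<in>{a..b}. \<bar>\<phi> t\<bar> \<le> B"
    and i: "i \<in> {1..n}"
  shows "score u \<phi> i \<in> borel_measurable (field_algebra P (\<nu> \<Otimes>\<^sub>M L) (Xs i))"
    "score u \<phi> i \<in> borel_measurable algebra_X"
    "score u \<phi> i \<in> borel_measurable P"
    "AE w in P. integrable L (\<lambda>t. Xs i (u, t) w * \<phi> t)"
    "integrable P (score u \<phi> i)" "expectation (score u \<phi> i) = 0"
    "integrable P (\<lambda>w. (score u \<phi> i w)\<^sup>2)"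
    "ennreal (expectation (\<lambda>w. (score u \<phi> i w)\<^sup>2)) = (\<integral>\<^sup>+w. ennreal ((\<integral>t. X (u, t) w * \<phi> t \<partial>L)\<^sup>2) \<partial>P)"
proof -
  interpret L: finite_measure L by (rule finite_L)
  note [measurable] = Xs_section(1)[OF i, of u]
  show 1: "score u \<phi> i \<in> borel_measurable (field_algebra P (\<nu> \<Otimes>\<^sub>M L) (Xs i))"
    unfolding score_def[abs_def] by measurable
  show "score u \<phi> i \<in> borel_measurable algebra_X"
    by (rule measurable_from_subalg[OF X_noise_subalgebra(2)[OF i] 1])
  show "score u \<phi> i \<in> borel_measurable P"
    by (rule measurable_from_subalg[OF random_field_subalgebra[OF Xs_field[OF i]] 1])
  have bd': "\<forall>t\<in>space L. \<bar>\<phi> t\<bar> \<le> B" using bd by simp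
  have sqs: "integrable (P \<Otimes>\<^sub>M L) (\<lambda>x. (Xs i (u, snd x) (fst x))\<^sup>2)"
    by (rule joint_square_integrable[OF fin Xs_section(2)[OF i]]) (rule Xs_moments(3)[OF i])
  have sq: "integrable (P \<Otimes>\<^sub>M L) (\<lambda>x. (X (u, snd x) (fst x))\<^sup>2)"
    by (rule joint_square_integrable[OF fin X_section(2)]) (simp add: second_moment_def)
  note s = integral_section_square[OF finite_L Xs_section(2)[OF i] sqs phi bd', simplified fst_conv snd_conv]
  note s' = integral_section_square[OF finite_L X_section(2) sq phi bd', simplified fst_conv snd_conv]
  show "AE w in P. integrable L (\<lambda>t. Xs i (u, t) w * \<phi> t)" using s(3) .
  show "integrable P (score u \<phi> i)" unfolding score_def[abs_def] using s(4) .
  show "integrable P (\<lambda>w. (score u \<phi> i w)\<^sup>2)" unfolding score_def[abs_def] using s(1) .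
  have "expectation (score u \<phi> i) = (\<integral>t. (\<integral>w. Xs i (u, t) w \<partial>P) * \<phi> t \<partial>L)"
    unfolding score_def[abs_def] using s(5) .
  also have "\<dots> = (\<integral>t. 0 \<partial>L)"
    by (rule Bochner_Integration.integral_cong) (use Xs_moments(2)[OF i] in auto)
  finally show "expectation (score u \<phi> i) = 0" by simp
  have "expectation (\<lambda>w. (score u \<phi> i w)\<^sup>2) = (\<integral>p. (\<integral>w. Xs i (u, fst p) w * Xs i (u, snd p) w \<partial>P) * (\<phi> (fst p) * \<phi> (snd p)) \<partial>(L \<Otimes>\<^sub>M L))"
    unfolding score_def[abs_def] using s(2) .
  \<comment> \<open>The copy is replaced by \<open>X\<close> inside the double integral, pair of
    times by pair of times; this makes the second moment the same for all subjects.\<close>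
  also have "\<dots> = (\<integral>p. (\<integral>w. X (u, fst p) w * X (u, snd p) w \<partial>P) * (\<phi> (fst p) * \<phi> (snd p)) \<partial>(L \<Otimes>\<^sub>M L))"
  proof (rule Bochner_Integration.integral_cong[OF refl])
    fix p assume "p \<in> space (L \<Otimes>\<^sub>M L)"
    then have s: "(u, fst p) \<in> space (\<nu> \<Otimes>\<^sub>M L)" "(u, snd p) \<in> space (\<nu> \<Otimes>\<^sub>M L)"
      by (auto simp: space_field space_pair_measure[of L L])
    show "(\<integral>w. Xs i (u, fst p) w * Xs i (u, snd p) w \<partial>P) * (\<phi> (fst p) * \<phi> (snd p))
        = (\<integral>w. X (u, fst p) w * X (u, snd p) w \<partial>P) * (\<phi> (fst p) * \<phi> (snd p))"
      using same_field_law_expectation(1)[OF Xs_law[OF i] Xs_field[OF i] X_field s, of "\<lambda>z. fst z * snd z"]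
      by simp
  qed
  also have "\<dots> = expectation (\<lambda>w. (\<integral>t. X (u, t) w * \<phi> t \<partial>L)\<^sup>2)"
    using s'(2)[symmetric] .
  finally show "ennreal (expectation (\<lambda>w. (score u \<phi> i w)\<^sup>2)) = (\<integral>\<^sup>+w. ennreal ((\<integral>t. X (u, t) w * \<phi> t \<partial>L)\<^sup>2) \<partial>P)"
    using nn_integral_eq_integral[OF s'(1)] by simp
qed

text \<open>The error does not depend on t, so the noise coefficient is the score plus
  \<open>\<kappa>\<close> times the error, with a deterministic \<open>\<kappa>\<close>. Errors of
  distinct visits are orthogonal to each other and to all scores. Scores of different subjects are
  orthogonal as well, while two visits of one subject share the same score and leave its second
  moment.\<close>

lemma noise_covariance:
  assumes fin: "(\<integral>\<^sup>+t. second_moment u t \<partial>L) < \<infinity>"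
    and phi [measurable]: "\<phi> \<in> borel_measurable L" and bd: "\<forall>t\<in>{a..b}. \<bar>\<phi> t\<bar> \<le> B"
    and pq: "p \<in> I" "q \<in> I" "p \<noteq> q"
  defines "\<xi> \<equiv> \<lambda>p w. \<integral>t. noise u p (w, t) * \<phi> t \<partial>L"
  shows "(\<integral>w. \<xi> p w * \<xi> q w \<partial>P)
    = (if fst p = fst q then expectation (\<lambda>w. (score u \<phi> (fst p) w)\<^sup>2) else 0)"
proof -
  interpret L: finite_measure L by (rule finite_L)
  define \<kappa> where "\<kappa> = (\<integral>t. \<tau> t * \<phi> t \<partial>L)"
  let ?y = "\<lambda>p. score u \<phi> (fst p)" and ?e = "\<lambda>p. \<eta> (fst p) (snd p) u"
  have I': "(fst r, snd r) \<in> I" "fst r \<in> {1..n}" if "r \<in> I" for r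
    using that visitsD[of "fst r" "snd r"] by auto
  note y = score_moments[OF fin phi bd I'(2)]
  note e = eta_moments[OF I'(1)]
  note [measurable] = tau_meas
  have tauphi: "integrable L (\<lambda>t. \<tau> t * \<phi> t)"
  proof (rule L.integrable_const_bound[of _ "\<tau>' * B"])
    show "AE t in L. norm (\<tau> t * \<phi> t) \<le> \<tau>' * B"
      by (rule AE_I2) (auto simp: abs_mult intro!: mult_mono tau_le bd[rule_format] order_trans[OF abs_ge_zero tau_le])
  qed measurable
  have xi: "AE w in P. \<xi> r w = ?y r w + \<kappa> * ?e r w" if r: "r \<in> I" for r
    using y(4)[OF r]
  proof eventually_elim
    case (elim w)
    have "\<xi> r w = (\<integral>t. Xs (fst r) (u, t) w * \<phi> t + ?e r w * (\<tau> t * \<phi> t) \<partial>L)"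
      by (simp add: \<xi>_def noise_def algebra_simps)
    also have "\<dots> = ?y r w + \<kappa> * ?e r w"
      using elim tauphi by (simp add: score_def \<kappa>_def mult.commute)
    finally show ?case .
  qed
  have xim: "\<xi> r \<in> borel_measurable P" if "r \<in> I" for r
  proof -
    note [measurable] = measurable_pair_subalgebra[OF noise_subalgebra noise_measurable[OF that]]
    show ?thesis unfolding \<xi>_def by measurable
  qed
  have ym: "?y r \<in> borel_measurable P" "?e r \<in> borel_measurable P" if r: "r \<in> I" for r
    using y(3)[OF r] e(1)[OF r] by auto
  have sub: "subalgebra P algebra_X" "subalgebra P algebra_\<eta>"
    using algebras_subalgebra[of 1] algebras_subalgebra[of 2] by (simp_all add: algebras_def)
  have ye: "integrable P (\<lambda>w. ?y r w * ?e s w)" "expectation (\<lambda>w. ?y r w * ?e s w) = 0" if "r \<in> I" "s \<in> I" for r s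
    using expectation_mult_indep_set[OF X_eta_indep sub y(2)[OF that(1)] eta_measurable(2)[OF I'(1)[OF that(2)]] y(5)[OF that(1)] e(1)[OF that(2)]]
      e(2)[OF that(2)] by auto
  have yy: "integrable P (\<lambda>w. ?y p w * ?y q w)"
    "expectation (\<lambda>w. ?y p w * ?y q w) = (if fst p = fst q then expectation (\<lambda>w. (?y p w)\<^sup>2) else 0)"
  proof -
    have "integrable P (\<lambda>w. ?y p w * ?y q w) \<and>
      expectation (\<lambda>w. ?y p w * ?y q w) = (if fst p = fst q then expectation (\<lambda>w. (?y p w)\<^sup>2) else 0)"
    proof (cases "fst p = fst q")
      case True
      then show ?thesis using y(7)[OF pq(1)] by (simp add: power2_eq_square)
    next
      case False
      have ind: "indep_set (sets (field_algebra P (\<nu> \<Otimes>\<^sub>M L) (Xs (fst p)))) (sets (field_algebra P (\<nu> \<Otimes>\<^sub>M L) (Xs (fst q))))"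
        by (rule indep_fields_field_algebras[OF Xs_indep Xs_field I'(2)[OF pq(1)] I'(2)[OF pq(2)] False])
      then show ?thesis
        using expectation_mult_indep_set[OF ind X_subalgebra[OF I'(2)[OF pq(1)]] X_subalgebra[OF I'(2)[OF pq(2)]] y(1)[OF pq(1)] y(1)[OF pq(2)] y(5)[OF pq(1)] y(5)[OF pq(2)]]
          y(6)[OF pq(1)] False by simp
    qed
    then show "integrable P (\<lambda>w. ?y p w * ?y q w)"
    "expectation (\<lambda>w. ?y p w * ?y q w) = (if fst p = fst q then expectation (\<lambda>w. (?y p w)\<^sup>2) else 0)" by auto
  qed
  have "(\<integral>w. \<xi> p w * \<xi> q w \<partial>P) = (\<integral>w. (?y p w + \<kappa> * ?e p w) * (?y q w + \<kappa> * ?e q w) \<partial>P)"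
    using xi[OF pq(1)] xi[OF pq(2)] xim[OF pq(1)] xim[OF pq(2)] ym[OF pq(1)] ym[OF pq(2)]
    by (intro integral_cong_AE) auto
  also have "\<dots> = (\<integral>w. ?y p w * ?y q w + \<kappa> * (?y p w * ?e q w) + \<kappa> * (?y q w * ?e p w) + \<kappa>\<^sup>2 * (?e p w * ?e q w) \<partial>P)"
    by (rule Bochner_Integration.integral_cong) (simp_all add: power2_eq_square algebra_simps)
  also have "\<dots> = (if fst p = fst q then expectation (\<lambda>w. (?y p w)\<^sup>2) else 0)"
    using yy ye[OF pq(1,2)] ye[OF pq(2,1)] eta_orthogonal[OF pq, of u] by simp
  finally show ?thesis .
qed

text \<open>The proof gives an equality up to the positive part of the off-diagonal weight. The
  subtracted multiple of \<open>\<beta>\<close> squared is moved to the left, so that the statement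
  stays nonnegative and can be integrated over u by Tonelli.\<close>

lemma pointwise_risk:
  fixes f \<phi> :: "real \<Rightarrow> real" and c :: "nat \<times> nat \<Rightarrow> real" and u
  assumes fin: "(\<integral>\<^sup>+t. second_moment u t \<partial>L) < \<infinity>"
    and f_meas [measurable]: "f \<in> borel_measurable L" and f_sq: "integrable L (\<lambda>t. (f t)\<^sup>2)"
    and phi [measurable]: "\<phi> \<in> borel_measurable L" and bd: "\<forall>t\<in>{a..b}. \<bar>\<phi> t\<bar> \<le> B"
    and c: "(\<Sum>p\<in>I. c p) = 1"
  defines "\<beta> \<equiv> \<integral>t. f t * \<phi> t \<partial>L"
    and "T' \<equiv> \<lambda>(i, j). T i j"
  shows "(\<integral>\<^sup>+w. ennreal (((\<Sum>p\<in>I. c p * ((f (T' p w) + noise u p (w, T' p w)) * \<phi> (T' p w) / g (T' p w))) - \<beta>)\<^sup>2) \<partial>P)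
      + ennreal ((\<Sum>p\<in>I. (c p)\<^sup>2) * \<beta>\<^sup>2)
    \<le> ennreal (\<Sum>p\<in>I. (c p)\<^sup>2)
        * (\<integral>\<^sup>+t. (ennreal ((f t)\<^sup>2) + second_moment u t + ennreal ((\<tau> t)\<^sup>2)) * ennreal ((\<phi> t)\<^sup>2 / g t) \<partial>L)
      + ennreal (max (\<Sum>p\<in>I. \<Sum>q\<in>I - {p}. if fst p = fst q then c p * c q else 0) 0)
        * (\<integral>\<^sup>+w. ennreal ((\<integral>t. X (u, t) w * \<phi> t \<partial>L)\<^sup>2) \<partial>P)"
    (is "?risk + _ \<le> ennreal ?S2 * ?J + ennreal (max ?C 0) * ?v")
proof -
  interpret L: finite_measure L by (rule finite_L)
  note [measurable] = tau_meas g_meas second_moment_measurable[of u]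
  \<comment> \<open>Finiteness for almost every t allows the moment expansion at fixed t to be used
    under the integral.\<close>
  have V_fin: "AE t in L. second_moment u t < \<infinity>"
    using nn_integral_PInf_AE[OF second_moment_measurable, of u] fin by (simp add: less_top)
  have nn_noise: "(\<integral>\<^sup>+x. ennreal ((h (snd x) + noise u p x)\<^sup>2 * \<psi> (snd x)) \<partial>(design.PG \<Otimes>\<^sub>M L))
      = (\<integral>\<^sup>+t. (ennreal ((h t)\<^sup>2) + second_moment u t + ennreal ((\<tau> t)\<^sup>2)) * ennreal (\<psi> t) \<partial>L)"
    if p: "p \<in> I" and [measurable]: "h \<in> borel_measurable L" "\<psi> \<in> borel_measurable L"
      and pos: "\<And>t. t \<in> {a..b} \<Longrightarrow> 0 \<le> \<psi> t" for p and h \<psi> :: "real \<Rightarrow> real"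
  proof -
    note [measurable] = noise_measurable[OF p, of u]
    have m: "(\<lambda>w. noise u p (w, t)) \<in> borel_measurable P" if "t \<in> {a..b}" for t
      using noise_mean(1)[OF p that] by auto
    have "(\<integral>\<^sup>+x. ennreal ((h (snd x) + noise u p x)\<^sup>2 * \<psi> (snd x)) \<partial>(design.PG \<Otimes>\<^sub>M L))
      = (\<integral>\<^sup>+t. \<integral>\<^sup>+w. ennreal ((h t + noise u p (w, t))\<^sup>2 * \<psi> t) \<partial>P \<partial>L)"
      by (subst design.nn_integral_PG_L) simp_all
    also have "\<dots> = (\<integral>\<^sup>+t. (ennreal ((h t)\<^sup>2) + second_moment u t + ennreal ((\<tau> t)\<^sup>2)) * ennreal (\<psi> t) \<partial>L)"
    proof (rule nn_integral_cong_AE)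
      show "AE t in L. (\<integral>\<^sup>+w. ennreal ((h t + noise u p (w, t))\<^sup>2 * \<psi> t) \<partial>P)
        = (ennreal ((h t)\<^sup>2) + second_moment u t + ennreal ((\<tau> t)\<^sup>2)) * ennreal (\<psi> t)"
        using V_fin AE_space
      proof eventually_elim
        case (elim t)
        then have t: "t \<in> {a..b}" by simp
        show ?case
          using noise_second_moment[OF p t elim(1), of "h t"] pos[OF t] m[OF t]
          by (simp add: ennreal_mult nn_integral_multc)
      qed
    qed
    finally show ?thesis .
  qed
  \<comment> \<open>This is \<open>nn_noise\<close> with mean 0 and weight 1; the field contributes
    its integrated second moment and the error the integral of the bounded squared noise
    level.\<close>
  have W_sq: "integrable (design.PG \<Otimes>\<^sub>M L) (\<lambda>x. (noise u p x)\<^sup>2)" if p: "p \<in> I" for p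
  proof (rule integrableI_bounded)
    note [measurable] = noise_measurable[OF p, of u]
    show "(\<lambda>x. (noise u p x)\<^sup>2) \<in> borel_measurable (design.PG \<Otimes>\<^sub>M L)" by measurable
    have tau2: "(\<integral>\<^sup>+t. ennreal ((\<tau> t)\<^sup>2) \<partial>L) < \<infinity>"
    proof -
      have "integrable L (\<lambda>t. (\<tau> t)\<^sup>2)"
        by (rule L.integrable_const_bound[of _ "\<tau>'\<^sup>2"])
           (auto intro!: tau_le power_mono[of "\<bar>\<tau> _\<bar>" \<tau>' 2, simplified])
      then show ?thesis by (simp add: integrable_iff_bounded)
    qed
    have "(\<integral>\<^sup>+x. ennreal (norm ((noise u p x)\<^sup>2)) \<partial>(design.PG \<Otimes>\<^sub>M L))
      = (\<integral>\<^sup>+t. second_moment u t \<partial>L) + (\<integral>\<^sup>+t. ennreal ((\<tau> t)\<^sup>2) \<partial>L)"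
      using nn_noise[OF p, of "\<lambda>_. 0" "\<lambda>_. 1"] by (simp add: nn_integral_add)
    also have "\<dots> < \<infinity>" using fin tau2 by simp
    finally show "(\<integral>\<^sup>+x. ennreal (norm ((noise u p x)\<^sup>2)) \<partial>(design.PG \<Otimes>\<^sub>M L)) < \<infinity>" .
  qed
  have bd': "t \<in> space L \<Longrightarrow> \<bar>\<phi> t\<bar> \<le> B" for t using bd by auto
  have g': "t \<in> space L \<Longrightarrow> \<gamma> \<le> g t" for t using g_ge by auto
  have mean: "p \<in> I \<Longrightarrow> t \<in> space L \<Longrightarrow> (\<integral>w. noise u p (w, t) \<partial>P) = 0" for p t using noise_mean(2) by auto
  let ?err = "\<lambda>w. ((\<Sum>p\<in>I. c p * ((f (T' p w) + noise u p (w, T' p w)) * \<phi> (T' p w) / g (T' p w))) - \<beta>)\<^sup>2"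
  let ?\<xi> = "\<lambda>p w. \<integral>t. noise u p (w, t) * \<phi> t \<partial>L"
  have R1: "integrable P ?err"
    unfolding \<beta>_def T'_def
    by (rule design.weighted_estimator_risk(1)[where B = B and \<gamma> = \<gamma>])
       (fact f_meas f_sq phi bd' \<gamma>_pos g' noise_measurable W_sq mean c)+
  have R2: "expectation ?err = (\<Sum>p\<in>I. (c p)\<^sup>2 * ((\<integral>x. (f (snd x) + noise u p x)\<^sup>2 * ((\<phi> (snd x))\<^sup>2 / g (snd x)) \<partial>(design.PG \<Otimes>\<^sub>M L)) - \<beta>\<^sup>2))
         + (\<Sum>p\<in>I. \<Sum>q\<in>I - {p}. c p * c q * (\<integral>w. ?\<xi> p w * ?\<xi> q w \<partial>P))"
    unfolding \<beta>_def T'_def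
    by (rule design.weighted_estimator_risk(2)[where B = B and \<gamma> = \<gamma>])
       (fact f_meas f_sq phi bd' \<gamma>_pos g' noise_measurable W_sq mean c)+
  have R3: "integrable (design.PG \<Otimes>\<^sub>M L) (\<lambda>x. (f (snd x) + noise u p x)\<^sup>2 * ((\<phi> (snd x))\<^sup>2 / g (snd x)))"
    if "p \<in> I" for p
    by (rule design.weighted_estimator_risk(3)[where B = B and \<gamma> = \<gamma> and c = c])
       (fact f_meas f_sq phi bd' \<gamma>_pos g' noise_measurable W_sq mean c that)+
  \<comment> \<open>Real versions of the two extended integrals. The computation with possibly
    negative off-diagonal weights is carried out in the reals; finiteness is established just
    below.\<close>
  define J where "J = enn2real ?J"
  define y2 where "y2 = enn2real ?v"
  have J: "(\<integral>x. (f (snd x) + noise u p x)\<^sup>2 * ((\<phi> (snd x))\<^sup>2 / g (snd x)) \<partial>(design.PG \<Otimes>\<^sub>M L)) = J"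
    and J': "?J = ennreal J" if p: "p \<in> I" for p
  proof -
    have gpos: "t \<in> {a..b} \<Longrightarrow> 0 < g t" for t using g_ge[of t] \<gamma>_pos by auto
    have "ennreal (\<integral>x. (f (snd x) + noise u p x)\<^sup>2 * ((\<phi> (snd x))\<^sup>2 / g (snd x)) \<partial>(design.PG \<Otimes>\<^sub>M L)) =
      (\<integral>\<^sup>+x. ennreal ((f (snd x) + noise u p x)\<^sup>2 * ((\<phi> (snd x))\<^sup>2 / g (snd x))) \<partial>(design.PG \<Otimes>\<^sub>M L))"
      by (rule nn_integral_eq_integral[symmetric, OF R3[OF p]])
         (auto simp: space_pair_measure intro!: AE_I2 divide_nonneg_pos gpos)
    also have "\<dots> = ?J"
      by (rule nn_noise[OF p, of f "\<lambda>t. (\<phi> t)\<^sup>2 / g t"]) (auto intro!: divide_nonneg_pos gpos)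
    finally have eq: "ennreal (\<integral>x. (f (snd x) + noise u p x)\<^sup>2 * ((\<phi> (snd x))\<^sup>2 / g (snd x)) \<partial>(design.PG \<Otimes>\<^sub>M L)) = ?J" .
    have "0 \<le> (\<integral>x. (f (snd x) + noise u p x)\<^sup>2 * ((\<phi> (snd x))\<^sup>2 / g (snd x)) \<partial>(design.PG \<Otimes>\<^sub>M L))"
      by (rule Bochner_Integration.integral_nonneg) (auto simp: space_pair_measure intro!: divide_nonneg_pos gpos)
    with eq show "(\<integral>x. (f (snd x) + noise u p x)\<^sup>2 * ((\<phi> (snd x))\<^sup>2 / g (snd x)) \<partial>(design.PG \<Otimes>\<^sub>M L)) = J"
      "?J = ennreal J"
      unfolding J_def eq[symmetric] by simp_all
  qed
  have y2: "expectation (\<lambda>w. (score u \<phi> i w)\<^sup>2) = y2" and y2': "?v = ennreal y2" if "i \<in> {1..n}" for i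
    using score_moments(8)[OF fin phi bd that] unfolding y2_def
    by (simp_all add: enn2real_eq_posreal_iff[symmetric] flip: score_moments(8)[OF fin phi bd that])
  \<comment> \<open>The finiteness statements \<open>J'\<close> and \<open>y2'\<close> are relative
    to a visit and a subject; any visit supplies both.\<close>
  obtain i j where ij: "(i, j) \<in> I" using visits_ne by auto
  have y2_nonneg: "0 \<le> y2" by (simp add: y2_def)
  have J_nonneg: "0 \<le> J" by (simp add: J_def)
  have "expectation ?err = (\<Sum>p\<in>I. (c p)\<^sup>2 * (J - \<beta>\<^sup>2)) + (\<Sum>p\<in>I. \<Sum>q\<in>I - {p}. c p * c q * (if fst p = fst q then y2 else 0))"
    unfolding R2
  proof (intro arg_cong2[where f = "(+)"] sum.cong refl)
    fix p assume p: "p \<in> I"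
    show "(c p)\<^sup>2 * ((\<integral>x. (f (snd x) + noise u p x)\<^sup>2 * ((\<phi> (snd x))\<^sup>2 / g (snd x)) \<partial>(design.PG \<Otimes>\<^sub>M L)) - \<beta>\<^sup>2)
        = (c p)\<^sup>2 * (J - \<beta>\<^sup>2)"
      by (simp only: J[OF p])
    fix q assume q: "q \<in> I - {p}"
    have "fst p \<in> {1..n}" using p visitsD[of "fst p" "snd p"] by simp
    then show "c p * c q * (\<integral>w. ?\<xi> p w * ?\<xi> q w \<partial>P) = c p * c q * (if fst p = fst q then y2 else 0)"
      using noise_covariance[OF fin phi bd p, of q] q y2 by auto
  qed
  also have "\<dots> = ?S2 * (J - \<beta>\<^sup>2) + ?C * y2"
    by (simp add: sum_distrib_right if_distrib[of "\<lambda>x. x * y2"] if_distrib[of "\<lambda>x. _ * x"] cong: if_cong)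
  finally have E: "expectation ?err + ?S2 * \<beta>\<^sup>2 = ?S2 * J + ?C * y2"
    by (simp add: algebra_simps)
  have "?risk + ennreal (?S2 * \<beta>\<^sup>2) = ennreal (expectation ?err + ?S2 * \<beta>\<^sup>2)"
    using nn_integral_eq_integral[OF R1]
    by (subst ennreal_plus) (auto intro!: sum_nonneg mult_nonneg_nonneg)
  \<comment> \<open>The only loss in the argument at fixed u: the off-diagonal weight is replaced by
    its positive part, which is harmless for a nonnegative second moment.\<close>
  also have "\<dots> \<le> ennreal (?S2 * J + max ?C 0 * y2)"
    unfolding E using y2_nonneg by (intro ennreal_leI add_left_mono mult_right_mono) auto
  also have "\<dots> = ennreal ?S2 * ?J + ennreal (max ?C 0) * ?v"
    unfolding J'[OF ij] y2'[OF visitsD[OF ij]]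
    using y2_nonneg J_nonneg by (simp add: ennreal_plus ennreal_mult sum_nonneg)
  finally show ?thesis .
qed

end

section \<open>Orthonormal expansions\<close>

lemma square_integrable_integral_mult:
  "square_integrable N f \<Longrightarrow> square_integrable N h \<Longrightarrow> integrable N (\<lambda>x. f x * h x)"
  unfolding square_integrable_def by (intro integrable_product_of_squares) auto

lemma sq_norm_eq_ennreal:
  "square_integrable N f \<Longrightarrow> sq_norm N f = ennreal (\<integral>x. (f x)\<^sup>2 \<partial>N)"
  unfolding square_integrable_def sq_norm_def by (intro nn_integral_eq_integral) auto

lemma square_integrable_iff_sq_norm:
  "f \<in> borel_measurable N \<Longrightarrow> square_integrable N f \<longleftrightarrow> sq_norm N f < \<infinity>"
  by (auto simp: square_integrable_def sq_norm_def integrable_iff_bounded)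

text \<open>The coefficients d are arbitrary: the choice d = c yields Bessel and Parseval, and the
  choice of estimated coefficients splits the loss into estimation error and truncation
  error.\<close>

lemma orthonormal_expansion_error:
  assumes basis: "orthonormal_basis N \<phi>" and f: "square_integrable N f"
  defines "c \<equiv> \<lambda>k. \<integral>x. f x * \<phi> k x \<partial>N"
  shows "square_integrable N (\<lambda>x. (\<Sum>k=1..K. d k * \<phi> k x) - f x)"
    and "(\<integral>x. ((\<Sum>k=1..K. d k * \<phi> k x) - f x)\<^sup>2 \<partial>N)
      = (\<integral>x. (f x)\<^sup>2 \<partial>N) - (\<Sum>k=1..K. (c k)\<^sup>2) + (\<Sum>k=1..K. (d k - c k)\<^sup>2)"
proof -
  have phi: "square_integrable N (\<phi> k)" if "1 \<le> k" for k
    using basis that by (simp add: orthonormal_basis_def)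
  have orth: "(\<integral>x. \<phi> k x * \<phi> l x \<partial>N) = (if k = l then 1 else 0)" if "1 \<le> k" "1 \<le> l" for k l
    using basis that by (simp add: orthonormal_basis_def)
  have pp: "integrable N (\<lambda>x. \<phi> k x * \<phi> l x)" if "1 \<le> k" "1 \<le> l" for k l
    using phi that by (simp add: square_integrable_integral_mult)
  have fp: "integrable N (\<lambda>x. f x * \<phi> k x)" if "1 \<le> k" for k
    using phi f that by (simp add: square_integrable_integral_mult)
  have ff: "integrable N (\<lambda>x. (f x)\<^sup>2)" using f by (simp add: square_integrable_def)
  have eq: "((\<Sum>k=1..K. d k * \<phi> k x) - f x)\<^sup>2
      = (\<Sum>k=1..K. \<Sum>l=1..K. d k * d l * (\<phi> k x * \<phi> l x)) - (\<Sum>k=1..K. 2 * d k * (f x * \<phi> k x)) + (f x)\<^sup>2" for x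
  proof -
    have "(\<Sum>k=1..K. d k * \<phi> k x)\<^sup>2 = (\<Sum>k=1..K. \<Sum>l=1..K. d k * d l * (\<phi> k x * \<phi> l x))"
      by (simp add: power2_eq_square sum_product algebra_simps)
    moreover have "2 * (\<Sum>k=1..K. d k * \<phi> k x) * f x = (\<Sum>k=1..K. 2 * d k * (f x * \<phi> k x))"
      by (simp add: sum_distrib_left sum_distrib_right algebra_simps)
    ultimately show ?thesis by (simp add: power2_diff)
  qed
  have int: "integrable N (\<lambda>x. ((\<Sum>k=1..K. d k * \<phi> k x) - f x)\<^sup>2)"
    unfolding eq
    by (intro Bochner_Integration.integrable_add Bochner_Integration.integrable_diff
        Bochner_Integration.integrable_sum integrable_mult_right pp fp ff) auto
  have m: "(\<lambda>x. (\<Sum>k=1..K. d k * \<phi> k x) - f x) \<in> borel_measurable N"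
    using f phi unfolding square_integrable_def
    by (intro borel_measurable_diff borel_measurable_sum borel_measurable_times borel_measurable_const)
       (simp_all only: atLeastAtMost_iff)
  show "square_integrable N (\<lambda>x. (\<Sum>k=1..K. d k * \<phi> k x) - f x)"
    using int m by (simp add: square_integrable_def)
  have "(\<integral>x. ((\<Sum>k=1..K. d k * \<phi> k x) - f x)\<^sup>2 \<partial>N)
      = (\<Sum>k=1..K. \<Sum>l=1..K. d k * d l * (if k = l then 1 else 0)) - (\<Sum>k=1..K. 2 * d k * c k) + (\<integral>x. (f x)\<^sup>2 \<partial>N)"
    unfolding eq
  proof -
    have 1: "integrable N (\<lambda>x. \<Sum>k=1..K. \<Sum>l=1..K. d k * d l * (\<phi> k x * \<phi> l x))"
      "integrable N (\<lambda>x. \<Sum>k=1..K. 2 * d k * (f x * \<phi> k x))"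
      by (intro Bochner_Integration.integrable_sum integrable_mult_right pp fp; simp)+
    have 2: "(\<integral>x. (\<Sum>k=1..K. 2 * d k * (f x * \<phi> k x)) \<partial>N) = (\<Sum>k=1..K. 2 * d k * c k)"
      using fp by (subst Bochner_Integration.integral_sum) (auto simp: c_def)
    have "(\<integral>x. (\<Sum>k=1..K. \<Sum>l=1..K. d k * d l * (\<phi> k x * \<phi> l x)) \<partial>N)
        = (\<Sum>k=1..K. \<integral>x. (\<Sum>l=1..K. d k * d l * (\<phi> k x * \<phi> l x)) \<partial>N)"
      by (intro Bochner_Integration.integral_sum Bochner_Integration.integrable_sum integrable_mult_right pp) auto
    also have "\<dots> = (\<Sum>k=1..K. \<Sum>l=1..K. \<integral>x. d k * d l * (\<phi> k x * \<phi> l x) \<partial>N)"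
      by (intro sum.cong refl Bochner_Integration.integral_sum integrable_mult_right pp) auto
    also have "\<dots> = (\<Sum>k=1..K. \<Sum>l=1..K. d k * d l * (if k = l then 1 else 0))"
      by (intro sum.cong refl) (use orth in auto)
    finally show "(\<integral>x. (\<Sum>k=1..K. \<Sum>l=1..K. d k * d l * (\<phi> k x * \<phi> l x)) - (\<Sum>k=1..K. 2 * d k * (f x * \<phi> k x)) + (f x)\<^sup>2 \<partial>N)
      = (\<Sum>k=1..K. \<Sum>l=1..K. d k * d l * (if k = l then 1 else 0)) - (\<Sum>k=1..K. 2 * d k * c k) + (\<integral>x. (f x)\<^sup>2 \<partial>N)"
      using 1 2 ff by (simp only: Bochner_Integration.integral_add Bochner_Integration.integral_diff Bochner_Integration.integrable_diff)
  qed
  also have "(\<Sum>k=1..K. \<Sum>l=1..K. d k * d l * (if k = l then 1 else 0)) = (\<Sum>k=1..K. (d k)\<^sup>2)"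
    by (simp add: power2_eq_square if_distrib[of "\<lambda>x. _ * x"] sum.delta cong: if_cong)
  also have "(\<Sum>k=1..K. (d k)\<^sup>2) - (\<Sum>k=1..K. 2 * d k * c k) + (\<integral>x. (f x)\<^sup>2 \<partial>N)
     = (\<integral>x. (f x)\<^sup>2 \<partial>N) - (\<Sum>k=1..K. (c k)\<^sup>2) + (\<Sum>k=1..K. (d k - c k)\<^sup>2)"
    by (simp add: power2_diff sum.distrib sum_subtractf algebra_simps)
  finally show "(\<integral>x. ((\<Sum>k=1..K. d k * \<phi> k x) - f x)\<^sup>2 \<partial>N)
      = (\<integral>x. (f x)\<^sup>2 \<partial>N) - (\<Sum>k=1..K. (c k)\<^sup>2) + (\<Sum>k=1..K. (d k - c k)\<^sup>2)" .
qed

text \<open>The approximation error with the exact coefficients is nonnegative. Only measurability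
  is asked, since the inequality is applied to individual paths of \<open>X\<close>; an infinite
  norm makes it trivial.\<close>

lemma bessel_inequality:
  assumes basis: "orthonormal_basis N \<phi>" and f: "f \<in> borel_measurable N"
  shows "(\<Sum>k=1..K. ennreal ((\<integral>x. f x * \<phi> k x \<partial>N)\<^sup>2)) \<le> sq_norm N f"
proof (cases "square_integrable N f")
  case True
  let ?c = "\<lambda>k. \<integral>x. f x * \<phi> k x \<partial>N"
  have "0 \<le> (\<integral>x. ((\<Sum>k=1..K. ?c k * \<phi> k x) - f x)\<^sup>2 \<partial>N)" by simp
  also have "\<dots> = (\<integral>x. (f x)\<^sup>2 \<partial>N) - (\<Sum>k=1..K. (?c k)\<^sup>2)"
    using orthonormal_expansion_error(2)[OF basis True, of ?c K] by simp
  finally show ?thesis using True by (simp add: sq_norm_eq_ennreal)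
next
  case False
  then show ?thesis using f by (simp add: square_integrable_iff_sq_norm not_less top_unique)
qed

text \<open>Completeness is given as convergence of partial expansions in norm. By the error
  identity the squared distance is the squared norm minus the partial sum of squares, so the sums
  converge to the squared norm.\<close>

lemma parseval:
  assumes basis: "orthonormal_basis N \<phi>" and f: "square_integrable N f"
  shows "(\<lambda>k. (\<integral>x. f x * \<phi> (Suc k) x \<partial>N)\<^sup>2) sums (\<integral>x. (f x)\<^sup>2 \<partial>N)"
proof -
  let ?c = "\<lambda>k. \<integral>x. f x * \<phi> k x \<partial>N"
  have eq: "sq_norm N (\<lambda>x. f x - (\<Sum>k=1..K. ?c k * \<phi> k x)) = ennreal ((\<integral>x. (f x)\<^sup>2 \<partial>N) - (\<Sum>k=1..K. (?c k)\<^sup>2))" for K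
  proof -
    have "sq_norm N (\<lambda>x. f x - (\<Sum>k=1..K. ?c k * \<phi> k x)) = sq_norm N (\<lambda>x. (\<Sum>k=1..K. ?c k * \<phi> k x) - f x)"
      by (simp add: sq_norm_def power2_commute)
    then show ?thesis
      using sq_norm_eq_ennreal[OF orthonormal_expansion_error(1)[OF basis f, of ?c K]]
        orthonormal_expansion_error(2)[OF basis f, of ?c K] by simp
  qed
  have "(\<lambda>K. ennreal ((\<integral>x. (f x)\<^sup>2 \<partial>N) - (\<Sum>k=1..K. (?c k)\<^sup>2))) \<longlonglongrightarrow> ennreal 0"
  proof -
    have "(\<lambda>K. sq_norm N (\<lambda>x. f x - (\<Sum>k=1..K. ?c k * \<phi> k x))) \<longlonglongrightarrow> 0"
      by (rule basis[unfolded orthonormal_basis_def, THEN conjunct2, THEN conjunct2, rule_format, OF f])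
    then show ?thesis by (simp only: eq ennreal_0)
  qed
  moreover have "0 \<le> (\<integral>x. (f x)\<^sup>2 \<partial>N) - (\<Sum>k=1..K. (?c k)\<^sup>2)" for K
    using orthonormal_expansion_error(2)[OF basis f, of ?c K]
      Bochner_Integration.integral_nonneg[of N "\<lambda>x. ((\<Sum>k=1..K. ?c k * \<phi> k x) - f x)\<^sup>2"] by simp
  ultimately have "(\<lambda>K. (\<integral>x. (f x)\<^sup>2 \<partial>N) - (\<Sum>k=1..K. (?c k)\<^sup>2)) \<longlonglongrightarrow> 0"
    by (subst (asm) tendsto_ennreal_iff) auto
  from tendsto_diff[OF tendsto_const[of "\<integral>x. (f x)\<^sup>2 \<partial>N"] this]
  have "(\<lambda>K. \<Sum>k=1..K. (?c k)\<^sup>2) \<longlonglongrightarrow> (\<integral>x. (f x)\<^sup>2 \<partial>N)" by simp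
  \<comment> \<open>Basis indices start at 1 and series indices at 0, hence the successor in the
    statement.\<close>
  moreover have "(\<Sum>k=1..K. (?c k)\<^sup>2) = (\<Sum>k<K. (?c (Suc k))\<^sup>2)" for K
    by (simp add: sum.atLeast1_atMost_eq)
  ultimately show ?thesis by (simp add: sums_def)
qed

text \<open>Loss and squared norm have the same tail, which starts at the coefficient K + 1. That
  common tail is both the squared bias and the correction to the subtracted norm.\<close>

lemma sq_norm_expansion_error:
  assumes basis: "orthonormal_basis N \<phi>" and f: "square_integrable N f"
  defines "c \<equiv> \<lambda>k. \<integral>x. f x * \<phi> k x \<partial>N"
  shows "sq_norm N (\<lambda>x. (\<Sum>k=1..K. d k * \<phi> k x) - f x)
      = (\<Sum>k=1..K. ennreal ((d k - c k)\<^sup>2)) + (\<Sum>k. ennreal ((c (K + 1 + k))\<^sup>2))"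
    and "sq_norm N f = (\<Sum>k=1..K. ennreal ((c k)\<^sup>2)) + (\<Sum>k. ennreal ((c (K + 1 + k))\<^sup>2))"
proof -
  have s: "(\<lambda>k. (c (Suc k))\<^sup>2) sums (\<integral>x. (f x)\<^sup>2 \<partial>N)"
    using parseval[OF basis f] by (simp add: c_def)
  have tail: "(\<lambda>k. (c (K + 1 + k))\<^sup>2) sums ((\<integral>x. (f x)\<^sup>2 \<partial>N) - (\<Sum>k=1..K. (c k)\<^sup>2))"
    using sums_split_initial_segment[OF s, of K] by (simp add: sum.atLeast1_atMost_eq add.commute)
  have e: "(\<Sum>k. ennreal ((c (K + 1 + k))\<^sup>2)) = ennreal ((\<integral>x. (f x)\<^sup>2 \<partial>N) - (\<Sum>k=1..K. (c k)\<^sup>2))"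
    by (rule suminf_ennreal_eq[OF _ tail]) simp
  have nonneg: "0 \<le> (\<integral>x. (f x)\<^sup>2 \<partial>N) - (\<Sum>k=1..K. (c k)\<^sup>2)"
    by (rule sums_le[OF _ sums_zero tail]) simp
  have ee: "(\<Sum>k=1..K. ennreal ((h k)\<^sup>2)) = ennreal (\<Sum>k=1..K. (h k)\<^sup>2)" for h :: "nat \<Rightarrow> real"
    by (rule sum_ennreal) simp
  have "sq_norm N (\<lambda>x. (\<Sum>k=1..K. d k * \<phi> k x) - f x)
      = ennreal ((\<Sum>k=1..K. (d k - c k)\<^sup>2) + ((\<integral>x. (f x)\<^sup>2 \<partial>N) - (\<Sum>k=1..K. (c k)\<^sup>2)))"
    unfolding sq_norm_eq_ennreal[OF orthonormal_expansion_error(1)[OF basis f, of d K]]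
      orthonormal_expansion_error(2)[OF basis f, of d K] c_def by (rule arg_cong[of _ _ ennreal]) linarith
  also have "\<dots> = (\<Sum>k=1..K. ennreal ((d k - c k)\<^sup>2)) + (\<Sum>k. ennreal ((c (K + 1 + k))\<^sup>2))"
    unfolding e ee by (rule ennreal_plus[OF sum_nonneg nonneg]) simp
  finally show "sq_norm N (\<lambda>x. (\<Sum>k=1..K. d k * \<phi> k x) - f x)
      = (\<Sum>k=1..K. ennreal ((d k - c k)\<^sup>2)) + (\<Sum>k. ennreal ((c (K + 1 + k))\<^sup>2))" .
  have "sq_norm N f = ennreal ((\<Sum>k=1..K. (c k)\<^sup>2) + ((\<integral>x. (f x)\<^sup>2 \<partial>N) - (\<Sum>k=1..K. (c k)\<^sup>2)))"
    unfolding sq_norm_eq_ennreal[OF f] by (rule arg_cong[of _ _ ennreal]) linarith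
  also have "\<dots> = (\<Sum>k=1..K. ennreal ((c k)\<^sup>2)) + (\<Sum>k. ennreal ((c (K + 1 + k))\<^sup>2))"
    unfolding e ee by (rule ennreal_plus[OF sum_nonneg nonneg]) simp
  finally show "sq_norm N f = (\<Sum>k=1..K. ennreal ((c k)\<^sup>2)) + (\<Sum>k. ennreal ((c (K + 1 + k))\<^sup>2))" .
qed

text \<open>Beyond K every weight k^(2s) is at least K^(2s), so K^(2s) times the tail is bounded by
  the weighted sum over all indices.\<close>

lemma smooth_tail_bound:
  fixes A :: "nat \<Rightarrow> ennreal" and s C :: real
  assumes sum: "(\<Sum>\<^sub>\<infinity>k\<in>{1..}. ennreal (real k powr (2 * s)) * A k) \<le> ennreal C"
    and s: "0 \<le> s" and C: "0 \<le> C" and K: "1 \<le> K"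
  shows "(\<Sum>k. A (K + 1 + k)) \<le> ennreal (C * real K powr (- 2 * s))"
proof -
  let ?f = "\<lambda>k. ennreal (real k powr (2 * s)) * A k"
  have "ennreal (real K powr (2 * s)) * (\<Sum>k. A (K + 1 + k)) = (\<Sum>k. ennreal (real K powr (2 * s)) * A (K + 1 + k))"
    by simp
  also have "\<dots> \<le> (\<Sum>k. ?f (K + 1 + k))"
    using s by (intro suminf_le mult_right_mono ennreal_leI powr_mono2) auto
  \<comment> \<open>The series is a supremum over initial segments and the unordered sum one over
    finite sets; each shifted segment is such a finite set.\<close>
  also have "\<dots> = (SUP N. \<Sum>k<N. ?f (K + 1 + k))"
    by (rule suminf_eq_SUP)
  also have "\<dots> \<le> (\<Sum>\<^sub>\<infinity>k\<in>{1..}. ?f k)"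
  proof (rule SUP_least)
    fix N
    have "(\<Sum>k<N. ?f (K + 1 + k)) = sum ?f ((\<lambda>k. K + 1 + k) ` {..<N})"
      by (subst sum.reindex) (auto simp: inj_on_def)
    also have "\<dots> \<le> (\<Sum>\<^sub>\<infinity>k\<in>{1..}. ?f k)"
      by (subst nonneg_infsum_complete) (auto intro!: SUP_upper)
    finally show "(\<Sum>k<N. ?f (K + 1 + k)) \<le> (\<Sum>\<^sub>\<infinity>k\<in>{1..}. ?f k)" .
  qed
  also note sum
  finally have *: "ennreal (real K powr (2 * s)) * (\<Sum>k. A (K + 1 + k)) \<le> ennreal C" .
  have pos: "0 < real K powr (2 * s)" using K by simp
  have "(\<Sum>k. A (K + 1 + k)) = ennreal (real K powr (- 2 * s)) * (ennreal (real K powr (2 * s)) * (\<Sum>k. A (K + 1 + k)))"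
    using K by (simp add: mult.assoc[symmetric] ennreal_mult[symmetric] powr_add[symmetric])
  also have "\<dots> \<le> ennreal (real K powr (- 2 * s)) * ennreal C"
    by (rule mult_left_mono[OF *]) simp
  also have "\<dots> = ennreal (C * real K powr (- 2 * s))"
    using C by (simp add: ennreal_mult[symmetric] mult.commute)
  finally show ?thesis .
qed

section \<open>Integrated risk\<close>

text \<open>For almost every u the section of the mean is square integrable and the expansion in t
  applies with d k = bh k u w. Joint measurability of the estimated coefficients permits exchanging
  the expectation with the integral over u.\<close>

lemma risk_series_estimator:
  fixes \<nu> :: "'u measure" and L :: "real measure" and \<mu> :: "'u \<times> real \<Rightarrow> real"
  assumes P: "prob_space P" and nu: "finite_measure \<nu>" and L: "finite_measure L"
    and basis: "orthonormal_basis L \<phi>" and mu: "square_integrable (\<nu> \<Otimes>\<^sub>M L) \<mu>"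
    and bh: "\<And>k. k \<in> {1..K} \<Longrightarrow> (\<lambda>x. bh k (snd x) (fst x)) \<in> borel_measurable (P \<Otimes>\<^sub>M \<nu>)"
  defines "tail \<equiv> \<Sum>k. sq_norm \<nu> (basis_coeff L \<phi> \<mu> (K + 1 + k))"
  shows "risk P (\<nu> \<Otimes>\<^sub>M L) (\<lambda>(u, t) w. \<Sum>k=1..K. bh k u w * \<phi> k t) \<mu>
      = (\<Sum>k=1..K. \<integral>\<^sup>+u. \<integral>\<^sup>+w. ennreal ((bh k u w - basis_coeff L \<phi> \<mu> k u)\<^sup>2) \<partial>P \<partial>\<nu>) + tail"
    and "sq_norm (\<nu> \<Otimes>\<^sub>M L) \<mu> = (\<Sum>k=1..K. sq_norm \<nu> (basis_coeff L \<phi> \<mu> k)) + tail"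
    and "AE u in \<nu>. square_integrable L (\<lambda>t. \<mu> (u, t))"
proof -
  interpret P: prob_space P by fact
  interpret nu: finite_measure \<nu> by fact
  interpret L: finite_measure L by fact
  interpret nuL: pair_sigma_finite \<nu> L ..
  interpret Pnu: pair_sigma_finite P \<nu> ..
  have mu_m [measurable]: "\<mu> \<in> borel_measurable (\<nu> \<Otimes>\<^sub>M L)" and mu2: "integrable (\<nu> \<Otimes>\<^sub>M L) (\<lambda>x. (\<mu> x)\<^sup>2)"
    using mu by (auto simp: square_integrable_def)
  have phi: "\<phi> k \<in> borel_measurable L" if "1 \<le> k" for k
    using basis that unfolding orthonormal_basis_def square_integrable_def by blast
  have mu_sec: "(\<lambda>t. \<mu> (u, t)) \<in> borel_measurable L" if "u \<in> space \<nu>" for u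
    by (rule measurable_compose[OF measurable_Pair1'[OF that] mu_m])
  show ae: "AE u in \<nu>. square_integrable L (\<lambda>t. \<mu> (u, t))"
    using nuL.AE_integrable_fst'[OF mu2] AE_space
    by eventually_elim (simp add: square_integrable_def mu_sec)
  have bc: "basis_coeff L \<phi> \<mu> k \<in> borel_measurable \<nu>" if "1 \<le> k" for k
  proof -
    note [measurable] = phi[OF that]
    show ?thesis unfolding basis_coeff_def[abs_def] by measurable
  qed
  define r where "r u = (\<Sum>k. ennreal ((basis_coeff L \<phi> \<mu> (K + 1 + k) u)\<^sup>2))" for u
  have bc2: "(\<lambda>u. ennreal ((basis_coeff L \<phi> \<mu> k u)\<^sup>2)) \<in> borel_measurable \<nu>" if "1 \<le> k" for k
    using bc[OF that] by measurable
  have r_m: "r \<in> borel_measurable \<nu>"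
  proof -
    have [measurable]: "(\<lambda>u. ennreal ((basis_coeff L \<phi> \<mu> (K + 1 + k) u)\<^sup>2)) \<in> borel_measurable \<nu>" for k
      by (rule bc2) simp
    show ?thesis unfolding r_def by measurable
  qed
  have r_int: "(\<integral>\<^sup>+u. r u \<partial>\<nu>) = tail"
    unfolding r_def tail_def sq_norm_def by (rule nn_integral_suminf) (rule bc2, simp)
  have "sq_norm (\<nu> \<Otimes>\<^sub>M L) \<mu> = (\<integral>\<^sup>+u. sq_norm L (\<lambda>t. \<mu> (u, t)) \<partial>\<nu>)"
    unfolding sq_norm_def by (subst L.nn_integral_fst[symmetric]) auto
  also have "\<dots> = (\<integral>\<^sup>+u. (\<Sum>k=1..K. ennreal ((basis_coeff L \<phi> \<mu> k u)\<^sup>2)) + r u \<partial>\<nu>)"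
  proof (rule nn_integral_cong_AE)
    show "AE u in \<nu>. sq_norm L (\<lambda>t. \<mu> (u, t)) = (\<Sum>k=1..K. ennreal ((basis_coeff L \<phi> \<mu> k u)\<^sup>2)) + r u"
      using ae
    proof eventually_elim
      case (elim u)
      show ?case
        using sq_norm_expansion_error(2)[OF basis elim, of K]
        by (simp only: r_def basis_coeff_def)
    qed
  qed
  also have "\<dots> = (\<Sum>k=1..K. sq_norm \<nu> (basis_coeff L \<phi> \<mu> k)) + tail"
    unfolding sq_norm_def r_int[symmetric]
    by (subst nn_integral_add, intro borel_measurable_sum bc2, simp, rule r_m,
        subst nn_integral_sum, rule bc2, simp, rule refl)
  finally show "sq_norm (\<nu> \<Otimes>\<^sub>M L) \<mu> = (\<Sum>k=1..K. sq_norm \<nu> (basis_coeff L \<phi> \<mu> k)) + tail" .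
  let ?d = "\<lambda>k u w. ennreal ((bh k u w - basis_coeff L \<phi> \<mu> k u)\<^sup>2)"
  have d_m: "(\<lambda>x. ?d k (snd x) (fst x)) \<in> borel_measurable (P \<Otimes>\<^sub>M \<nu>)" if "k \<in> {1..K}" for k
  proof -
    have "1 \<le> k" using that by simp
    note [measurable] = bh[OF that] bc[OF this]
    show ?thesis by measurable
  qed
  have d_sec: "(\<lambda>u. ?d k u w) \<in> borel_measurable \<nu>" if "k \<in> {1..K}" "w \<in> space P" for k w
    using measurable_compose[OF measurable_Pair1'[OF that(2)] d_m[OF that(1)]] by simp
  have "risk P (\<nu> \<Otimes>\<^sub>M L) (\<lambda>(u, t) w. \<Sum>k=1..K. bh k u w * \<phi> k t) \<mu>
    = (\<integral>\<^sup>+w. (\<Sum>k=1..K. \<integral>\<^sup>+u. ?d k u w \<partial>\<nu>) + tail \<partial>P)"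
    unfolding risk_def
  proof (rule nn_integral_cong)
    fix w assume w: "w \<in> space P"
    have m: "(\<lambda>x. (\<Sum>k=1..K. bh k (fst x) w * \<phi> k (snd x)) - \<mu> x) \<in> borel_measurable (\<nu> \<Otimes>\<^sub>M L)"
    proof (intro borel_measurable_diff borel_measurable_sum borel_measurable_times mu_m)
      fix k assume k: "k \<in> {1..K}"
      then show "(\<lambda>x. \<phi> k (snd x)) \<in> borel_measurable (\<nu> \<Otimes>\<^sub>M L)"
        by (intro measurable_compose[OF measurable_snd] phi) simp
      have "(\<lambda>u. bh k u w) \<in> borel_measurable \<nu>"
        using measurable_compose[OF measurable_Pair1'[OF w] bh[OF k]] by simp
      then show "(\<lambda>x. bh k (fst x) w) \<in> borel_measurable (\<nu> \<Otimes>\<^sub>M L)"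
        by (rule measurable_compose[OF measurable_fst])
    qed
    have "sq_norm (\<nu> \<Otimes>\<^sub>M L) (\<lambda>x. (case x of (u, t) \<Rightarrow> \<lambda>w. \<Sum>k=1..K. bh k u w * \<phi> k t) w - \<mu> x)
      = (\<integral>\<^sup>+u. sq_norm L (\<lambda>t. (\<Sum>k=1..K. bh k u w * \<phi> k t) - \<mu> (u, t)) \<partial>\<nu>)"
      using m unfolding sq_norm_def case_prod_unfold by (subst L.nn_integral_fst[symmetric]) auto
    also have "\<dots> = (\<integral>\<^sup>+u. (\<Sum>k=1..K. ?d k u w) + r u \<partial>\<nu>)"
    proof (rule nn_integral_cong_AE)
      show "AE u in \<nu>. sq_norm L (\<lambda>t. (\<Sum>k=1..K. bh k u w * \<phi> k t) - \<mu> (u, t)) = (\<Sum>k=1..K. ?d k u w) + r u"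
        using ae
      proof eventually_elim
        case (elim u)
        show ?case
          using sq_norm_expansion_error(1)[OF basis elim, of "\<lambda>k. bh k u w" K]
          by (simp only: r_def basis_coeff_def)
      qed
    qed
    also have "\<dots> = (\<Sum>k=1..K. \<integral>\<^sup>+u. ?d k u w \<partial>\<nu>) + tail"
      unfolding r_int[symmetric]
      by (subst nn_integral_add, intro borel_measurable_sum d_sec w, assumption, rule r_m,
          subst nn_integral_sum, rule d_sec[OF _ w], assumption, rule refl)
    finally show "sq_norm (\<nu> \<Otimes>\<^sub>M L) (\<lambda>x. (case x of (u, t) \<Rightarrow> \<lambda>w. \<Sum>k=1..K. bh k u w * \<phi> k t) w - \<mu> x)
      = (\<Sum>k=1..K. \<integral>\<^sup>+u. ?d k u w \<partial>\<nu>) + tail" .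
  qed
  \<comment> \<open>The tail is deterministic and passes through the expectation because
    \<open>P\<close> has total mass one.\<close>
  also have "\<dots> = (\<Sum>k=1..K. \<integral>\<^sup>+w. \<integral>\<^sup>+u. ?d k u w \<partial>\<nu> \<partial>P) + tail"
  proof -
    have m: "(\<lambda>w. \<integral>\<^sup>+u. ?d k u w \<partial>\<nu>) \<in> borel_measurable P" if "k \<in> {1..K}" for k
      using nu.borel_measurable_nn_integral_fst[OF d_m[OF that]] by simp
    show ?thesis
      by (subst nn_integral_add, intro borel_measurable_sum m, assumption, simp,
          subst nn_integral_sum, rule m, assumption, simp add: P.emeasure_space_1)
  qed
  \<comment> \<open>Tonelli puts u outermost, where the bound of the scalar risk at fixed u can be
    inserted.\<close>
  also have "(\<Sum>k=1..K. \<integral>\<^sup>+w. \<integral>\<^sup>+u. ?d k u w \<partial>\<nu> \<partial>P) = (\<Sum>k=1..K. \<integral>\<^sup>+u. \<integral>\<^sup>+w. ?d k u w \<partial>P \<partial>\<nu>)"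
  proof (intro sum.cong refl)
    fix k assume k: "k \<in> {1..K}"
    show "(\<integral>\<^sup>+w. \<integral>\<^sup>+u. ?d k u w \<partial>\<nu> \<partial>P) = (\<integral>\<^sup>+u. \<integral>\<^sup>+w. ?d k u w \<partial>P \<partial>\<nu>)"
      using Pnu.Fubini[OF d_m[OF k]] by simp
  qed
  finally show "risk P (\<nu> \<Otimes>\<^sub>M L) (\<lambda>(u, t) w. \<Sum>k=1..K. bh k u w * \<phi> k t) \<mu>
      = (\<Sum>k=1..K. \<integral>\<^sup>+u. \<integral>\<^sup>+w. ennreal ((bh k u w - basis_coeff L \<phi> \<mu> k u)\<^sup>2) \<partial>P \<partial>\<nu>) + tail" .
qed

section \<open>Integrated moments and the constants C1 and C2\<close>

context longitudinal_model
begin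

abbreviation "field_space \<equiv> \<nu> \<Otimes>\<^sub>M L"

lemma X_joint: "(\<lambda>x. X (snd x) (fst x)) \<in> borel_measurable (P \<Otimes>\<^sub>M field_space)"
  using random_field_joint[OF X_field] by (simp add: case_prod_unfold)

lemma second_moment_joint: "(\<lambda>x. second_moment (fst x) (snd x)) \<in> borel_measurable field_space"
proof -
  have "(\<lambda>x. X (fst x) (snd x)) \<in> borel_measurable (field_space \<Otimes>\<^sub>M P)"
    using measurable_compose[OF measurable_pair_swap' X_joint] by (simp add: case_prod_unfold)
  then have "(\<lambda>x. ennreal ((X (fst x) (snd x))\<^sup>2)) \<in> borel_measurable (field_space \<Otimes>\<^sub>M P)"
    by measurable
  from borel_measurable_nn_integral_fst[OF this] show ?thesis
    by (simp add: second_moment_def)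
qed

lemma sigma_finite_spaces: "sigma_finite_measure \<nu>" "sigma_finite_measure L" "sigma_finite_measure field_space"
proof -
  interpret nu: finite_measure \<nu> by (rule nu_finite)
  interpret L: finite_measure L by (rule finite_L)
  interpret pair_sigma_finite \<nu> L ..
  show "sigma_finite_measure \<nu>" "sigma_finite_measure L" "sigma_finite_measure field_space" by unfold_locales
qed

lemma integral_second_moment:
  "(\<integral>\<^sup>+u. \<integral>\<^sup>+t. second_moment u t \<partial>L \<partial>\<nu>) = C2 P field_space X"
proof -
  interpret S: sigma_finite_measure field_space by (rule sigma_finite_spaces)
  interpret L: sigma_finite_measure L by (rule sigma_finite_spaces)
  interpret PS: pair_sigma_finite P field_space ..
  have sq: "(\<lambda>x. ennreal ((X (snd x) (fst x))\<^sup>2)) \<in> borel_measurable (P \<Otimes>\<^sub>M field_space)"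
    using X_joint by measurable
  have "C2 P field_space X = (\<integral>\<^sup>+s. \<integral>\<^sup>+w. ennreal ((X s w)\<^sup>2) \<partial>P \<partial>field_space)"
    unfolding C2_def sq_norm_def
    using PS.Fubini[OF sq] by simp
  also have "\<dots> = (\<integral>\<^sup>+s. second_moment (fst s) (snd s) \<partial>field_space)"
    by (simp add: second_moment_def)
  also have "\<dots> = (\<integral>\<^sup>+u. \<integral>\<^sup>+t. second_moment u t \<partial>L \<partial>\<nu>)"
    using L.nn_integral_fst[OF second_moment_joint] by simp
  finally show ?thesis ..
qed

text \<open>On the diagonal the kernel is the expected squared norm of X(.,t), provided this is
  finite; otherwise the Bochner integrals in \<open>cov_kernel\<close> may take their default value
  0. Finiteness of \<open>C2\<close> excludes this for almost every t, which is enough because t is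
  integrated afterwards.\<close>

lemma second_moment_le_cov_kernel:
  assumes C2: "C2 P field_space X < \<infinity>"
  shows "AE t in L. (\<integral>\<^sup>+u. second_moment u t \<partial>\<nu>) \<le> sup_norm ({a..b} \<times> {a..b}) (cov_kernel P \<nu> X)"
proof -
  interpret nu: sigma_finite_measure \<nu> by (rule sigma_finite_spaces)
  interpret L: sigma_finite_measure L by (rule sigma_finite_spaces)
  interpret nuL: pair_sigma_finite \<nu> L ..
  interpret Pnu: pair_sigma_finite P \<nu> ..
  have m: "(\<lambda>t. \<integral>\<^sup>+u. second_moment u t \<partial>\<nu>) \<in> borel_measurable L"
    using nu.borel_measurable_nn_integral_fst[OF measurable_compose[OF measurable_pair_swap' second_moment_joint]]
    by (simp add: case_prod_unfold)
  have "(\<integral>\<^sup>+t. \<integral>\<^sup>+u. second_moment u t \<partial>\<nu> \<partial>L) = C2 P field_space X"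
    using nuL.Fubini[OF second_moment_joint] integral_second_moment by simp
  then have "AE t in L. (\<integral>\<^sup>+u. second_moment u t \<partial>\<nu>) \<noteq> \<infinity>"
    using C2 by (intro nn_integral_PInf_AE[OF m]) auto
  then show ?thesis
    using AE_space
  proof eventually_elim
    case (elim t)
    then have t: "t \<in> {a..b}" by simp
    have m: "(\<lambda>x. X (snd x, t) (fst x)) \<in> borel_measurable (P \<Otimes>\<^sub>M \<nu>)"
    proof -
      have "(\<lambda>x. (fst x, (snd x, t))) \<in> P \<Otimes>\<^sub>M \<nu> \<rightarrow>\<^sub>M P \<Otimes>\<^sub>M field_space" using t by simp
      from measurable_compose[OF this X_joint] show ?thesis by simp
    qed
    have eq: "(\<integral>\<^sup>+x. ennreal ((X (snd x, t) (fst x))\<^sup>2) \<partial>(P \<Otimes>\<^sub>M \<nu>)) = (\<integral>\<^sup>+u. second_moment u t \<partial>\<nu>)"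
      using Pnu.nn_integral_snd[of "\<lambda>x. ennreal ((X (snd x, t) (fst x))\<^sup>2)"] m
      by (simp add: second_moment_def)
    have int: "integrable (P \<Otimes>\<^sub>M \<nu>) (\<lambda>x. (X (snd x, t) (fst x))\<^sup>2)"
      using elim(1) m eq by (intro integrableI_bounded) (auto simp: less_top)
    have "cov_kernel P \<nu> X (t, t) = (\<integral>x. (X (snd x, t) (fst x))\<^sup>2 \<partial>(P \<Otimes>\<^sub>M \<nu>))"
      using Pnu.integral_fst'[OF int] by (simp add: cov_kernel_def power2_eq_square)
    then have "(\<integral>\<^sup>+u. second_moment u t \<partial>\<nu>) = ennreal (cov_kernel P \<nu> X (t, t))"
      using nn_integral_eq_integral[OF int] eq by simp
    also have "\<dots> \<le> ennreal \<bar>cov_kernel P \<nu> X (t, t)\<bar>" by (rule ennreal_leI) simp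
    also have "\<dots> \<le> sup_norm ({a..b} \<times> {a..b}) (cov_kernel P \<nu> X)"
      unfolding sup_norm_def by (rule SUP_upper) (use t in simp)
    finally show ?case .
  qed
qed

text \<open>Bessel's inequality is applied to each path in t at fixed u and w, before any
  integration; the bound is therefore uniform in K.\<close>

lemma score_second_moment_sum:
  assumes basis: "orthonormal_basis L \<phi>"
  shows "(\<Sum>k=1..K. \<integral>\<^sup>+u. \<integral>\<^sup>+w. ennreal ((\<integral>t. X (u, t) w * \<phi> k t \<partial>L)\<^sup>2) \<partial>P \<partial>\<nu>) \<le> C2 P field_space X"
    and "\<And>k. 1 \<le> k \<Longrightarrow> (\<lambda>u. \<integral>\<^sup>+w. ennreal ((\<integral>t. X (u, t) w * \<phi> k t \<partial>L)\<^sup>2) \<partial>P) \<in> borel_measurable \<nu>"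
proof -
  interpret nu: sigma_finite_measure \<nu> by (rule sigma_finite_spaces)
  interpret L: sigma_finite_measure L by (rule sigma_finite_spaces)
  let ?h = "\<lambda>k u w. ennreal ((\<integral>t. X (u, t) w * \<phi> k t \<partial>L)\<^sup>2)"
  have hm: "(\<lambda>x. ?h k (fst x) (snd x)) \<in> borel_measurable (\<nu> \<Otimes>\<^sub>M P)" if k: "1 \<le> k" for k
  proof -
    have [measurable]: "\<phi> k \<in> borel_measurable L"
      using basis k unfolding orthonormal_basis_def square_integrable_def by blast
    have "(\<lambda>x. (snd (fst x), (fst (fst x), snd x))) \<in> (\<nu> \<Otimes>\<^sub>M P) \<Otimes>\<^sub>M L \<rightarrow>\<^sub>M P \<Otimes>\<^sub>M field_space" by simp
    from measurable_compose[OF this X_joint]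
    have [measurable]: "(\<lambda>x. X (fst (fst x), snd x) (snd (fst x))) \<in> borel_measurable ((\<nu> \<Otimes>\<^sub>M P) \<Otimes>\<^sub>M L)" by simp
    show ?thesis by measurable
  qed
  have hm1: "(\<lambda>u. \<integral>\<^sup>+w. ?h k u w \<partial>P) \<in> borel_measurable \<nu>" if k: "1 \<le> k" for k
    using borel_measurable_nn_integral_fst[OF hm[OF k]] by simp
  have hm2: "?h k u \<in> borel_measurable P" if k: "1 \<le> k" for k u
    using measurable_compose[OF measurable_Pair1' hm[OF k], of u] by (simp add: space_nu)
  show "\<And>k. 1 \<le> k \<Longrightarrow> (\<lambda>u. \<integral>\<^sup>+w. ?h k u w \<partial>P) \<in> borel_measurable \<nu>" by (rule hm1)
  have Xs: "(\<lambda>t. X (u, t) w) \<in> borel_measurable L" if "w \<in> space P" for u w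
    using measurable_compose[OF measurable_Pair1'[OF that] X_section(2)] by simp
  have "(\<Sum>k=1..K. \<integral>\<^sup>+u. \<integral>\<^sup>+w. ?h k u w \<partial>P \<partial>\<nu>) = (\<integral>\<^sup>+u. \<integral>\<^sup>+w. (\<Sum>k=1..K. ?h k u w) \<partial>P \<partial>\<nu>)"
    by (subst nn_integral_sum[symmetric], rule hm1, simp, rule nn_integral_cong,
        subst nn_integral_sum[symmetric], rule hm2, simp, rule refl)
  also have "\<dots> \<le> (\<integral>\<^sup>+u. \<integral>\<^sup>+w. \<integral>\<^sup>+t. ennreal ((X (u, t) w)\<^sup>2) \<partial>L \<partial>P \<partial>\<nu>)"
    by (intro nn_integral_mono order_trans[OF bessel_inequality[OF basis Xs]]) (simp_all add: sq_norm_def)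
  also have "\<dots> = (\<integral>\<^sup>+u. \<integral>\<^sup>+t. second_moment u t \<partial>L \<partial>\<nu>)"
  proof (rule nn_integral_cong)
    fix u
    interpret PL: pair_sigma_finite P L ..
    have "(\<lambda>x. ennreal ((X (u, snd x) (fst x))\<^sup>2)) \<in> borel_measurable (P \<Otimes>\<^sub>M L)"
      using X_section(2)[of u] by measurable
    from PL.Fubini[OF this]
    show "(\<integral>\<^sup>+w. \<integral>\<^sup>+t. ennreal ((X (u, t) w)\<^sup>2) \<partial>L \<partial>P) = (\<integral>\<^sup>+t. second_moment u t \<partial>L)"
      by (simp add: second_moment_def)
  qed
  also have "\<dots> = C2 P field_space X" by (rule integral_second_moment)
  finally show "(\<Sum>k=1..K. \<integral>\<^sup>+u. \<integral>\<^sup>+w. ?h k u w \<partial>P \<partial>\<nu>) \<le> C2 P field_space X" .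
qed

text \<open>With t outermost, the integral over u is at most the numerator of \<open>C1\<close>
  uniformly in t, and 1/g is at most 1/\<open>\<gamma>\<close>. What remains is the integral of the
  squared basis function, which is one.\<close>

lemma diagonal_le_C1:
  assumes C2: "C2 P field_space X < \<infinity>" and \<gamma>: "\<gamma> = (INF t\<in>{a..b}. g t)"
    and mu [measurable]: "\<mu> \<in> borel_measurable field_space"
    and phi [measurable]: "\<phi> \<in> borel_measurable L" and unit: "sq_norm L \<phi> = 1"
  shows "(\<integral>\<^sup>+u. \<integral>\<^sup>+t. (ennreal ((\<mu> (u, t))\<^sup>2) + second_moment u t + ennreal ((\<tau> t)\<^sup>2)) * ennreal ((\<phi> t)\<^sup>2 / g t) \<partial>L \<partial>\<nu>)
    \<le> C1 P \<nu> a b \<mu> X \<tau> g"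
proof -
  interpret nu: sigma_finite_measure \<nu> by (rule sigma_finite_spaces)
  interpret L: sigma_finite_measure L by (rule sigma_finite_spaces)
  interpret nuL: pair_sigma_finite \<nu> L ..
  note [measurable] = tau_meas g_meas second_moment_joint
  \<comment> \<open>The numerator of \<open>C1\<close>. It may be infinite, so the comparison is
    made entirely in the nonnegative extended reals.\<close>
  define Q where "Q = (SUP t\<in>{a..b}. sq_norm \<nu> (\<lambda>u. \<mu> (u, t)))
        + sup_norm ({a..b} \<times> {a..b}) (cov_kernel P \<nu> X)
        + (sup_norm {a..b} \<tau>)\<^sup>2 * emeasure \<nu> (space \<nu>)"
  let ?h = "\<lambda>u t. ennreal ((\<mu> (u, t))\<^sup>2) + second_moment u t + ennreal ((\<tau> t)\<^sup>2)"
  have hm: "(\<lambda>x. ?h (fst x) (snd x)) \<in> borel_measurable field_space" by measurable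
  have hm': "(\<lambda>u. ?h u t) \<in> borel_measurable \<nu>" "(\<lambda>u. second_moment u t) \<in> borel_measurable \<nu>"
    "(\<lambda>u. \<mu> (u, t)) \<in> borel_measurable \<nu>" if "t \<in> {a..b}" for t
    using measurable_compose[OF measurable_Pair2' hm, of t] measurable_compose[OF measurable_Pair2' second_moment_joint, of t]
      measurable_compose[OF measurable_Pair2' mu, of t] that by simp_all
  have "(\<integral>\<^sup>+u. \<integral>\<^sup>+t. ?h u t * ennreal ((\<phi> t)\<^sup>2 / g t) \<partial>L \<partial>\<nu>) = (\<integral>\<^sup>+t. \<integral>\<^sup>+u. ?h u t * ennreal ((\<phi> t)\<^sup>2 / g t) \<partial>\<nu> \<partial>L)"
    using nuL.Fubini[of "\<lambda>x. ?h (fst x) (snd x) * ennreal ((\<phi> (snd x))\<^sup>2 / g (snd x))"] by simp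
  also have "\<dots> \<le> (\<integral>\<^sup>+t. ennreal ((\<phi> t)\<^sup>2) * (Q / ennreal \<gamma>) \<partial>L)"
  proof (rule nn_integral_mono_AE)
    show "AE t in L. (\<integral>\<^sup>+u. ?h u t * ennreal ((\<phi> t)\<^sup>2 / g t) \<partial>\<nu>) \<le> ennreal ((\<phi> t)\<^sup>2) * (Q / ennreal \<gamma>)"
      using second_moment_le_cov_kernel[OF C2] AE_space
    proof eventually_elim
      case (elim t)
      then have t: "t \<in> {a..b}" by simp
      have "(\<integral>\<^sup>+u. ?h u t \<partial>\<nu>) = sq_norm \<nu> (\<lambda>u. \<mu> (u, t)) + (\<integral>\<^sup>+u. second_moment u t \<partial>\<nu>) + ennreal ((\<tau> t)\<^sup>2) * emeasure \<nu> (space \<nu>)"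
        using hm'[OF t] by (simp add: nn_integral_add sq_norm_def)
      also have "\<dots> \<le> Q"
        unfolding Q_def
      proof (intro add_mono mult_right_mono elim(1))
        show "sq_norm \<nu> (\<lambda>u. \<mu> (u, t)) \<le> (SUP t\<in>{a..b}. sq_norm \<nu> (\<lambda>u. \<mu> (u, t)))"
          by (rule SUP_upper[OF t])
        have "ennreal \<bar>\<tau> t\<bar> \<le> sup_norm {a..b} \<tau>"
          unfolding sup_norm_def by (rule SUP_upper[OF t])
        then have "(ennreal \<bar>\<tau> t\<bar>)\<^sup>2 \<le> (sup_norm {a..b} \<tau>)\<^sup>2" by (rule power_mono) simp
        then show "ennreal ((\<tau> t)\<^sup>2) \<le> (sup_norm {a..b} \<tau>)\<^sup>2" by (simp add: ennreal_power)
      qed simp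
      finally have Q: "(\<integral>\<^sup>+u. ?h u t \<partial>\<nu>) \<le> Q" .
      have "(\<phi> t)\<^sup>2 / g t \<le> (\<phi> t)\<^sup>2 / \<gamma>"
        using g_ge[OF t] \<gamma>_pos by (intro divide_left_mono) (auto intro!: mult_pos_pos)
      then have "ennreal ((\<phi> t)\<^sup>2 / g t) \<le> ennreal ((\<phi> t)\<^sup>2) / ennreal \<gamma>"
        using \<gamma>_pos by (simp add: divide_ennreal ennreal_leI)
      then have "(\<integral>\<^sup>+u. ?h u t \<partial>\<nu>) * ennreal ((\<phi> t)\<^sup>2 / g t) \<le> Q * (ennreal ((\<phi> t)\<^sup>2) / ennreal \<gamma>)"
        by (rule mult_mono[OF Q]) simp_all
      moreover have "(\<integral>\<^sup>+u. ?h u t * ennreal ((\<phi> t)\<^sup>2 / g t) \<partial>\<nu>) = (\<integral>\<^sup>+u. ?h u t \<partial>\<nu>) * ennreal ((\<phi> t)\<^sup>2 / g t)"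
        by (rule nn_integral_multc[OF hm'(1)[OF t]])
      moreover have "Q * (ennreal ((\<phi> t)\<^sup>2) / ennreal \<gamma>) = ennreal ((\<phi> t)\<^sup>2) * (Q / ennreal \<gamma>)"
        unfolding ennreal_times_divide by (subst mult.commute) (rule refl)
      ultimately show ?case by simp
    qed
  qed
  also have "\<dots> = Q / ennreal \<gamma>"
    using unit by (simp add: nn_integral_multc sq_norm_def)
  also have "\<dots> = C1 P \<nu> a b \<mu> X \<tau> g"
    by (simp add: C1_def Q_def \<gamma>)
  finally show ?thesis .
qed

end

text \<open>The variance produces ordered pairs of distinct visits. Pairs sharing a subject amount
  to a subject with an ordered pair of distinct visit numbers.\<close>

lemma sum_visits_same_subject:
  "(\<Sum>p\<in>visits n m. \<Sum>q\<in>visits n m - {p}. if fst p = fst q then h (fst p) (snd p) * h (fst q) (snd q) else 0)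
    = (\<Sum>i=1..n. \<Sum>j=1..m i. \<Sum>j'\<in>{1..m i} - {j}. h i j * h i j' :: real)"
proof -
  have inner: "(\<Sum>q\<in>visits n m - {(i, j)}. if i = fst q then h i j * h (fst q) (snd q) else 0)
      = (\<Sum>j'\<in>{1..m i} - {j}. h i j * h i j')" if "i \<in> {1..n}" for i j
  proof -
    have "(\<Sum>q\<in>visits n m - {(i, j)}. if i = fst q then h i j * h (fst q) (snd q) else 0)
      = (\<Sum>q\<in>{q \<in> visits n m - {(i, j)}. i = fst q}. h i j * h (fst q) (snd q))"
      by (rule sum.inter_filter[symmetric]) (simp add: visits_def)
    also have "{q \<in> visits n m - {(i, j)}. i = fst q} = Pair i ` ({1..m i} - {j})"
      using that by (auto simp: visits_def)
    also have "(\<Sum>q\<in>Pair i ` ({1..m i} - {j}). h i j * h (fst q) (snd q)) = (\<Sum>j'\<in>{1..m i} - {j}. h i j * h i j')"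
      by (subst sum.reindex) (auto simp: inj_on_def)
    finally show ?thesis .
  qed
  have "(\<Sum>p\<in>visits n m. \<Sum>q\<in>visits n m - {p}. if fst p = fst q then h (fst p) (snd p) * h (fst q) (snd q) else 0)
    = (\<Sum>(i, j)\<in>visits n m. \<Sum>j'\<in>{1..m i} - {j}. h i j * h i j')"
  proof (rule sum.cong[OF refl])
    fix p assume p: "p \<in> visits n m"
    obtain i j where ij: "p = (i, j)" by (cases p)
    with p have "i \<in> {1..n}" by (simp add: visits_def)
    then show "(\<Sum>q\<in>visits n m - {p}. if fst p = fst q then h (fst p) (snd p) * h (fst q) (snd q) else 0)
        = (case p of (i, j) \<Rightarrow> \<Sum>j'\<in>{1..m i} - {j}. h i j * h i j')"
      unfolding ij fst_conv snd_conv prod.case by (rule inner)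
  qed
  then show ?thesis
    unfolding visits_def by (subst sum.Sigma) auto
qed

section \<open>From scalar risks to the sum over coefficients\<close>

context longitudinal_model
begin

text \<open>Prepares Tonelli over (w, u). Nothing is frozen here, so joint measurability with
  respect to \<open>P\<close> suffices and composition with the design point is direct.\<close>

lemma observation_measurable:
  assumes p: "(i, j) \<in> I" and mu: "\<mu> \<in> borel_measurable field_space"
  shows "(\<lambda>x. \<mu> (snd x, T i j (fst x)) + noise (snd x) (i, j) (fst x, T i j (fst x))) \<in> borel_measurable (P \<Otimes>\<^sub>M \<nu>)"
proof -
  note [measurable] = T_measurable[OF p] tau_meas
  have pair: "(\<lambda>x. (snd x, T i j (fst x))) \<in> P \<Otimes>\<^sub>M \<nu> \<rightarrow>\<^sub>M field_space" by measurable
  have "(\<lambda>x. \<mu> (snd x, T i j (fst x))) \<in> borel_measurable (P \<Otimes>\<^sub>M \<nu>)"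
    by (rule measurable_compose[OF pair mu])
  moreover have "(\<lambda>x. (fst x, (snd x, T i j (fst x)))) \<in> P \<Otimes>\<^sub>M \<nu> \<rightarrow>\<^sub>M P \<Otimes>\<^sub>M field_space"
    by (intro measurable_Pair measurable_fst pair)
  from measurable_compose[OF this random_field_joint[OF Xs_field[OF visitsD[OF p]]]]
  have "(\<lambda>x. Xs i (snd x, T i j (fst x)) (fst x)) \<in> borel_measurable (P \<Otimes>\<^sub>M \<nu>)" by simp
  moreover have "(\<lambda>x. \<eta> i j (snd x) (fst x)) \<in> borel_measurable (P \<Otimes>\<^sub>M \<nu>)"
    using random_field_joint[OF eta_field[OF p]] by (simp add: case_prod_unfold)
  ultimately show ?thesis unfolding noise_def fst_conv snd_conv by measurable
qed

text \<open>The two parts are treated differently in k. Each diagonal term is bounded by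
  \<open>C1\<close>, which produces the factor K. The within-subject terms are summed before they
  are bounded, so that Bessel's inequality gives a single \<open>C2\<close> for all
  coefficients.\<close>

lemma series_risk_bound:
  fixes \<omega> :: "nat \<Rightarrow> nat \<Rightarrow> real" and Y :: "nat \<Rightarrow> nat \<Rightarrow> 'u \<Rightarrow> 'w \<Rightarrow> real"
  assumes C2: "C2 P field_space X < \<infinity>" and \<gamma>: "\<gamma> = (INF t\<in>{a..b}. g t)"
    and mu: "square_integrable field_space \<mu>"
    and basis: "orthonormal_basis L \<phi>"
    and bdd: "\<And>k. 1 \<le> k \<Longrightarrow> \<exists>B. \<forall>t\<in>{a..b}. \<bar>\<phi> k t\<bar> \<le> B"
    and \<omega>: "(\<Sum>(i, j)\<in>I. \<omega> i j) = 1"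
    and Y: "\<And>i j u w. (i, j) \<in> I \<Longrightarrow> w \<in> space P \<Longrightarrow>
      Y i j u w = \<mu> (u, T i j w) + noise u (i, j) (w, T i j w)"
  defines "S2 \<equiv> \<Sum>(i, j)\<in>I. (\<omega> i j)\<^sup>2"
    and "D2 \<equiv> max (\<Sum>i=1..n. \<Sum>j=1..m i. \<Sum>j'\<in>{1..m i} - {j}. \<omega> i j * \<omega> i j') 0"
    and "bh \<equiv> beta_hat n m \<omega> Y T g \<phi>"
  shows "\<And>k. k \<in> {1..K} \<Longrightarrow> (\<lambda>x. bh k (snd x) (fst x)) \<in> borel_measurable (P \<Otimes>\<^sub>M \<nu>)"
    and "(\<Sum>k=1..K. \<integral>\<^sup>+u. \<integral>\<^sup>+w. ennreal ((bh k u w - basis_coeff L \<phi> \<mu> k u)\<^sup>2) \<partial>P \<partial>\<nu>)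
        + ennreal S2 * (\<Sum>k=1..K. sq_norm \<nu> (basis_coeff L \<phi> \<mu> k))
      \<le> ennreal S2 * (of_nat K * C1 P \<nu> a b \<mu> X \<tau> g) + ennreal D2 * C2 P field_space X"
proof -
  interpret nu: sigma_finite_measure \<nu> by (rule sigma_finite_spaces)
  interpret L: sigma_finite_measure L by (rule sigma_finite_spaces)
  interpret nuL: pair_sigma_finite \<nu> L ..
  interpret Pnu: pair_sigma_finite P \<nu> ..
  let ?\<beta> = "basis_coeff L \<phi> \<mu>"
  define c where "c p = \<omega> (fst p) (snd p)" for p
  have mu_m [measurable]: "\<mu> \<in> borel_measurable field_space"
    using mu by (simp add: square_integrable_def)
  have S2: "S2 = (\<Sum>p\<in>I. (c p)\<^sup>2)" by (simp add: S2_def c_def case_prod_unfold)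
  have D2: "D2 = max (\<Sum>p\<in>I. \<Sum>q\<in>I - {p}. if fst p = fst q then c p * c q else 0) 0"
    unfolding D2_def c_def sum_visits_same_subject ..
  have c1: "(\<Sum>p\<in>I. c p) = 1" using \<omega> by (simp add: c_def case_prod_unfold)
  have phi_m: "\<phi> k \<in> borel_measurable L" if "1 \<le> k" for k
    using basis that unfolding orthonormal_basis_def square_integrable_def by blast
  let ?T = "\<lambda>(i, j). T i j"
  let ?b = "\<lambda>k u w. \<Sum>p\<in>I. c p * ((\<mu> (u, ?T p w) + noise u p (w, ?T p w)) * \<phi> k (?T p w) / g (?T p w))"
  have b_eq: "bh k u w = ?b k u w" if "w \<in> space P" for k u w
    unfolding bh_def beta_hat_def c_def
    by (intro sum.cong refl) (use Y that in auto)
  have b_m: "(\<lambda>x. bh k (snd x) (fst x)) \<in> borel_measurable (P \<Otimes>\<^sub>M \<nu>)" if k: "1 \<le> k" for k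
  proof -
    have "(\<lambda>x. ?b k (snd x) (fst x)) \<in> borel_measurable (P \<Otimes>\<^sub>M \<nu>)"
    proof (rule borel_measurable_sum)
      fix p assume p: "p \<in> I"
      obtain i j where ij: "p = (i, j)" "(i, j) \<in> I" using p by (cases p) auto
      note [measurable] = observation_measurable[OF ij(2) mu_m] T_measurable[OF ij(2)] g_meas phi_m[OF k]
      show "(\<lambda>x. c p * ((\<mu> (snd x, ?T p (fst x)) + noise (snd x) p (fst x, ?T p (fst x))) * \<phi> k (?T p (fst x)) / g (?T p (fst x))))
        \<in> borel_measurable (P \<Otimes>\<^sub>M \<nu>)"
        unfolding ij(1) prod.case by measurable
    qed
    moreover have "(\<lambda>x. bh k (snd x) (fst x)) \<in> borel_measurable (P \<Otimes>\<^sub>M \<nu>)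
        \<longleftrightarrow> (\<lambda>x. ?b k (snd x) (fst x)) \<in> borel_measurable (P \<Otimes>\<^sub>M \<nu>)"
      by (rule measurable_cong) (rule b_eq, auto simp: space_pair_measure)
    ultimately show ?thesis by simp
  qed
  then show "\<And>k. k \<in> {1..K} \<Longrightarrow> (\<lambda>x. bh k (snd x) (fst x)) \<in> borel_measurable (P \<Otimes>\<^sub>M \<nu>)" by simp
  have \<beta>_m: "?\<beta> k \<in> borel_measurable \<nu>" if "1 \<le> k" for k
  proof -
    note [measurable] = phi_m[OF that]
    show ?thesis unfolding basis_coeff_def[abs_def] by measurable
  qed
  let ?e = "\<lambda>k u. \<integral>\<^sup>+w. ennreal ((bh k u w - ?\<beta> k u)\<^sup>2) \<partial>P"
  let ?J = "\<lambda>k u. \<integral>\<^sup>+t. (ennreal ((\<mu> (u, t))\<^sup>2) + second_moment u t + ennreal ((\<tau> t)\<^sup>2)) * ennreal ((\<phi> k t)\<^sup>2 / g t) \<partial>L"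
  let ?v = "\<lambda>k u. \<integral>\<^sup>+w. ennreal ((\<integral>t. X (u, t) w * \<phi> k t \<partial>L)\<^sup>2) \<partial>P"
  have e_m: "?e k \<in> borel_measurable \<nu>" if k: "1 \<le> k" for k
  proof -
    note [measurable] = b_m[OF k] \<beta>_m[OF k]
    have "(\<lambda>x. ennreal ((bh k (snd x) (fst x) - ?\<beta> k (snd x))\<^sup>2)) \<in> borel_measurable (P \<Otimes>\<^sub>M \<nu>)" by measurable
    from borel_measurable_nn_integral_fst[OF measurable_compose[OF measurable_pair_swap' this]]
    show ?thesis by (simp add: case_prod_unfold)
  qed
  have J_m: "?J k \<in> borel_measurable \<nu>" if k: "1 \<le> k" for k
  proof -
    note [measurable] = tau_meas g_meas second_moment_joint phi_m[OF k]
    have "(\<lambda>x. (ennreal ((\<mu> x)\<^sup>2) + second_moment (fst x) (snd x) + ennreal ((\<tau> (snd x))\<^sup>2)) * ennreal ((\<phi> k (snd x))\<^sup>2 / g (snd x)))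
      \<in> borel_measurable field_space" by measurable
    from L.borel_measurable_nn_integral_fst[OF this] show ?thesis by simp
  qed
  have v_m: "?v k \<in> borel_measurable \<nu>" if k: "1 \<le> k" for k
    by (rule score_second_moment_sum(2)[OF basis k])
  have fin: "AE u in \<nu>. (\<integral>\<^sup>+t. second_moment u t \<partial>L) \<noteq> \<infinity>"
  proof (rule nn_integral_PInf_AE)
    show "(\<lambda>u. \<integral>\<^sup>+t. second_moment u t \<partial>L) \<in> borel_measurable \<nu>"
      using L.borel_measurable_nn_integral_fst[OF second_moment_joint] by simp
    show "(\<integral>\<^sup>+u. \<integral>\<^sup>+t. second_moment u t \<partial>L \<partial>\<nu>) \<noteq> \<infinity>"
      using C2 integral_second_moment by auto
  qed
  \<comment> \<open>Only the statement about sections is wanted, so the empty series with K = 0 and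
    the zero estimator is inserted.\<close>
  have mu_ae: "AE u in \<nu>. square_integrable L (\<lambda>t. \<mu> (u, t))"
    by (rule risk_series_estimator(3)[OF prob_space_axioms nu_finite finite_L basis mu, of 0 "\<lambda>_ _ _. 0"]) simp
  have main: "(\<integral>\<^sup>+u. ?e k u \<partial>\<nu>) + ennreal S2 * sq_norm \<nu> (?\<beta> k)
      \<le> ennreal S2 * C1 P \<nu> a b \<mu> X \<tau> g + ennreal D2 * (\<integral>\<^sup>+u. ?v k u \<partial>\<nu>)" if k: "1 \<le> k" for k
  proof -
    obtain B where B: "\<forall>t\<in>{a..b}. \<bar>\<phi> k t\<bar> \<le> B" using bdd[OF k] by auto
    have phi1: "sq_norm L (\<phi> k) = 1"
    proof -
      have "square_integrable L (\<phi> k)" "(\<integral>x. \<phi> k x * \<phi> k x \<partial>L) = 1"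
        using basis k by (simp_all add: orthonormal_basis_def)
      then show ?thesis by (simp add: sq_norm_eq_ennreal power2_eq_square)
    qed
    have "(\<integral>\<^sup>+u. ?e k u \<partial>\<nu>) + ennreal S2 * sq_norm \<nu> (?\<beta> k) = (\<integral>\<^sup>+u. ?e k u + ennreal S2 * ennreal ((?\<beta> k u)\<^sup>2) \<partial>\<nu>)"
      using e_m[OF k] \<beta>_m[OF k] by (simp add: nn_integral_add nn_integral_cmult sq_norm_def)
    also have "\<dots> \<le> (\<integral>\<^sup>+u. ennreal S2 * ?J k u + ennreal D2 * ?v k u \<partial>\<nu>)"
    proof (rule nn_integral_mono_AE)
      show "AE u in \<nu>. ?e k u + ennreal S2 * ennreal ((?\<beta> k u)\<^sup>2) \<le> ennreal S2 * ?J k u + ennreal D2 * ?v k u"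
        using fin mu_ae
      proof eventually_elim
        case (elim u)
        have fin': "(\<integral>\<^sup>+t. second_moment u t \<partial>L) < \<infinity>" using elim(1) by (simp add: less_top)
        have e: "?e k u = (\<integral>\<^sup>+w. ennreal ((?b k u w - ?\<beta> k u)\<^sup>2) \<partial>P)"
          by (rule nn_integral_cong) (simp only: b_eq)
        have f: "(\<lambda>t. \<mu> (u, t)) \<in> borel_measurable L" "integrable L (\<lambda>t. (\<mu> (u, t))\<^sup>2)"
          using elim(2) by (auto simp: square_integrable_def)
        show ?case
          unfolding e D2 S2 using pointwise_risk[OF fin' f phi_m[OF k] B c1]
          by (simp add: basis_coeff_def ennreal_mult sum_nonneg)
      qed
    qed
    also have "\<dots> = ennreal S2 * (\<integral>\<^sup>+u. ?J k u \<partial>\<nu>) + ennreal D2 * (\<integral>\<^sup>+u. ?v k u \<partial>\<nu>)"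
      using J_m[OF k] v_m[OF k] by (simp add: nn_integral_add nn_integral_cmult)
    also have "\<dots> \<le> ennreal S2 * C1 P \<nu> a b \<mu> X \<tau> g + ennreal D2 * (\<integral>\<^sup>+u. ?v k u \<partial>\<nu>)"
      by (intro add_right_mono mult_left_mono diagonal_le_C1[OF C2 \<gamma> mu_m phi_m[OF k] phi1]) simp
    finally show ?thesis .
  qed
  have "(\<Sum>k=1..K. \<integral>\<^sup>+u. ?e k u \<partial>\<nu>) + ennreal S2 * (\<Sum>k=1..K. sq_norm \<nu> (?\<beta> k))
      = (\<Sum>k=1..K. (\<integral>\<^sup>+u. ?e k u \<partial>\<nu>) + ennreal S2 * sq_norm \<nu> (?\<beta> k))"
    by (simp add: sum.distrib sum_distrib_left)
  also have "\<dots> \<le> (\<Sum>k=1..K. ennreal S2 * C1 P \<nu> a b \<mu> X \<tau> g + ennreal D2 * (\<integral>\<^sup>+u. ?v k u \<partial>\<nu>))"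
    by (rule sum_mono) (rule main, simp)
  also have "\<dots> = ennreal S2 * (of_nat K * C1 P \<nu> a b \<mu> X \<tau> g) + ennreal D2 * (\<Sum>k=1..K. \<integral>\<^sup>+u. ?v k u \<partial>\<nu>)"
    by (simp add: sum.distrib sum_distrib_left mult.left_commute)
  also have "\<dots> \<le> ennreal S2 * (of_nat K * C1 P \<nu> a b \<mu> X \<tau> g) + ennreal D2 * C2 P field_space X"
    by (intro add_left_mono mult_left_mono score_second_moment_sum(1)[OF basis]) simp
  finally show "(\<Sum>k=1..K. \<integral>\<^sup>+u. ?e k u \<partial>\<nu>) + ennreal S2 * (\<Sum>k=1..K. sq_norm \<nu> (?\<beta> k))
      \<le> ennreal S2 * (of_nat K * C1 P \<nu> a b \<mu> X \<tau> g) + ennreal D2 * C2 P field_space X" .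
qed

end

text \<open>Here r is the summed coefficient risk, bs the energy of the first K coefficients and tl
  the tail. Subtraction first appears at this point: bs is the full squared norm minus tl, and tl is
  at most t.\<close>

lemma bias_variance_combination:
  fixes r bs tl c1 c2 :: ennreal and S2 D2 t k :: real
  assumes bound: "r + ennreal S2 * bs \<le> ennreal S2 * (ennreal k * c1) + ennreal D2 * c2"
    and tl: "tl \<le> ennreal t" and fin: "bs + tl < \<infinity>" "c2 < \<infinity>"
    and pos: "0 < S2" "0 \<le> D2" "0 \<le> t" "0 < k"
  shows "enn2ereal (r + tl) \<le> ereal S2 * (enn2ereal c1 * ereal k - enn2ereal (bs + tl) + ereal t)
      + ereal D2 * enn2ereal c2 + ereal t"
proof -
  obtain b' where b': "bs = ennreal b'" "0 \<le> b'" using fin by (cases bs) auto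
  obtain l' where l': "tl = ennreal l'" "0 \<le> l'" using fin by (cases tl) auto
  obtain d' where d': "c2 = ennreal d'" "0 \<le> d'" using fin by (cases c2) auto
  show ?thesis
  proof (cases c1)
    \<comment> \<open>Positivity of S2 and k prevents a product of zero and infinity, so the
      right-hand side is infinite.\<close>
    case top
    then show ?thesis
      using pos b' l' d' by (simp add: ennreal_plus[symmetric] enn2ereal_ennreal del: ennreal_plus)
  next
    case (real c')
    have "r < \<infinity>"
    proof -
      have "r \<le> r + ennreal S2 * bs" by simp
      also have "\<dots> \<le> ennreal (S2 * (k * c') + D2 * d')"
        using bound real d' pos by (simp add: ennreal_mult[symmetric] ennreal_plus[symmetric] del: ennreal_plus)
      finally show ?thesis using le_less_trans by fastforce
    qed
    then obtain r' where r': "r = ennreal r'" "0 \<le> r'" by (cases r) auto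
    have "r' + S2 * b' \<le> S2 * (k * c') + D2 * d'"
      using bound real d' b' r' pos
      by (simp add: ennreal_mult[symmetric] ennreal_plus[symmetric] del: ennreal_plus)
    moreover have lt: "l' \<le> t" using tl l' pos by simp
    \<comment> \<open>The tail bound is used twice: as it stands for the squared bias, and scaled by
      S2 to replace the energy of the first K coefficients by the full squared norm.\<close>
    moreover have "S2 * l' \<le> S2 * t" using lt pos by simp
    ultimately have "r' + l' \<le> S2 * (c' * k - (b' + l') + t) + D2 * d' + t"
      by (simp add: algebra_simps)
    then show ?thesis
      using real r' b' l' d' by (simp add: ennreal_plus[symmetric] enn2ereal_ennreal del: ennreal_plus)
  qed
qed

theorem theorem1:
  fixes P :: "'w measure"
    and \<nu> :: "'u::metric_space measure"
    and a b :: real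
    and n :: nat and m :: "nat \<Rightarrow> nat"
    and \<mu> :: "'u \<times> real \<Rightarrow> real"
    and X :: "'u \<times> real \<Rightarrow> 'w \<Rightarrow> real" and Xs :: "nat \<Rightarrow> 'u \<times> real \<Rightarrow> 'w \<Rightarrow> real"
    and T\<^sub>0 :: "'w \<Rightarrow> real" and T :: "nat \<Rightarrow> nat \<Rightarrow> 'w \<Rightarrow> real"
    and g \<tau> :: "real \<Rightarrow> real"
    and \<eta> \<epsilon> Y :: "nat \<Rightarrow> nat \<Rightarrow> 'u \<Rightarrow> 'w \<Rightarrow> real"
    and \<phi> :: "nat \<Rightarrow> real \<Rightarrow> real"
    and s C\<^sub>s :: real
    and \<omega> :: "nat \<Rightarrow> nat \<Rightarrow> real"
    and K :: nat
  assumes prob: "prob_space P"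
    and interval: "a < b"
    and separable: "separable_space (euclidean :: 'u topology)"
    and nu_borel: "sets \<nu> = sets borel"
    and nu_finite: "finite_measure \<nu>"
    and n_pos: "1 \<le> n"
    and m_pos: "\<And>i. i \<in> {1..n} \<Longrightarrow> 1 \<le> m i"
    and mu_L2: "square_integrable (\<nu> \<Otimes>\<^sub>M interval_lebesgue a b) \<mu>"
    and model: "\<And>i j u w. (i, j) \<in> visits n m \<Longrightarrow> w \<in> space P \<Longrightarrow>
          Y i j u w = \<mu> (u, T i j w) + Xs i (u, T i j w) w + \<epsilon> i j u w"
    and X_field: "random_field P (\<nu> \<Otimes>\<^sub>M interval_lebesgue a b) X"
    and X_sq: "C2 P (\<nu> \<Otimes>\<^sub>M interval_lebesgue a b) X < \<infinity>"
    and X_mean: "\<And>u t. t \<in> {a..b} \<Longrightarrow> has_bochner_integral P (X (u, t)) 0"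
    and Xs_field: "\<And>i. i \<in> {1..n} \<Longrightarrow> random_field P (\<nu> \<Otimes>\<^sub>M interval_lebesgue a b) (Xs i)"
    and Xs_law: "\<And>i. i \<in> {1..n} \<Longrightarrow>
          same_field_law P (\<nu> \<Otimes>\<^sub>M interval_lebesgue a b) (Xs i) X"
    and Xs_indep: "indep_fields P (\<nu> \<Otimes>\<^sub>M interval_lebesgue a b) Xs {1..n}"
    and T_density: "distributed P (interval_lebesgue a b) T\<^sub>0 (\<lambda>t. ennreal (g t))"
    and T_law: "\<And>i j. (i, j) \<in> visits n m \<Longrightarrow>
          distr P (interval_lebesgue a b) (T i j) = distr P (interval_lebesgue a b) T\<^sub>0"
    and T_indep: "prob_space.indep_vars P (\<lambda>_. interval_lebesgue a b) (\<lambda>(i, j). T i j) (visits n m)"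
    and g_lipschitz: "\<exists>L. L-lipschitz_on {a..b} g"
    and g_pos: "\<And>t. t \<in> {a..b} \<Longrightarrow> 0 < g t"
    and noise: "\<And>i j u w. (i, j) \<in> visits n m \<Longrightarrow> w \<in> space P \<Longrightarrow>
          \<epsilon> i j u w = \<tau> (T i j w) * \<eta> i j u w"
    and tau_meas: "\<tau> \<in> borel_measurable (interval_lebesgue a b)"
    and tau_nonneg: "\<And>t. t \<in> {a..b} \<Longrightarrow> 0 \<le> \<tau> t"
    and tau_bounded: "bounded (\<tau> ` {a..b})"
    and eta_field: "\<And>i j. (i, j) \<in> visits n m \<Longrightarrow> random_field P \<nu> (\<eta> i j)"
    and eta_law: "\<And>i j i' j'. (i, j) \<in> visits n m \<Longrightarrow> (i', j') \<in> visits n m \<Longrightarrow>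
          same_field_law P \<nu> (\<eta> i j) (\<eta> i' j')"
    and eta_indep: "indep_fields P \<nu> (\<lambda>(i, j). \<eta> i j) (visits n m)"
    and eta_mean: "\<And>i j u. (i, j) \<in> visits n m \<Longrightarrow> has_bochner_integral P (\<eta> i j u) 0"
    and eta_var: "\<And>i j u. (i, j) \<in> visits n m \<Longrightarrow> prob_space.variance P (\<eta> i j u) = 1"
    and indep: "prob_space.indep_sets P
          (\<lambda>l. [joint_sigma P (visits n m)
                  (\<lambda>(i, j). vimage_algebra (space P) (T i j) (interval_lebesgue a b)),
                joint_sigma P {1..n}
                  (\<lambda>i. field_algebra P (\<nu> \<Otimes>\<^sub>M interval_lebesgue a b) (Xs i)),
                joint_sigma P (visits n m)
                  (\<lambda>(i, j). field_algebra P \<nu> (\<eta> i j))] ! l) {0, 1, 2}"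
    and basis: "orthonormal_basis (interval_lebesgue a b) \<phi>"
    and basis_lipschitz: "\<And>k. 1 \<le> k \<Longrightarrow> \<exists>L. L-lipschitz_on {a..b} (\<phi> k)"
    and s_pos: "0 < s"
    and Cs_pos: "0 < C\<^sub>s"
    and smooth: "(\<Sum>\<^sub>\<infinity>k\<in>{1..}. ennreal (real k powr (2 * s)) *
          sq_norm \<nu> (basis_coeff (interval_lebesgue a b) \<phi> \<mu> k)) \<le> ennreal C\<^sub>s"
    and cov_cont: "continuous_on ({a..b} \<times> {a..b}) (cov_kernel P \<nu> X)"
    and weights: "admissible_weights P (interval_lebesgue a b) n m T\<^sub>0 T \<omega>"
    and K_pos: "1 \<le> K"
  shows "enn2ereal (risk P (\<nu> \<Otimes>\<^sub>M interval_lebesgue a b) (mu_hat n m \<omega> Y T g \<phi> K) \<mu>)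
     \<le> ereal (\<Sum>(i, j)\<in>visits n m. (\<omega> i j)\<^sup>2)
          * (enn2ereal (C1 P \<nu> a b \<mu> X \<tau> g) * ereal (real K)
             - enn2ereal (sq_norm (\<nu> \<Otimes>\<^sub>M interval_lebesgue a b) \<mu>)
             + ereal (C\<^sub>s * real K powr (- 2 * s)))
       + ereal (max (\<Sum>i=1..n. \<Sum>j=1..m i. \<Sum>j'\<in>{1..m i} - {j}. \<omega> i j * \<omega> i j') 0)
          * enn2ereal (C2 P (\<nu> \<Otimes>\<^sub>M interval_lebesgue a b) X)
       + ereal (C\<^sub>s * real K powr (- 2 * s))"
proof -
  interpret prob_space P by (rule prob)
  let ?L = "interval_lebesgue a b"
  let ?S = "\<nu> \<Otimes>\<^sub>M ?L"
  define \<gamma> where "\<gamma> = (INF t\<in>{a..b}. g t)"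
  have ne: "{a..b} \<noteq> {}" using interval by simp
  obtain Lg where "Lg-lipschitz_on {a..b} g" using g_lipschitz by auto
  then have "continuous_on {a..b} g" by (rule lipschitz_on_continuous_on)
  \<comment> \<open>Pointwise positivity of \<open>g\<close> alone would allow infimum 0; on a
    compact interval the infimum is attained and therefore positive.\<close>
  from continuous_attains_inf[OF compact_Icc ne this]
  obtain t0 where t0: "t0 \<in> {a..b}" "\<forall>t\<in>{a..b}. g t0 \<le> g t" by auto
  have \<gamma>_eq: "\<gamma> = g t0"
    unfolding \<gamma>_def by (rule cInf_eq_minimum) (use t0 in auto)
  obtain \<tau>' where \<tau>': "\<forall>t\<in>{a..b}. \<bar>\<tau> t\<bar> \<le> \<tau>'"
    using tau_bounded by (auto simp: bounded_iff)
  have ij: "(1, 1) \<in> visits n m" using n_pos m_pos[of 1] by (simp add: visits_def)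
  have g_meas: "g \<in> borel_measurable ?L"
    by (rule distributed_real_measurable[OF _ T_density]) (use g_pos in \<open>auto intro: less_imp_le\<close>)
  interpret longitudinal_model P \<nu> a b n m X Xs T g \<tau> \<gamma> \<tau>' \<eta>
  proof (intro longitudinal_model.intro longitudinal_model_axioms.intro)
    show "visits n m \<noteq> {}" using ij by auto
    show "distr P ?L (T i j) = density ?L (\<lambda>t. ennreal (g t))" if "(i, j) \<in> visits n m" for i j
      using T_law[OF that] distributed_distr_eq_density[OF T_density] by simp
    show "0 < \<gamma>" using g_pos[OF t0(1)] by (simp add: \<gamma>_eq)
    show "\<gamma> \<le> g t" if "t \<in> {a..b}" for t using t0 that by (simp add: \<gamma>_eq)
    show "\<bar>\<tau> t\<bar> \<le> \<tau>'" if "t \<in> {a..b}" for t using \<tau>' that by simp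
  qed (fact prob nu_borel nu_finite X_field X_mean Xs_field Xs_law Xs_indep T_indep g_meas tau_meas
      eta_field eta_indep eta_mean eta_var indep)+
  \<comment> \<open>The Lipschitz condition enters through boundedness of each basis function on the
    compact interval, with a bound that may depend on k but does not appear in the result.\<close>
  have bdd: "\<exists>B. \<forall>t\<in>{a..b}. \<bar>\<phi> k t\<bar> \<le> B" if k: "1 \<le> k" for k
  proof -
    obtain M where "M-lipschitz_on {a..b} (\<phi> k)" using basis_lipschitz[OF k] by auto
    then have "bounded (\<phi> k ` {a..b})"
      by (intro compact_imp_bounded compact_continuous_image lipschitz_on_continuous_on) auto
    then show ?thesis by (auto simp: bounded_iff)
  qed
  have \<omega>: "(\<Sum>(i, j)\<in>visits n m. \<omega> i j) = 1"
    using weights by (simp add: admissible_weights_def)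
  have Y: "Y i j u w = \<mu> (u, T i j w) + noise u (i, j) (w, T i j w)"
    if "(i, j) \<in> visits n m" "w \<in> space P" for i j u w
    by (simp add: model[OF that] noise[OF that] noise_def)
  let ?S2 = "\<Sum>(i, j)\<in>visits n m. (\<omega> i j)\<^sup>2"
  let ?D2 = "max (\<Sum>i=1..n. \<Sum>j=1..m i. \<Sum>j'\<in>{1..m i} - {j}. \<omega> i j * \<omega> i j') 0"
  let ?b = "beta_hat n m \<omega> Y T g \<phi>"
  let ?tail = "\<Sum>k. sq_norm \<nu> (basis_coeff ?L \<phi> \<mu> (K + 1 + k))"
  have b_meas: "(\<lambda>x. ?b k (snd x) (fst x)) \<in> borel_measurable (P \<Otimes>\<^sub>M \<nu>)" if "k \<in> {1..K}" for k
    using that by (intro series_risk_bound(1)[OF X_sq \<gamma>_def mu_L2 basis bdd \<omega> Y])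
  have bound: "(\<Sum>k=1..K. \<integral>\<^sup>+u. \<integral>\<^sup>+w. ennreal ((?b k u w - basis_coeff ?L \<phi> \<mu> k u)\<^sup>2) \<partial>P \<partial>\<nu>)
        + ennreal ?S2 * (\<Sum>k=1..K. sq_norm \<nu> (basis_coeff ?L \<phi> \<mu> k))
      \<le> ennreal ?S2 * (ennreal (real K) * C1 P \<nu> a b \<mu> X \<tau> g) + ennreal ?D2 * C2 P ?S X"
    unfolding ennreal_of_nat_eq_real_of_nat[symmetric]
    by (rule series_risk_bound(2)[OF X_sq \<gamma>_def mu_L2 basis bdd \<omega> Y])
  have risk: "risk P ?S (mu_hat n m \<omega> Y T g \<phi> K) \<mu>
      = (\<Sum>k=1..K. \<integral>\<^sup>+u. \<integral>\<^sup>+w. ennreal ((?b k u w - basis_coeff ?L \<phi> \<mu> k u)\<^sup>2) \<partial>P \<partial>\<nu>) + ?tail"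
    unfolding mu_hat_def
    by (rule risk_series_estimator(1)[OF prob nu_finite finite_L basis mu_L2 b_meas])
  have mu_norm: "sq_norm ?S \<mu> = (\<Sum>k=1..K. sq_norm \<nu> (basis_coeff ?L \<phi> \<mu> k)) + ?tail"
    by (rule risk_series_estimator(2)[OF prob nu_finite finite_L basis mu_L2 b_meas])
  \<comment> \<open>Weights with sum one cannot all vanish. Strict positivity matters when
    \<open>C1\<close> is infinite.\<close>
  have S2_pos: "0 < ?S2"
  proof -
    have "\<exists>p\<in>visits n m. (case p of (i, j) \<Rightarrow> \<omega> i j) \<noteq> 0"
      using \<omega> sum.neutral[of "visits n m" "\<lambda>(i, j). \<omega> i j"] by fastforce
    then obtain p where "p \<in> visits n m" "(case p of (i, j) \<Rightarrow> \<omega> i j) \<noteq> 0" by blast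
    then show ?thesis
      by (intro sum_pos2[of _ p]) (auto simp: visits_def)
  qed
  have tail: "(\<Sum>k. sq_norm \<nu> (basis_coeff ?L \<phi> \<mu> (K + 1 + k))) \<le> ennreal (C\<^sub>s * real K powr (- 2 * s))"
    by (rule smooth_tail_bound[OF smooth]) (use s_pos Cs_pos K_pos in auto)
  have mu_fin: "sq_norm ?S \<mu> < \<infinity>"
    using mu_L2 by (simp add: sq_norm_eq_ennreal)
  show ?thesis
    unfolding risk mu_norm
    by (rule bias_variance_combination[OF bound tail mu_fin[unfolded mu_norm] X_sq S2_pos])
       (use Cs_pos K_pos in simp_all)
qed

end
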